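(* Let $u=(u_1,\dots,u_d)$ be the solution of the system of stochastic heat equations in the context. For any $0<a<b<\infty$, there exists a constant $C>0$ such that for all integers $n\ge1$ and all $(t,x),(t^1,x^1),\dots,(t^n,x^n)\in[a,b]\times[-b,b]^N$, \[ \mathrm{Var}\big(u_1(t,x)\,|\,u_1(t^1,x^1),\dots,u_1(t^n,x^n)\big)\ge C\min_{1\le i\le n}\rho((t,x),(t^i,x^i))^2, \] where $\rho((t,x),(s,y))=|t-s|^{\frac{2-\beta}{4}}+|x-y|^{\frac{2-\beta}{2}}$.
   Context: Consider the system \[ \frac{\partial}{\partial t}u_j(t,x)=\Delta u_j(t,x)+\dot W_j(t,x),\quad t\ge 0,\ x\in\mathbb{R}^N,\qquad u_j(0,x)=0,\quad j=1,\dots,d, \] where $\dot W_1,\dots,\dot W_d$ are i.i.d. centered Gaussian noises and each $\dot W_j$ is either (i) white in time and colored in space with covariance $\mathbb{E}[\dot W_j(t,x)\dot W_j(s,y)]=\delta_0(t-s)|x-y|^{-\beta}$, where $N\ge 1$ and $0<\beta<\min(2,N)$; or (ii) space-time white noise with $N=1$, in which case one sets $\beta=1$. The solution is the mean zero Gaussian field $u=(u_1,\dots,u_d)$ with i.i.d. components \[ u_j(t,x)=\int_0^t\int_{\mathbb{R}^N}G(t-s,x-y)\,W_j(ds\,dy),\qquad G(t,x)=\frac{1}{(4\pi t)^{N/2}}\exp\Big(-\frac{|x|^2}{4t}\Big)\mathbf 1_{\{t>0\}}. \] *)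

theory Defs
  imports "HOL-Probability.Probability"
begin

definition centered_gaussian :: "'a measure \<Rightarrow> ('a \<Rightarrow> real) \<Rightarrow> bool" where
  "centered_gaussian M X \<longleftrightarrow> X \<in> borel_measurable M \<and>
     ((\<exists>\<sigma>>0. distributed M lborel X (normal_density 0 \<sigma>)) \<or> (AE \<omega> in M. X \<omega> = 0))"

text \<open>
  A spatially homogeneous noise that is white in time is described by a measure
  \<open>\<Lambda>\<close> on triples \<open>(s, y, z)\<close>, where \<open>s\<close> is a time and \<open>y, z\<close> are points of space: the formal covariance
  \<open>\<delta>\<^sub>0(t - s) f(y - z)\<close> means that the noise integrated against \<open>\<phi>\<close> and \<open>\<psi>\<close> has covariance
  \<open>\<integral> \<phi>(s,y) \<psi>(s,z) \<Lambda>(ds dy dz)\<close>. For space-time white noise \<open>\<Lambda>\<close> lives on the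
  diagonal \<open>y = z\<close>. In the coloured case the value of \<open>powr\<close> on the diagonal is irrelevant, as
  the diagonal is Lebesgue-null.
\<close>

definition colored_covariance :: "real \<Rightarrow> (real \<times> (real ^ 'n) \<times> (real ^ 'n)) measure" where
  "colored_covariance \<beta> = density lborel (\<lambda>(s, y, z). ennreal (norm (y - z) powr (- \<beta>)))"

definition white_covariance :: "(real \<times> (real ^ 'n) \<times> (real ^ 'n)) measure" where
  "white_covariance = distr lborel borel (\<lambda>(s, y). (s, y, y))"

definition bounded_borel :: "(real \<times> (real ^ 'n)) set set" where
  "bounded_borel = {A \<in> sets borel. bounded A \<and> A \<subseteq> {0..} \<times> UNIV}"

text \<open>The noise is a Gaussian random measure \<open>A \<mapsto> W(A)\<close> on the bounded Borel subsets of
  \<open>[0,\<infinity>) \<times> \<real>\<^sup>N\<close>; additivity of \<open>W\<close> (almost surely) follows from the covariance formula.\<close>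

definition gaussian_noise ::
  "'a measure \<Rightarrow> (real \<times> (real ^ 'n) \<times> (real ^ 'n)) measure
    \<Rightarrow> ((real \<times> (real ^ 'n)) set \<Rightarrow> 'a \<Rightarrow> real) \<Rightarrow> bool" where
  "gaussian_noise M \<Lambda> W \<longleftrightarrow>
     (\<forall>F c. finite F \<and> F \<subseteq> bounded_borel \<longrightarrow> centered_gaussian M (\<lambda>\<omega>. \<Sum>A\<in>F. c A * W A \<omega>)) \<and>
     (\<forall>A\<in>bounded_borel. \<forall>B\<in>bounded_borel.
        (LINT \<omega>|M. W A \<omega> * W B \<omega>) = measure \<Lambda> {(s, y, z). (s, y) \<in> A \<and> (s, z) \<in> B})"

text \<open>Independence is that of the processes \<open>(W\<^sub>j(A))\<^sub>A\<close>; equality in law of the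
  components follows from their common covariance.\<close>

definition iid_gaussian_noises ::
  "'a measure \<Rightarrow> (real \<times> (real ^ 'n) \<times> (real ^ 'n)) measure \<Rightarrow> nat
    \<Rightarrow> (nat \<Rightarrow> (real \<times> (real ^ 'n)) set \<Rightarrow> 'a \<Rightarrow> real) \<Rightarrow> bool" where
  "iid_gaussian_noises M \<Lambda> d W \<longleftrightarrow>
     (\<forall>j\<in>{1..d}. gaussian_noise M \<Lambda> (W j)) \<and>
     prob_space.indep_vars M (\<lambda>_. Pi\<^sub>M bounded_borel (\<lambda>_. borel))
       (\<lambda>j \<omega>. \<lambda>A\<in>bounded_borel. W j A \<omega>) {1..d}"

text \<open>\<open>has_wiener_integral M \<Lambda> W f X\<close>: \<open>X\<close> is (a version of) the integral
  \<open>\<integral> f(s,y) W(ds dy)\<close>, the \<open>L\<^sup>2\<close> limit of the integrals of simple functions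
  \<open>\<Sum>A\<in>F k. c k A * 1\<^sub>A\<close> that approximate \<open>f\<close> in the norm
  \<open>\<parallel>h\<parallel>\<^sub>+\<^sup>2 = \<integral> \<bar>h(s,y)\<bar> \<bar>h(s,z)\<bar> \<Lambda>(ds dy dz)\<close>, as in Walsh's
  construction. With the absolute values and the nonnegative integral, convergence to 0 cannot hold
  merely because an integral is undefined.\<close>

definition plus_norm_sq ::
  "(real \<times> (real ^ 'n) \<times> (real ^ 'n)) measure \<Rightarrow> (real \<times> (real ^ 'n) \<Rightarrow> real) \<Rightarrow> ennreal" where
  "plus_norm_sq \<Lambda> h = (\<integral>\<^sup>+ (s, y, z). ennreal (\<bar>h (s, y)\<bar> * \<bar>h (s, z)\<bar>) \<partial>\<Lambda>)"

definition has_wiener_integral ::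
  "'a measure \<Rightarrow> (real \<times> (real ^ 'n) \<times> (real ^ 'n)) measure
    \<Rightarrow> ((real \<times> (real ^ 'n)) set \<Rightarrow> 'a \<Rightarrow> real)
    \<Rightarrow> (real \<times> (real ^ 'n) \<Rightarrow> real) \<Rightarrow> ('a \<Rightarrow> real) \<Rightarrow> bool" where
  "has_wiener_integral M \<Lambda> W f X \<longleftrightarrow>
     f \<in> borel_measurable borel \<and> X \<in> borel_measurable M \<and>
     (\<exists>F c. (\<forall>k::nat. finite (F k) \<and> F k \<subseteq> bounded_borel) \<and>
        (\<lambda>k. plus_norm_sq \<Lambda> (\<lambda>p. f p - (\<Sum>A\<in>F k. c k A * indicator A p))) \<longlonglongrightarrow> 0 \<and>
        (\<lambda>k. \<integral>\<^sup>+ \<omega>. ennreal ((X \<omega> - (\<Sum>A\<in>F k. c k A * W A \<omega>))\<^sup>2) \<partial>M) \<longlonglongrightarrow> 0)"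

definition heat_kernel :: "real \<Rightarrow> real ^ 'n \<Rightarrow> real" where
  "heat_kernel t x =
     (if t > 0 then 1 / (4 * pi * t) powr (real CARD('n) / 2) * exp (- ((norm x)\<^sup>2 / (4 * t))) else 0)"

definition stochastic_heat_solution ::
  "'a measure \<Rightarrow> (real \<times> (real ^ 'n) \<times> (real ^ 'n)) measure \<Rightarrow> nat
    \<Rightarrow> (nat \<Rightarrow> (real \<times> (real ^ 'n)) set \<Rightarrow> 'a \<Rightarrow> real)
    \<Rightarrow> (nat \<Rightarrow> real \<times> (real ^ 'n) \<Rightarrow> 'a \<Rightarrow> real) \<Rightarrow> bool" where
  "stochastic_heat_solution M \<Lambda> d W u \<longleftrightarrow>
     (\<forall>j\<in>{1..d}. \<forall>t\<ge>0. \<forall>x. has_wiener_integral M \<Lambda> (W j)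
        (\<lambda>(s, y). indicator {0..t} s * heat_kernel (t - s) (x - y)) (u j (t, x)))"

definition cond_variance :: "'a measure \<Rightarrow> 'a measure \<Rightarrow> ('a \<Rightarrow> real) \<Rightarrow> 'a \<Rightarrow> real" where
  "cond_variance M F X = real_cond_exp M F (\<lambda>\<omega>. (X \<omega> - real_cond_exp M F X \<omega>)\<^sup>2)"

text \<open>The sub-sigma-algebra generated by the random variables \<open>Y i\<close>, \<open>i \<in> I\<close>.\<close>

definition generated_by :: "'a measure \<Rightarrow> 'i set \<Rightarrow> ('i \<Rightarrow> 'a \<Rightarrow> real) \<Rightarrow> 'a measure" where
  "generated_by M I Y = vimage_algebra (space M) (\<lambda>\<omega>. \<lambda>i\<in>I. Y i \<omega>) (Pi\<^sub>M I (\<lambda>_. borel))"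

definition she_metric :: "real \<Rightarrow> real \<times> (real ^ 'n) \<Rightarrow> real \<times> (real ^ 'n) \<Rightarrow> real" where
  "she_metric \<beta> = (\<lambda>(t, x) (s, y).
     \<bar>t - s\<bar> powr ((2 - \<beta>) / 4) + norm (x - y) powr ((2 - \<beta>) / 2))"

end

theory Submission
  imports Defs
begin

text \<open>
  For jointly Gaussian variables the conditional variance is almost surely the constant
  \<open>E (u(p) - \<Sum> c\<^sub>i u(q\<^sub>i))\<^sup>2\<close> for the coefficients \<open>c\<close> of the orthogonal projection, so it suffices to bound such
  second moments from below, uniformly in \<open>c\<close>. The second moment is the covariance form \<open>Q(h)\<close> of the integrand
  \<open>h = G\<^sub>p - \<Sum> c\<^sub>i G\<^sub>q\<^sub>i\<close>, and by duality \<open>(\<integral> h g)\<^sup>2 \<le> \<kappa> Q(h)\<close> for suitable test functions \<open>g\<close>. For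
  \<open>g = (\<partial>\<^sub>t - \<Delta>) w\<close> with \<open>w\<close> supported in a small parabolic ball around \<open>p\<close>, Duhamel's formula gives
  \<open>\<integral> G\<^sub>q g = w(q)\<close>, which vanishes at all \<open>q\<^sub>i\<close>; scaling the ball to the distance from \<open>p\<close> to the \<open>q\<^sub>i\<close> gives the
  right power. For white noise \<open>\<kappa>\<close> is \<open>\<integral> g\<^sup>2\<close>. For coloured noise \<open>\<bar>x\<bar> powr - \<beta>\<close> is a superposition of
  self-convolutions of indicators of balls; using only the balls of radius below \<open>r\<close> and a test function on the
  space of balls keeps \<open>w\<close> compactly supported and avoids Fourier analysis.
\<close>

section \<open>Conditional variance of Gaussian vectors\<close>

text \<open>The projection coefficients are unknown and vary with n, so a usable bound must be blind
  to them. A test function whose pairing with every G at q_i vanishes removes all of them at once;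
  this is why C does not depend on n. The exponent comes from balancing gain against cost at
  parabolic radius r. For white noise in dimension 1 the source of a unit bump has size r^-2 on a
  cylinder of volume of order r^3, so \<kappa> is of order 1/r while the pairing is of order 1. For
  coloured noise \<kappa> is of order r^(2N + \<beta>) and the pairing of order r^(N + 1). Either
  way pairing^2 / \<kappa> is of order r^(2 - \<beta>), the square of the metric. The obstacle in
  the coloured case is that inverting convolution with the Riesz kernel is nonlocal. Writing the
  kernel as K K^* with K indexed by balls replaces inversion by Cauchy-Schwarz: every
  square-integrable \<Psi> on the space of balls gives an admissible g = K \<Psi> with \<kappa>
  proportional to the squared norm of \<Psi>. On the probabilistic side, independence of the
  projection residual is extracted from factoring characteristic functions, using only the
  one-dimensional Levy uniqueness theorem.\<close>

lemma (in prob_space) set_integral_eq_0_if_char_eq_0: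
  fixes Z Y :: "'a \<Rightarrow> real"
  assumes Z[measurable]: "integrable M Z" and Y[measurable]: "Y \<in> borel_measurable M"
    and char0: "\<And>t. (CLINT \<omega>|M. complex_of_real (Z \<omega>) * iexp (t * Y \<omega>)) = 0"
    and B[measurable]: "B \<in> sets borel"
  shows "(LINT \<omega>|M. Z \<omega> * indicator B (Y \<omega>)) = 0"
proof -
  \<comment> \<open>A signed version of Levy uniqueness: the positive and negative parts of
    \<open>Z\<close> have the same mass \<open>m\<close> (frequency 0), and after division by
    \<open>m\<close> they are densities under which \<open>Y\<close> has the same characteristic
    function, hence the same law.\<close>
  define P where "P = (\<lambda>\<omega>. max 0 (Z \<omega>))"
  define N where "N = (\<lambda>\<omega>. max 0 (- Z \<omega>))"
  have [measurable]: "Z \<in> borel_measurable M" using Z by auto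
  have [measurable]: "P \<in> borel_measurable M" "N \<in> borel_measurable M" by (simp_all add: P_def N_def)
  have ip: "integrable M P" "integrable M N" using Z by (simp_all add: P_def N_def)
  have Zeq: "Z \<omega> = P \<omega> - N \<omega>" for \<omega> by (simp add: P_def N_def)
  have pos: "0 \<le> P \<omega>" "0 \<le> N \<omega>" for \<omega> by (simp_all add: P_def N_def)
  define m where "m = (LINT \<omega>|M. P \<omega>)"
  have "(CLINT \<omega>|M. complex_of_real (Z \<omega>)) = 0" using char0[of 0] by simp
  then have "(LINT \<omega>|M. Z \<omega>) = 0" by simp
  then have mN: "m = (LINT \<omega>|M. N \<omega>)" unfolding m_def Zeq using ip by simp
  have m0: "0 \<le> m" unfolding m_def using pos by simp
  have i1: "integrable M (\<lambda>\<omega>. P \<omega> * indicator B (Y \<omega>))"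
    by (rule Bochner_Integration.integrable_bound[OF ip(1)]) (auto simp: indicator_def)
  have i2: "integrable M (\<lambda>\<omega>. N \<omega> * indicator B (Y \<omega>))"
    by (rule Bochner_Integration.integrable_bound[OF ip(2)]) (auto simp: indicator_def)
  show ?thesis
  proof (cases "m = 0")
    case True
    have "(LINT \<omega>|M. P \<omega>) = 0" "(LINT \<omega>|M. N \<omega>) = 0" using True mN m_def by simp_all
    then have "AE \<omega> in M. P \<omega> = 0" "AE \<omega> in M. N \<omega> = 0"
      using ip pos by (simp_all add: integral_nonneg_eq_0_iff_AE)
    then have "AE \<omega> in M. Z \<omega> * indicator B (Y \<omega>) = 0" by eventually_elim (simp add: Zeq)
    then show ?thesis by (rule integral_eq_zero_AE)
  next
    case False
    then have m: "0 < m" using m0 by simp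
    define D where "D f = density M (\<lambda>\<omega>. ennreal (f \<omega> / m))" for f :: "'a \<Rightarrow> real"
    have ps: "prob_space (D f)" if f: "integrable M f" "\<And>\<omega>. 0 \<le> f \<omega>" "(LINT \<omega>|M. f \<omega>) = m" for f
    proof
      have [measurable]: "f \<in> borel_measurable M" using f by auto
      have "emeasure (D f) (space (D f)) = (\<integral>\<^sup>+\<omega>. ennreal (f \<omega> / m) \<partial>M)"
        unfolding D_def by (simp add: emeasure_density cong: nn_integral_cong)
      also have "\<dots> = ennreal (LINT \<omega>|M. f \<omega> / m)"
        using f m by (intro nn_integral_eq_integral) auto
      also have "\<dots> = 1" using f(3) m by simp
      finally show "emeasure (D f) (space (D f)) = 1" .
    qed
    have rd: "real_distribution (distr (D f) borel Y)"
      if f: "integrable M f" "\<And>\<omega>. 0 \<le> f \<omega>" "(LINT \<omega>|M. f \<omega>) = m" for f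
    proof -
      interpret D: prob_space "D f" by (rule ps[OF f])
      show ?thesis by (rule D.real_distribution_distr) (simp add: D_def)
    qed
    have ch: "char (distr (D f) borel Y) t = (CLINT \<omega>|M. complex_of_real (f \<omega>) * iexp (t * Y \<omega>)) / m"
      if f: "integrable M f" "\<And>\<omega>. 0 \<le> f \<omega>" for f t
    proof -
      have [measurable]: "f \<in> borel_measurable M" using f by auto
      have "char (distr (D f) borel Y) t = (CLINT \<omega>|D f. iexp (t * Y \<omega>))"
        unfolding char_def by (subst integral_distr) (simp_all add: D_def)
      also have "\<dots> = (CLINT \<omega>|M. (f \<omega> / m) *\<^sub>R iexp (t * Y \<omega>))"
        unfolding D_def using f(2) m by (subst integral_density) auto
      also have "\<dots> = (CLINT \<omega>|M. (complex_of_real (f \<omega>) * iexp (t * Y \<omega>)) / m)"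
        by (intro Bochner_Integration.integral_cong) (auto simp: scaleR_conv_of_real)
      finally show ?thesis by simp
    qed
    have ii: "integrable M (\<lambda>\<omega>. complex_of_real (f \<omega>) * iexp (t * Y \<omega>))" if f: "integrable M f" for f t
    proof (rule Bochner_Integration.integrable_bound[OF f])
      show "(\<lambda>\<omega>. complex_of_real (f \<omega>) * iexp (t * Y \<omega>)) \<in> borel_measurable M"
        using borel_measurable_integrable[OF f] by measurable
    qed (auto simp: norm_mult)
    have "char (distr (D P) borel Y) = char (distr (D N) borel Y)"
    proof
      fix t
      have "0 = (CLINT \<omega>|M. complex_of_real (P \<omega>) * iexp (t * Y \<omega>) - complex_of_real (N \<omega>) * iexp (t * Y \<omega>))"
        unfolding char0[of t, symmetric]
        by (intro Bochner_Integration.integral_cong) (auto simp: Zeq algebra_simps)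
      also have "\<dots> = (CLINT \<omega>|M. complex_of_real (P \<omega>) * iexp (t * Y \<omega>)) - (CLINT \<omega>|M. complex_of_real (N \<omega>) * iexp (t * Y \<omega>))"
        by (intro Bochner_Integration.integral_diff ii ip)
      finally show "char (distr (D P) borel Y) t = char (distr (D N) borel Y) t"
        using ch[OF ip(1) pos(1)] ch[OF ip(2) pos(2)] by simp
    qed
    then have eq: "distr (D P) borel Y = distr (D N) borel Y"
      using rd[OF ip(1) pos(1)] rd[OF ip(2) pos(2)] m_def mN by (intro Levy_uniqueness) auto
    have em: "emeasure (distr (D f) borel Y) B = ennreal ((LINT \<omega>|M. f \<omega> * indicator B (Y \<omega>)) / m)"
      if f: "integrable M f" "\<And>\<omega>. 0 \<le> f \<omega>" "integrable M (\<lambda>\<omega>. f \<omega> * indicator B (Y \<omega>))" for f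
    proof -
      have [measurable]: "f \<in> borel_measurable M" using f by auto
      have "emeasure (distr (D f) borel Y) B = (\<integral>\<^sup>+\<omega>. ennreal (f \<omega> / m) * indicator (Y -` B \<inter> space M) \<omega> \<partial>M)"
        by (simp add: D_def emeasure_distr emeasure_density)
      also have "\<dots> = (\<integral>\<^sup>+\<omega>. ennreal ((f \<omega> * indicator B (Y \<omega>)) / m) \<partial>M)"
        by (intro nn_integral_cong) (auto simp: indicator_def)
      also have "\<dots> = ennreal (LINT \<omega>|M. (f \<omega> * indicator B (Y \<omega>)) / m)"
        using f m by (intro nn_integral_eq_integral) auto
      finally show ?thesis by simp
    qed
    have "(LINT \<omega>|M. P \<omega> * indicator B (Y \<omega>)) / m = (LINT \<omega>|M. N \<omega> * indicator B (Y \<omega>)) / m"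
    proof -
      have "0 \<le> (LINT \<omega>|M. P \<omega> * indicator B (Y \<omega>)) / m" "0 \<le> (LINT \<omega>|M. N \<omega> * indicator B (Y \<omega>)) / m"
        using m pos by (auto intro!: divide_nonneg_pos Bochner_Integration.integral_nonneg)
      then show ?thesis
        using em[OF ip(1) pos(1) i1] em[OF ip(2) pos(2) i2] eq by (metis ennreal_inj)
    qed
    then show ?thesis using m i1 i2 by (simp add: Zeq left_diff_distrib)
  qed
qed

lemma (in prob_space) complex_set_integral_eq_0_if_char_eq_0:
  fixes Z :: "'a \<Rightarrow> complex" and Y :: "'a \<Rightarrow> real"
  assumes Z: "integrable M Z" and Y[measurable]: "Y \<in> borel_measurable M"
    and char0: "\<And>t. (CLINT \<omega>|M. Z \<omega> * iexp (t * Y \<omega>)) = 0"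
    and B[measurable]: "B \<in> sets borel"
  shows "(CLINT \<omega>|M. Z \<omega> * indicator B (Y \<omega>)) = 0"
proof -
  have [measurable]: "Z \<in> borel_measurable M" using Z by auto
  have iR: "integrable M (\<lambda>\<omega>. Re (Z \<omega>))" and iI: "integrable M (\<lambda>\<omega>. Im (Z \<omega>))" using Z by auto
  have ii: "integrable M (\<lambda>\<omega>. Z \<omega> * iexp (t * Y \<omega>))" for t
    by (rule Bochner_Integration.integrable_bound[OF Z]) (auto simp: norm_mult)
  have [measurable]: "(\<lambda>\<omega>. cnj (Z \<omega>)) \<in> borel_measurable M"
    using Z by (intro borel_measurable_integrable) simp
  have ii': "integrable M (\<lambda>\<omega>. cnj (Z \<omega>) * iexp (t * Y \<omega>))" for t
    by (rule Bochner_Integration.integrable_bound[OF Z]) (auto simp: norm_mult)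
  \<comment> \<open>Conjugation turns frequency \<open>t\<close> into \<open>-t\<close>, so the
    hypothesis passes to the conjugate of \<open>Z\<close>, hence to its real and imaginary
    parts.\<close>
  have c2: "(CLINT \<omega>|M. cnj (Z \<omega>) * iexp (t * Y \<omega>)) = 0" for t
  proof -
    have "(CLINT \<omega>|M. cnj (Z \<omega>) * iexp (t * Y \<omega>)) = (CLINT \<omega>|M. cnj (Z \<omega> * iexp ((-t) * Y \<omega>)))"
      by (intro Bochner_Integration.integral_cong) (auto simp: exp_cnj)
    also have "\<dots> = cnj (CLINT \<omega>|M. Z \<omega> * iexp ((-t) * Y \<omega>))" by (rule Bochner_Integration.integral_cnj)
    finally show ?thesis using char0[of "-t"] by simp
  qed
  have re: "(CLINT \<omega>|M. complex_of_real (Re (Z \<omega>)) * iexp (t * Y \<omega>)) = 0" for t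
  proof -
    have "(CLINT \<omega>|M. complex_of_real (Re (Z \<omega>)) * iexp (t * Y \<omega>)) =
      (CLINT \<omega>|M. (Z \<omega> * iexp (t * Y \<omega>) + cnj (Z \<omega>) * iexp (t * Y \<omega>)) / 2)"
      by (intro Bochner_Integration.integral_cong refl)
        (simp add: distrib_right[symmetric] complex_add_cnj)
    also have "\<dots> = 0" using ii ii' char0 c2 by simp
    finally show ?thesis .
  qed
  have im: "(CLINT \<omega>|M. complex_of_real (Im (Z \<omega>)) * iexp (t * Y \<omega>)) = 0" for t
  proof -
    have "(CLINT \<omega>|M. complex_of_real (Im (Z \<omega>)) * iexp (t * Y \<omega>)) =
      (CLINT \<omega>|M. (Z \<omega> * iexp (t * Y \<omega>) - cnj (Z \<omega>) * iexp (t * Y \<omega>)) / (2 * \<i>))"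
      by (intro Bochner_Integration.integral_cong refl)
        (simp add: left_diff_distrib[symmetric] complex_diff_cnj mult.commute)
    also have "\<dots> = 0" using ii ii' char0 c2 by simp
    finally show ?thesis .
  qed
  have i3: "integrable M (\<lambda>\<omega>. complex_of_real (Re (Z \<omega>) * indicator B (Y \<omega>)))"
    by (rule Bochner_Integration.integrable_bound[OF iR]) (auto simp: indicator_def)
  have i4: "integrable M (\<lambda>\<omega>. complex_of_real (Im (Z \<omega>) * indicator B (Y \<omega>)))"
    by (rule Bochner_Integration.integrable_bound[OF iI]) (auto simp: indicator_def)
  have "(CLINT \<omega>|M. Z \<omega> * indicator B (Y \<omega>)) =
    (CLINT \<omega>|M. complex_of_real (Re (Z \<omega>) * indicator B (Y \<omega>)) + \<i> * complex_of_real (Im (Z \<omega>) * indicator B (Y \<omega>)))"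
    by (intro Bochner_Integration.integral_cong refl) (auto simp: indicator_def complex_eq_iff)
  also have "\<dots> = complex_of_real (LINT \<omega>|M. Re (Z \<omega>) * indicator B (Y \<omega>)) + \<i> * complex_of_real (LINT \<omega>|M. Im (Z \<omega>) * indicator B (Y \<omega>))"
    using i3 i4 by (subst Bochner_Integration.integral_add) (auto simp del: of_real_mult)
  also have "\<dots> = 0"
    using set_integral_eq_0_if_char_eq_0[OF iR Y re B] set_integral_eq_0_if_char_eq_0[OF iI Y im B] by simp
  finally show ?thesis .
qed

text \<open>One coordinate is treated at a time: the exponentials of the other coordinates are
  absorbed into \<open>Z\<close>, and the one-dimensional result turns the remaining exponential
  into an indicator. This absorption is why \<open>Z\<close> has to be complex.\<close>

lemma (in prob_space) complex_box_integral_eq_0_if_char_eq_0: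
  fixes Z :: "'a \<Rightarrow> complex" and Y :: "'i \<Rightarrow> 'a \<Rightarrow> real"
  assumes "finite I" "integrable M Z" "\<And>i. i \<in> I \<Longrightarrow> Y i \<in> borel_measurable M"
    and "\<And>t. (CLINT \<omega>|M. Z \<omega> * iexp (\<Sum>i\<in>I. t i * Y i \<omega>)) = 0"
    and "\<And>i. i \<in> I \<Longrightarrow> B i \<in> sets borel"
  shows "(CLINT \<omega>|M. Z \<omega> * (\<Prod>i\<in>I. indicator (B i) (Y i \<omega>))) = 0"
  using assms
proof (induction I arbitrary: Z rule: finite_induct)
  case empty
  then show ?case by simp
next
  case (insert k I)
  have [measurable]: "Z \<in> borel_measurable M" using insert.prems by auto
  have [measurable]: "Y i \<in> borel_measurable M" "B i \<in> sets borel" if "i \<in> insert k I" for i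
    using insert.prems that by auto
  have [measurable]: "Y k \<in> borel_measurable M" "B k \<in> sets borel" by auto
  have *: "integrable M (\<lambda>\<omega>. Z \<omega> * iexp (\<Sum>i\<in>I. t i * Y i \<omega>))" for t
  proof (rule Bochner_Integration.integrable_bound[OF insert.prems(1)])
    have "(\<lambda>\<omega>. (\<Sum>i\<in>I. t i * Y i \<omega>)) \<in> borel_measurable M"
      by (intro borel_measurable_sum) auto
    then show "(\<lambda>\<omega>. Z \<omega> * iexp (\<Sum>i\<in>I. t i * Y i \<omega>)) \<in> borel_measurable M" by measurable
  qed (auto simp: norm_mult)
  have 1: "(CLINT \<omega>|M. (Z \<omega> * indicator (B k) (Y k \<omega>)) * iexp (\<Sum>i\<in>I. t i * Y i \<omega>)) = 0" for t
  proof -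
    have "(CLINT \<omega>|M. (Z \<omega> * iexp (\<Sum>i\<in>I. t i * Y i \<omega>)) * iexp (s * Y k \<omega>)) = 0" for s
    proof -
      have "(\<Sum>i\<in>insert k I. (t(k := s)) i * Y i \<omega>) = (\<Sum>i\<in>I. t i * Y i \<omega>) + s * Y k \<omega>" for \<omega>
        using insert.hyps by (auto simp: intro!: sum.cong)
      then show ?thesis
        using insert.prems(3)[of "t(k := s)"] by (simp add: exp_add distrib_left mult.assoc)
    qed
    from complex_set_integral_eq_0_if_char_eq_0[OF * _ this, of "B k"]
    have "(CLINT \<omega>|M. (Z \<omega> * iexp (\<Sum>i\<in>I. t i * Y i \<omega>)) * indicator (B k) (Y k \<omega>)) = 0"
      by simp
    then show ?thesis by (simp add: ac_simps)
  qed
  have "(CLINT \<omega>|M. (Z \<omega> * indicator (B k) (Y k \<omega>)) * (\<Prod>i\<in>I. indicator (B i) (Y i \<omega>))) = 0"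
  proof (rule insert.IH)
    show "integrable M (\<lambda>\<omega>. Z \<omega> * indicator (B k) (Y k \<omega>))"
      by (rule Bochner_Integration.integrable_bound[OF insert.prems(1)])
        (auto simp: indicator_def norm_mult)
  qed (use 1 in auto)
  then show ?case using insert.hyps by (simp add: ac_simps)
qed

lemma space_generated_by [simp]: "space (generated_by M I Y) = space M"
  by (simp add: generated_by_def)

lemma subalgebra_generated_by:
  assumes "\<And>i. i \<in> I \<Longrightarrow> Y i \<in> borel_measurable M"
  shows "subalgebra M (generated_by M I Y)"
proof -
  have "(\<lambda>\<omega>. \<lambda>i\<in>I. Y i \<omega>) \<in> M \<rightarrow>\<^sub>M Pi\<^sub>M I (\<lambda>_. borel)"
    using assms by (intro measurable_restrict) auto
  then show ?thesis
    unfolding subalgebra_def generated_by_def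
    by (auto simp: sets_vimage_algebra2 space_PiM dest: measurable_space intro: measurable_sets)
qed

lemma measurable_generated_by:
  assumes "i \<in> I"
  shows "Y i \<in> borel_measurable (generated_by M I Y)"
proof -
  have "(\<lambda>\<omega>. \<lambda>i\<in>I. Y i \<omega>) \<in> generated_by M I Y \<rightarrow>\<^sub>M Pi\<^sub>M I (\<lambda>_. borel)"
    unfolding generated_by_def by (rule measurable_vimage_algebra1) (auto simp: space_PiM)
  from measurable_compose[OF this measurable_component_singleton[OF assms]] assms
  show ?thesis by simp
qed

text \<open>The sets over which \<open>Z\<close> integrates to 0 form a Dynkin system: complements
  work because frequency 0 gives total integral 0, disjoint unions by countable additivity. The
  boxes are an intersection-stable generator.\<close>

lemma (in prob_space) complex_generated_integral_eq_0_if_char_eq_0: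
  fixes Z :: "'a \<Rightarrow> complex" and Y :: "'i \<Rightarrow> 'a \<Rightarrow> real"
  assumes I: "finite I" and Z: "integrable M Z" and Y: "\<And>i. i \<in> I \<Longrightarrow> Y i \<in> borel_measurable M"
    and char0: "\<And>t. (CLINT \<omega>|M. Z \<omega> * iexp (\<Sum>i\<in>I. t i * Y i \<omega>)) = 0"
    and A: "A \<in> sets (generated_by M I Y)"
  shows "(CLINT \<omega>:A|M. Z \<omega>) = 0"
proof -
  let ?Y = "\<lambda>\<omega>. \<lambda>i\<in>I. Y i \<omega>"
  let ?V = "\<lambda>B. ?Y -` B \<inter> space M"
  have Ym: "?Y \<in> M \<rightarrow>\<^sub>M Pi\<^sub>M I (\<lambda>_. borel)"
    using Y by (intro measurable_restrict) auto
  have Zs: "set_integrable M B Z" if "B \<in> sets M" for B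
    unfolding set_integrable_def using integrable_mult_indicator[OF that Z] .
  obtain B where B: "B \<in> sets (Pi\<^sub>M I (\<lambda>_. borel :: real measure))" and AB: "A = ?V B"
    using A unfolding generated_by_def
    by (subst (asm) sets_vimage_algebra2) (auto simp: space_PiM)
  have "B \<in> sigma_sets (\<Pi>\<^sub>E i\<in>I. space borel) (prod_algebra I (\<lambda>_. borel :: real measure))"
    using B by (simp add: sets_PiM)
  then have "(CLINT \<omega>:?V B|M. Z \<omega>) = 0"
  proof (induction rule: sigma_sets_induct_disjoint[OF Int_stable_prod_algebra prod_algebra_sets_into_space, consumes 1, case_names basic empty compl union])
    case (basic B)
    then obtain E where E: "B = (\<Pi>\<^sub>E i\<in>I. E i)" "\<And>i. i \<in> I \<Longrightarrow> E i \<in> sets borel"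
      using I by (auto simp: prod_algebra_eq_finite)
    have "(CLINT \<omega>:?V B|M. Z \<omega>) = (CLINT \<omega>|M. Z \<omega> * (\<Prod>i\<in>I. indicator (E i) (Y i \<omega>)))"
      unfolding set_lebesgue_integral_def
    proof (rule Bochner_Integration.integral_cong[OF refl])
      fix \<omega> assume w: "\<omega> \<in> space M"
      show "indicator (?V B) \<omega> *\<^sub>R Z \<omega> = Z \<omega> * (\<Prod>i\<in>I. indicator (E i) (Y i \<omega>))"
      proof (cases "\<forall>i\<in>I. Y i \<omega> \<in> E i")
        case True
        then show ?thesis using w E by simp
      next
        case False
        then have "(\<Prod>i\<in>I. indicator (E i) (Y i \<omega>)) = (0::complex)" using I by (intro prod_zero) (auto simp: indicator_def)
        then show ?thesis using False E by (auto simp: PiE_iff)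
      qed
    qed
    also have "\<dots> = 0"
      using E by (intro complex_box_integral_eq_0_if_char_eq_0 I Z Y char0) auto
    finally show ?case .
  next
    case empty
    then show ?case by (simp add: set_lebesgue_integral_def)
  next
    case (compl B)
    have Bm: "B \<in> sets (Pi\<^sub>M I (\<lambda>_. borel :: real measure))" using compl by (simp add: sets_PiM)
    have VB: "?V B \<in> sets M" using measurable_sets[OF Ym Bm] .
    have "?V ((\<Pi>\<^sub>E i\<in>I. space borel) - B) = space M - ?V B" by (auto simp: PiE_iff)
    moreover have "(CLINT \<omega>:space M - ?V B|M. Z \<omega>) = (CLINT \<omega>|M. Z \<omega>) - (CLINT \<omega>:?V B|M. Z \<omega>)"
    proof -
      have "(CLINT \<omega>:space M - ?V B|M. Z \<omega>) = (CLINT \<omega>|M. Z \<omega> - indicator (?V B) \<omega> *\<^sub>R Z \<omega>)"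
        unfolding set_lebesgue_integral_def
        by (intro Bochner_Integration.integral_cong refl) (auto simp: indicator_def)
      then show ?thesis
        using Zs[OF VB] Z unfolding set_lebesgue_integral_def set_integrable_def by simp
    qed
    moreover have "(CLINT \<omega>|M. Z \<omega>) = 0" using char0[of "\<lambda>_. 0"] by simp
    moreover have "(CLINT \<omega>:?V B|M. Z \<omega>) = 0" by (rule compl.IH)
    ultimately show ?case by (simp only: diff_zero)
  next
    case (union F)
    have "F i \<in> sets (Pi\<^sub>M I (\<lambda>_. borel :: real measure))" for i using union by (auto simp: sets_PiM)
    then have VB: "?V (F i) \<in> sets M" for i using measurable_sets[OF Ym] by blast
    have "?V (\<Union> (range F)) = (\<Union>i. ?V (F i))" by auto
    moreover have "(CLINT \<omega>:(\<Union>i. ?V (F i))|M. Z \<omega>) = (\<Sum>i. (CLINT \<omega>:?V (F i)|M. Z \<omega>))"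
    proof (rule lebesgue_integral_countable_add)
      show "\<And>i j. i \<noteq> j \<Longrightarrow> ?V (F i) \<inter> ?V (F j) = {}"
        using union.hyps by (fastforce simp: disjoint_family_on_def)
      show "set_integrable M (\<Union>i. ?V (F i)) Z" using VB by (intro Zs sets.countable_UN) auto
    qed (use VB in auto)
    moreover have "(CLINT \<omega>:?V (F i)|M. Z \<omega>) = 0" for i by (rule union.IH)
    ultimately show ?case by (simp only: suminf_zero)
  qed
  then show ?thesis using AB by simp
qed

section \<open>Square-integrable functions and orthogonal projection\<close>

definition square_integrable :: "'a measure \<Rightarrow> ('a \<Rightarrow> real) \<Rightarrow> bool" where
  "square_integrable M f \<longleftrightarrow> f \<in> borel_measurable M \<and> integrable M (\<lambda>x. (f x)\<^sup>2)"

lemma square_integrable_measurable [measurable_dest]: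
  "square_integrable M f \<Longrightarrow> f \<in> borel_measurable M"
  by (simp add: square_integrable_def)

lemma square_integrable_times:
  assumes f: "square_integrable M f" and g: "square_integrable M g"
  shows "integrable M (\<lambda>x. f x * g x)"
proof (rule Bochner_Integration.integrable_bound)
  show "integrable M (\<lambda>x. (f x)\<^sup>2 + (g x)\<^sup>2)"
    using f g by (auto simp: square_integrable_def)
  show "(\<lambda>x. f x * g x) \<in> borel_measurable M" using f g by measurable
  have "\<bar>a * b\<bar> \<le> a\<^sup>2 + b\<^sup>2" for a b :: real
  proof -
    have "0 \<le> (\<bar>a\<bar> - \<bar>b\<bar>)\<^sup>2" by simp
    then have "2 * (\<bar>a\<bar> * \<bar>b\<bar>) \<le> a\<^sup>2 + b\<^sup>2" by (simp add: power2_diff)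
    moreover have "0 \<le> \<bar>a\<bar> * \<bar>b\<bar>" by simp
    ultimately show ?thesis unfolding abs_mult by linarith
  qed
  then show "AE x in M. norm (f x * g x) \<le> norm ((f x)\<^sup>2 + (g x)\<^sup>2)"
    by (intro AE_I2) simp
qed

lemma square_integrable_add:
  assumes f: "square_integrable M f" and g: "square_integrable M g"
  shows "square_integrable M (\<lambda>x. f x + g x)"
  using f g square_integrable_times[OF f g]
  by (auto simp: square_integrable_def power2_sum mult.assoc)

lemma square_integrable_cmult:
  "square_integrable M f \<Longrightarrow> square_integrable M (\<lambda>x. c * f x)"
  by (auto simp: square_integrable_def power_mult_distrib)

lemma square_integrable_diff:
  assumes f: "square_integrable M f" and g: "square_integrable M g"
  shows "square_integrable M (\<lambda>x. f x - g x)"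
  using square_integrable_add[OF f square_integrable_cmult[OF g, of "-1"]] by simp

lemma square_integrable_sum:
  assumes "\<And>i. i \<in> I \<Longrightarrow> square_integrable M (f i)"
  shows "square_integrable M (\<lambda>x. \<Sum>i\<in>I. f i x)"
  using assms
  by (induction I rule: infinite_finite_induct)
    (auto intro: square_integrable_add simp: square_integrable_def[of M "\<lambda>x. 0"])

lemma (in prob_space) square_integrable_integrable:
  assumes "square_integrable M f"
  shows "integrable M f"
  using square_integrable_times[OF assms, of "\<lambda>_. 1"] by (simp add: square_integrable_def)

text \<open>Gram-Schmidt: \<open>X\<close> and the new vector \<open>Y k\<close> are both projected
  on the old ones, and the residual of \<open>Y k\<close> supplies the one new direction. Working
  with coefficients makes linear dependence among the \<open>Y i\<close> harmless.\<close>

lemma ex_orthogonal_projection: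
  fixes X :: "'a \<Rightarrow> real" and Y :: "'i \<Rightarrow> 'a \<Rightarrow> real"
  assumes "finite I" "\<And>i. i \<in> I \<Longrightarrow> square_integrable M (Y i)" "square_integrable M X"
  shows "\<exists>c. \<forall>j\<in>I. (LINT \<omega>|M. (X \<omega> - (\<Sum>i\<in>I. c i * Y i \<omega>)) * Y j \<omega>) = 0"
  using assms
proof (induction I arbitrary: X rule: finite_induct)
  case empty
  then show ?case by simp
next
  case (insert k I)
  have Yk: "square_integrable M (Y k)" and Yi: "\<And>i. i \<in> I \<Longrightarrow> square_integrable M (Y i)"
    using insert.prems by auto
  obtain c where c: "\<And>j. j \<in> I \<Longrightarrow> (LINT \<omega>|M. (X \<omega> - (\<Sum>i\<in>I. c i * Y i \<omega>)) * Y j \<omega>) = 0"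
    using insert.IH[OF Yi insert.prems(2)] by blast
  obtain e where e: "\<And>j. j \<in> I \<Longrightarrow> (LINT \<omega>|M. (Y k \<omega> - (\<Sum>i\<in>I. e i * Y i \<omega>)) * Y j \<omega>) = 0"
    using insert.IH[OF Yi Yk] by blast
  define R where "R = (\<lambda>\<omega>. X \<omega> - (\<Sum>i\<in>I. c i * Y i \<omega>))"
  define K where "K = (\<lambda>\<omega>. Y k \<omega> - (\<Sum>i\<in>I. e i * Y i \<omega>))"
  have sR: "square_integrable M R" and sK: "square_integrable M K"
    unfolding R_def K_def
    by (auto intro!: square_integrable_diff square_integrable_sum square_integrable_cmult Yk Yi insert.prems)
  \<comment> \<open>The coefficient of \<open>R\<close> along \<open>K\<close>. If \<open>K\<close>
    is null the quotient is 0 by the convention for division by zero, and \<open>orthK\<close> holds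
    because \<open>K\<close> vanishes almost everywhere.\<close>
  define a where "a = (LINT \<omega>|M. R \<omega> * K \<omega>) / (LINT \<omega>|M. (K \<omega>)\<^sup>2)"
  define c' where "c' = (\<lambda>i. c i - a * e i)(k := a)"
  have res: "X \<omega> - (\<Sum>i\<in>insert k I. c' i * Y i \<omega>) = R \<omega> - a * K \<omega>" for \<omega>
  proof -
    have "(\<Sum>i\<in>insert k I. c' i * Y i \<omega>) = a * Y k \<omega> + (\<Sum>i\<in>I. (c i - a * e i) * Y i \<omega>)"
      using insert.hyps by (auto simp: c'_def intro!: sum.cong)
    also have "\<dots> = a * Y k \<omega> + ((\<Sum>i\<in>I. c i * Y i \<omega>) - a * (\<Sum>i\<in>I. e i * Y i \<omega>))"
      by (simp add: left_diff_distrib sum_subtractf sum_distrib_left mult.assoc)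
    finally show ?thesis by (simp add: R_def K_def algebra_simps)
  qed
  have RK: "square_integrable M (\<lambda>\<omega>. R \<omega> - a * K \<omega>)"
    by (intro square_integrable_diff square_integrable_cmult sR sK)
  have orthI: "(LINT \<omega>|M. (R \<omega> - a * K \<omega>) * Y j \<omega>) = 0" if j: "j \<in> I" for j
  proof -
    have "(LINT \<omega>|M. (R \<omega> - a * K \<omega>) * Y j \<omega>) = (LINT \<omega>|M. R \<omega> * Y j \<omega>) - a * (LINT \<omega>|M. K \<omega> * Y j \<omega>)"
      using square_integrable_times[OF sR Yi[OF j]] square_integrable_times[OF sK Yi[OF j]]
      by (simp add: left_diff_distrib mult.assoc)
    then show ?thesis using c[OF j] e[OF j] by (simp add: R_def K_def)
  qed
  have orthK: "(LINT \<omega>|M. (R \<omega> - a * K \<omega>) * K \<omega>) = 0"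
  proof -
    have iK: "integrable M (\<lambda>\<omega>. (K \<omega>)\<^sup>2)" using sK by (simp add: square_integrable_def)
    have eq: "(LINT \<omega>|M. (R \<omega> - a * K \<omega>) * K \<omega>) = (LINT \<omega>|M. R \<omega> * K \<omega>) - a * (LINT \<omega>|M. (K \<omega>)\<^sup>2)"
      using square_integrable_times[OF sR sK] iK
      by (simp add: left_diff_distrib mult.assoc power2_eq_square)
    show ?thesis
    proof (cases "(LINT \<omega>|M. (K \<omega>)\<^sup>2) = 0")
      case True
      then have "AE \<omega> in M. (K \<omega>)\<^sup>2 = 0" using iK by (simp add: integral_nonneg_eq_0_iff_AE)
      then have "AE \<omega> in M. (R \<omega> - a * K \<omega>) * K \<omega> = 0" by eventually_elim simp
      then show ?thesis by (rule integral_eq_zero_AE)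
    next
      case False
      then show ?thesis unfolding eq by (simp add: a_def)
    qed
  qed
  have orthk: "(LINT \<omega>|M. (R \<omega> - a * K \<omega>) * Y k \<omega>) = 0"
  proof -
    have "(LINT \<omega>|M. (R \<omega> - a * K \<omega>) * Y k \<omega>) =
      (LINT \<omega>|M. (R \<omega> - a * K \<omega>) * K \<omega> + (\<Sum>i\<in>I. e i * ((R \<omega> - a * K \<omega>) * Y i \<omega>)))"
      by (intro Bochner_Integration.integral_cong refl)
        (simp add: K_def algebra_simps sum_distrib_left sum_subtractf sum.distrib)
    also have "\<dots> = (LINT \<omega>|M. (R \<omega> - a * K \<omega>) * K \<omega>) + (\<Sum>i\<in>I. e i * (LINT \<omega>|M. (R \<omega> - a * K \<omega>) * Y i \<omega>))"
      using square_integrable_times[OF RK sK] square_integrable_times[OF RK Yi]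
      by (subst Bochner_Integration.integral_add) (auto simp: Bochner_Integration.integral_sum)
    finally show ?thesis using orthK orthI by simp
  qed
  have "\<forall>j\<in>insert k I. (LINT \<omega>|M. (X \<omega> - (\<Sum>i\<in>insert k I. c' i * Y i \<omega>)) * Y j \<omega>) = 0"
    unfolding res using orthI orthk by blast
  then show ?case by blast
qed

lemma (in prob_space) integrable_iexp':
  assumes [measurable]: "f \<in> borel_measurable M"
  shows "integrable M (\<lambda>\<omega>. iexp (f \<omega>))"
  by (rule integrable_iexp) simp_all

text \<open>The projection residual is uncorrelated with every \<open>Y i\<close>, so the joint
  characteristic function factors and the residual is independent of the generated sigma-algebra;
  its conditional second moment is therefore constant. Stating joint Gaussianity through
  characteristic functions covers degenerate covariances as well.\<close>

lemma (in prob_space) gaussian_cond_variance: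
  fixes X :: "'a \<Rightarrow> real" and Y :: "'i \<Rightarrow> 'a \<Rightarrow> real"
  assumes I: "finite I" and X: "square_integrable M X" and Y: "\<And>i. i \<in> I \<Longrightarrow> square_integrable M (Y i)"
    and gauss: "\<And>c0 c. (CLINT \<omega>|M. iexp (c0 * X \<omega> + (\<Sum>i\<in>I. c i * Y i \<omega>))) =
      exp (- (LINT \<omega>|M. (c0 * X \<omega> + (\<Sum>i\<in>I. c i * Y i \<omega>))\<^sup>2) / 2)"
  shows "\<exists>c. AE \<omega> in M. cond_variance M (generated_by M I Y) X \<omega> = (LINT \<omega>|M. (X \<omega> - (\<Sum>i\<in>I. c i * Y i \<omega>))\<^sup>2)"
proof -
  let ?F = "generated_by M I Y"
  have Ym[measurable]: "\<And>i. i \<in> I \<Longrightarrow> Y i \<in> borel_measurable M"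
    using Y by (simp add: square_integrable_def)
  have [measurable]: "X \<in> borel_measurable M" using X by (simp add: square_integrable_def)
  have sub: "subalgebra M ?F" by (rule subalgebra_generated_by[OF Ym])
  interpret F: finite_measure_subalgebra M ?F by standard (rule sub)
  obtain c where c: "\<And>j. j \<in> I \<Longrightarrow> (LINT \<omega>|M. (X \<omega> - (\<Sum>i\<in>I. c i * Y i \<omega>)) * Y j \<omega>) = 0"
    using ex_orthogonal_projection[of I M Y X, OF I Y X] by blast
  define P where "P = (\<lambda>\<omega>. \<Sum>i\<in>I. c i * Y i \<omega>)"
  define R where "R = (\<lambda>\<omega>. X \<omega> - P \<omega>)"
  define v where "v = (LINT \<omega>|M. (R \<omega>)\<^sup>2)"
  have sP: "square_integrable M P" unfolding P_def
    by (intro square_integrable_sum square_integrable_cmult Y)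
  have sR: "square_integrable M R" unfolding R_def by (intro square_integrable_diff X sP)
  have [measurable]: "R \<in> borel_measurable M" "P \<in> borel_measurable M"
    using sR sP by (auto simp: square_integrable_def)
  have iR: "integrable M R" and iP: "integrable M P" and iX: "integrable M X"
    using sR sP X by (auto intro: square_integrable_integrable)
  have iR2: "integrable M (\<lambda>\<omega>. (R \<omega>)\<^sup>2)" using sR by (simp add: square_integrable_def)
  have PF: "P \<in> borel_measurable ?F"
    unfolding P_def by (intro borel_measurable_sum borel_measurable_times borel_measurable_const measurable_generated_by)

  have char: "(CLINT \<omega>|M. iexp (s * R \<omega> + (\<Sum>i\<in>I. t i * Y i \<omega>))) =
    (CLINT \<omega>|M. iexp (s * R \<omega>)) * (CLINT \<omega>|M. iexp (\<Sum>i\<in>I. t i * Y i \<omega>))" for s t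
  proof -
    define V where "V = (\<lambda>\<omega>. \<Sum>i\<in>I. t i * Y i \<omega>)"
    have sV: "square_integrable M V" unfolding V_def
      by (intro square_integrable_sum square_integrable_cmult Y)
    have RV: "(LINT \<omega>|M. R \<omega> * V \<omega>) = 0"
    proof -
      have "(LINT \<omega>|M. R \<omega> * V \<omega>) = (LINT \<omega>|M. (\<Sum>i\<in>I. t i * (R \<omega> * Y i \<omega>)))"
        by (simp add: V_def sum_distrib_left ac_simps)
      also have "\<dots> = (\<Sum>i\<in>I. t i * (LINT \<omega>|M. R \<omega> * Y i \<omega>))"
        using square_integrable_times[OF sR Y] by (subst Bochner_Integration.integral_sum) auto
      also have "\<dots> = 0" using c by (simp add: R_def P_def)
      finally show ?thesis .
    qed
    \<comment> \<open>\<open>gauss\<close> speaks of combinations of \<open>X\<close> and the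
      \<open>Y i\<close>; any combination of the residual and \<open>V\<close> is of this
      kind.\<close>
    have comb: "s * R \<omega> + t0 * V \<omega> = s * X \<omega> + (\<Sum>i\<in>I. (t0 * t i - s * c i) * Y i \<omega>)" for s t0 \<omega>
      by (simp add: R_def P_def V_def left_diff_distrib sum_subtractf sum_distrib_left algebra_simps)
    have g: "(CLINT \<omega>|M. iexp (s * R \<omega> + t0 * V \<omega>)) = exp (- (s\<^sup>2 * v + t0\<^sup>2 * (LINT \<omega>|M. (V \<omega>)\<^sup>2)) / 2)" for s t0
    proof -
      have iV: "integrable M (\<lambda>\<omega>. (V \<omega>)\<^sup>2)" using sV by (simp add: square_integrable_def)
      have "(LINT \<omega>|M. (s * R \<omega> + t0 * V \<omega>)\<^sup>2) = (LINT \<omega>|M. s\<^sup>2 * (R \<omega>)\<^sup>2 + t0\<^sup>2 * (V \<omega>)\<^sup>2 + (2 * s * t0) * (R \<omega> * V \<omega>))"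
        by (intro Bochner_Integration.integral_cong refl) (simp add: power2_sum power_mult_distrib)
      also have "\<dots> = s\<^sup>2 * v + t0\<^sup>2 * (LINT \<omega>|M. (V \<omega>)\<^sup>2)"
        using iR2 iV square_integrable_times[OF sR sV] RV by (simp add: v_def)
      finally have "(LINT \<omega>|M. (s * R \<omega> + t0 * V \<omega>)\<^sup>2) = s\<^sup>2 * v + t0\<^sup>2 * (LINT \<omega>|M. (V \<omega>)\<^sup>2)" .
      then show ?thesis using gauss[of s "\<lambda>i. t0 * t i - s * c i"] unfolding comb by simp
    qed
    have "complex_of_real (exp (- (s\<^sup>2 * v + (LINT \<omega>|M. (V \<omega>)\<^sup>2)) / 2)) = exp (- (s\<^sup>2 * v) / 2) * exp (- (LINT \<omega>|M. (V \<omega>)\<^sup>2) / 2)"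
      by (simp flip: exp_of_real exp_add add: field_simps)
    then show ?thesis using g[of s 1] g[of s 0] g[of 0 1] unfolding V_def by simp
  qed

  \<comment> \<open>The vanishing criterion is used twice. With \<open>s\<close> fixed, the centred
    variable \<open>iexp (s * R) - m\<close> integrates to 0 over every set of the generated
    sigma-algebra; then, with the set \<open>A\<close> fixed and \<open>s\<close> varying, the
    centred indicator of \<open>A\<close> integrates to 0 over every event of
    \<open>R\<close>.\<close>
  have indepA: "(LINT \<omega>|M. (indicator A \<omega> - prob A) * indicator B (R \<omega>)) = 0"
    if A: "A \<in> sets ?F" and B: "B \<in> sets borel" for A B
  proof (rule set_integral_eq_0_if_char_eq_0)
    have AM[measurable]: "A \<in> events" using A sub by (auto simp: subalgebra_def)
    show "integrable M (\<lambda>\<omega>. indicator A \<omega> - prob A)"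
      by (intro Bochner_Integration.integrable_diff) (simp_all add: emeasure_eq_measure)
    show "(CLINT \<omega>|M. complex_of_real (indicator A \<omega> - prob A) * iexp (s * R \<omega>)) = 0" for s
    proof -
      define m where "m = (CLINT \<omega>|M. iexp (s * R \<omega>))"
      have i1: "integrable M (\<lambda>\<omega>. iexp (s * R \<omega>))" by (rule integrable_iexp') simp
      have "(CLINT \<omega>:A|M. iexp (s * R \<omega>) - m) = 0"
      proof (rule complex_generated_integral_eq_0_if_char_eq_0[OF I _ Ym _ A])
        show "integrable M (\<lambda>\<omega>. iexp (s * R \<omega>) - m)" using i1 by simp
        fix t
        have i2: "integrable M (\<lambda>\<omega>. iexp (s * R \<omega> + (\<Sum>i\<in>I. t i * Y i \<omega>)))"
          by (rule integrable_iexp') simp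
        have i3: "integrable M (\<lambda>\<omega>. iexp (\<Sum>i\<in>I. t i * Y i \<omega>))" by (rule integrable_iexp') simp
        have "(CLINT \<omega>|M. (iexp (s * R \<omega>) - m) * iexp (\<Sum>i\<in>I. t i * Y i \<omega>)) =
          (CLINT \<omega>|M. iexp (s * R \<omega> + (\<Sum>i\<in>I. t i * Y i \<omega>)) - m * iexp (\<Sum>i\<in>I. t i * Y i \<omega>))"
          by (intro Bochner_Integration.integral_cong refl) (simp add: left_diff_distrib exp_add[symmetric] distrib_left)
        also have "\<dots> = 0" using i2 i3 char[of s t] by (simp add: m_def)
        finally show "(CLINT \<omega>|M. (iexp (s * R \<omega>) - m) * iexp (\<Sum>i\<in>I. t i * Y i \<omega>)) = 0" .
      qed
      then have "(CLINT \<omega>|M. indicator A \<omega> * (iexp (s * R \<omega>) - m)) = 0"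
        unfolding set_lebesgue_integral_def by (simp add: scaleR_conv_of_real of_real_indicator)
      moreover have i4: "integrable M (\<lambda>\<omega>. indicator A \<omega> * iexp (s * R \<omega>))"
        using integrable_mult_indicator[OF AM i1] by (simp add: scaleR_conv_of_real of_real_indicator)
      moreover have i5: "integrable M (\<lambda>\<omega>. indicator A \<omega> :: complex)"
        using integrable_mult_indicator[OF AM, of "\<lambda>_. 1 :: complex"] by (simp add: scaleR_conv_of_real of_real_indicator)
      moreover have "(CLINT \<omega>|M. indicator A \<omega>) = prob A"
      proof -
        have "(CLINT \<omega>|M. complex_of_real (indicator A \<omega>)) = complex_of_real (LINT \<omega>|M. indicator A \<omega>)"
          by (rule integral_complex_of_real)
        then show ?thesis by (simp add: of_real_indicator)
      qed
      ultimately have "(CLINT \<omega>|M. indicator A \<omega> * iexp (s * R \<omega>)) = m * prob A"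
        by (simp add: right_diff_distrib mult.commute[of _ m])
      moreover have "(CLINT \<omega>|M. complex_of_real (indicator A \<omega> - prob A) * iexp (s * R \<omega>)) =
        (CLINT \<omega>|M. indicator A \<omega> * iexp (s * R \<omega>) - prob A * iexp (s * R \<omega>))"
        by (intro Bochner_Integration.integral_cong refl) (simp add: left_diff_distrib of_real_indicator)
      ultimately show ?thesis using i1 i4 by (simp add: m_def)
    qed
  qed (use B in auto)
  \<comment> \<open>Independence of \<open>R\<close> from the indicator of each single
    \<open>A\<close> is enough: the product rule for independent variables then handles unbounded
    functions of \<open>R\<close>, namely \<open>R\<close> itself and its square.\<close>
  have ind: "indep_var borel R borel (indicat_real A)" if A: "A \<in> sets ?F" for A
  proof -
    let ?G1 = "{R -` B \<inter> space M |B. B \<in> sets borel}" and ?G2 = "{indicat_real A -` C \<inter> space M |C. C \<in> sets borel}"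
    have pre: "indicat_real A -` C \<inter> space M \<in> sets ?F" if "C \<in> sets borel" for C
    proof -
      have "indicat_real A \<in> borel_measurable ?F" using A by simp
      from measurable_sets[OF this that] show ?thesis by simp
    qed
    have iA: "indicat_real A \<in> borel_measurable M" using A sub by (auto simp: subalgebra_def)
    have prod: "prob (R -` B \<inter> space M \<inter> A') = prob (R -` B \<inter> space M) * prob A'"
      if A': "A' \<in> sets ?F" and B[measurable]: "B \<in> sets borel" for A' B
    proof -
      have AM[measurable]: "A' \<in> events" using A' sub by (auto simp: subalgebra_def)
      have "(LINT \<omega>|M. (indicator A' \<omega> - prob A') * indicator B (R \<omega>)) =
        (LINT \<omega>|M. indicator (R -` B \<inter> space M \<inter> A') \<omega> - prob A' * indicator (R -` B \<inter> space M) \<omega>)"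
        by (intro Bochner_Integration.integral_cong refl) (auto simp: indicator_def)
      also have "\<dots> = prob (R -` B \<inter> space M \<inter> A') - prob A' * prob (R -` B \<inter> space M)"
        by (subst Bochner_Integration.integral_diff) (simp_all add: emeasure_eq_measure)
      finally show ?thesis using indepA[OF A' B] by simp
    qed
    have "indep_set (sigma_sets (space M) ?G1) (sigma_sets (space M) ?G2)"
    proof (rule indep_set_sigma_sets)
      show "indep_set ?G1 ?G2"
        unfolding indep_sets2_eq
        using prod pre measurable_sets[OF iA] by auto
      show "Int_stable ?G1"
      proof (rule Int_stableI, clarify)
        fix a b :: "real set" assume "a \<in> sets borel" "b \<in> sets borel"
        then show "\<exists>B. R -` a \<inter> space M \<inter> (R -` b \<inter> space M) = R -` B \<inter> space M \<and> B \<in> sets borel"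
          by (intro exI[of _ "a \<inter> b"]) auto
      qed
      show "Int_stable ?G2"
      proof (rule Int_stableI, clarify)
        fix a b :: "real set" assume "a \<in> sets borel" "b \<in> sets borel"
        then show "\<exists>B. indicat_real A -` a \<inter> space M \<inter> (indicat_real A -` b \<inter> space M) = indicat_real A -` B \<inter> space M \<and> B \<in> sets borel"
          by (intro exI[of _ "a \<inter> b"]) auto
      qed
    qed
    then show ?thesis unfolding indep_var_eq using iA by simp
  qed
  have ia: "(LINT \<omega>:A|M. f (R \<omega>)) = prob A * (LINT \<omega>|M. f (R \<omega>))"
    if A: "A \<in> sets ?F" and f: "f \<in> borel_measurable borel" "integrable M (\<lambda>\<omega>. f (R \<omega>))" for A and f :: "real \<Rightarrow> real"
  proof -
    have AM[measurable]: "A \<in> events" using A sub by (auto simp: subalgebra_def)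
    have "indep_var borel (f \<circ> R) borel ((\<lambda>x. x) \<circ> indicat_real A)"
      by (rule indep_var_compose[OF ind[OF A] f(1)]) simp
    then have "indep_var borel (\<lambda>\<omega>. f (R \<omega>)) borel (indicat_real A)" by (simp add: comp_def)
    moreover have "integrable M (indicat_real A)" by (simp add: emeasure_eq_measure)
    ultimately have "(LINT \<omega>|M. f (R \<omega>) * indicat_real A \<omega>) = (LINT \<omega>|M. f (R \<omega>)) * (LINT \<omega>|M. indicat_real A \<omega>)"
      by (intro indep_var_lebesgue_integral f(2))
    then show ?thesis by (simp add: set_lebesgue_integral_def mult.commute)
  qed
  \<comment> \<open>The characteristic function of \<open>R\<close> is even, so \<open>R\<close> and
    \<open>-R\<close> have the same law and the mean is 0.\<close>
  have ER: "(LINT \<omega>|M. R \<omega>) = 0"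
  proof -
    have s1: "square_integrable M (\<lambda>\<omega>. - R \<omega>)" using square_integrable_cmult[OF sR, of "-1"] by simp
    have "distr M borel R = distr M borel (\<lambda>\<omega>. - R \<omega>)"
    proof (rule Levy_uniqueness)
      show "char (distr M borel R) = char (distr M borel (\<lambda>\<omega>. - R \<omega>))"
      proof
        fix s
        have r: "s * R \<omega> = s * X \<omega> + (\<Sum>i\<in>I. (- s * c i) * Y i \<omega>)" for s \<omega>
          by (simp add: R_def P_def sum_distrib_left algebra_simps sum_negf)
        have "(CLINT \<omega>|M. iexp (s * R \<omega>)) = exp (- (s\<^sup>2 * v) / 2)" for s
        proof -
          have "(LINT \<omega>|M. (s * R \<omega>)\<^sup>2) = s\<^sup>2 * v" by (simp add: power_mult_distrib v_def)
          then show ?thesis using gauss[of s "\<lambda>i. - s * c i"] unfolding r[symmetric] by simp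
        qed
        from this[of s] this[of "-s"]
        show "char (distr M borel R) s = char (distr M borel (\<lambda>\<omega>. - R \<omega>)) s"
          unfolding char_def by (simp add: integral_distr)
      qed
    qed (auto intro!: real_distribution_distr)
    then have "(LINT x|distr M borel R. x) = (LINT x|distr M borel (\<lambda>\<omega>. - R \<omega>). x)" by simp
    then show ?thesis by (simp add: integral_distr)
  qed
  have cR: "AE \<omega> in M. real_cond_exp M ?F X \<omega> = P \<omega>"
  proof (rule F.real_cond_exp_charact)
    fix A assume A: "A \<in> sets ?F"
    have AM[measurable]: "A \<in> events" using A sub by (auto simp: subalgebra_def)
    have "(LINT \<omega>:A|M. R \<omega>) = 0" using ia[OF A, of "\<lambda>x. x"] iR ER by simp
    moreover have "(LINT \<omega>:A|M. R \<omega>) = (LINT \<omega>:A|M. X \<omega>) - (LINT \<omega>:A|M. P \<omega>)"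
      unfolding R_def using integrable_mult_indicator[OF AM iX] integrable_mult_indicator[OF AM iP]
      by (intro set_integral_diff) (auto simp: set_integrable_def)
    ultimately show "(LINT \<omega>:A|M. X \<omega>) = (LINT \<omega>:A|M. P \<omega>)" by simp
  qed (use iX iP PF in auto)
  have "AE \<omega> in M. real_cond_exp M ?F (\<lambda>\<omega>. (X \<omega> - real_cond_exp M ?F X \<omega>)\<^sup>2) \<omega> = real_cond_exp M ?F (\<lambda>\<omega>. (R \<omega>)\<^sup>2) \<omega>"
  proof (rule F.real_cond_exp_cong)
    show "AE \<omega> in M. (X \<omega> - real_cond_exp M ?F X \<omega>)\<^sup>2 = (R \<omega>)\<^sup>2"
      using cR by eventually_elim (simp add: R_def)
  qed (auto intro: measurable_from_subalg[OF sub])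
  moreover have "AE \<omega> in M. real_cond_exp M ?F (\<lambda>\<omega>. (R \<omega>)\<^sup>2) \<omega> = v"
  proof (rule F.real_cond_exp_charact)
    fix A assume A: "A \<in> sets ?F"
    have AM[measurable]: "A \<in> events" using A sub by (auto simp: subalgebra_def)
    show "(LINT \<omega>:A|M. (R \<omega>)\<^sup>2) = (LINT \<omega>:A|M. v)"
      using ia[OF A, of "\<lambda>x. x\<^sup>2"] iR2 by (simp add: v_def set_lebesgue_integral_def)
  qed (use iR2 in auto)
  ultimately have "AE \<omega> in M. cond_variance M ?F X \<omega> = v"
    unfolding cond_variance_def by eventually_elim simp
  then show ?thesis unfolding v_def R_def P_def by blast
qed

section \<open>Wiener integrals and duality\<close>

lemma square_integrable_cauchy_schwarz:
  assumes f: "square_integrable M f" and g: "square_integrable M g"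
  shows "(LINT x|M. f x * g x)\<^sup>2 \<le> (LINT x|M. (f x)\<^sup>2) * (LINT x|M. (g x)\<^sup>2)"
proof -
  define F where "F = (LINT x|M. (f x)\<^sup>2)"
  define G where "G = (LINT x|M. (g x)\<^sup>2)"
  define C where "C = (LINT x|M. f x * g x)"
  have int: "integrable M (\<lambda>x. (f x)\<^sup>2)" "integrable M (\<lambda>x. (g x)\<^sup>2)" "integrable M (\<lambda>x. f x * g x)"
    using f g square_integrable_times[OF f g] by (auto simp: square_integrable_def)
  have quad: "0 \<le> s\<^sup>2 * F - 2 * s * t * C + t\<^sup>2 * G" for s t
  proof -
    have "0 \<le> (LINT x|M. (s * f x - t * g x)\<^sup>2)" by simp
    also have "\<dots> = (LINT x|M. s\<^sup>2 * (f x)\<^sup>2 - (2 * s * t) * (f x * g x) + t\<^sup>2 * (g x)\<^sup>2)"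
      by (intro Bochner_Integration.integral_cong refl) (simp add: power2_diff power_mult_distrib)
    also have "\<dots> = s\<^sup>2 * F - 2 * s * t * C + t\<^sup>2 * G"
      using int by (simp add: F_def G_def C_def)
    finally show ?thesis .
  qed
  have F0: "0 \<le> F" by (simp add: F_def)
  have "C\<^sup>2 \<le> F * G"
  proof (cases "F = 0")
    case True
    have "C = 0"
    proof (rule ccontr)
      assume "C \<noteq> 0"
      \<comment> \<open>For F = 0 and t = 1 the form is affine in s, and this s makes it equal to
        -1.\<close>
      then show False using quad[of "(G + 1) / (2 * C)" 1] True by (simp add: field_simps)
    qed
    then show ?thesis using True by simp
  next
    case False
    then have "0 < F" using F0 by simp
    moreover have "0 \<le> F * (F * G - C\<^sup>2)"
      using quad[of C F] by (simp add: power2_eq_square algebra_simps)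
    ultimately show ?thesis by (simp add: zero_le_mult_iff)
  qed
  then show ?thesis by (simp add: F_def G_def C_def)
qed

section \<open>Square-mean limits of Gaussian variables\<close>

definition l2_limit :: "'a measure \<Rightarrow> (nat \<Rightarrow> 'a \<Rightarrow> real) \<Rightarrow> ('a \<Rightarrow> real) \<Rightarrow> bool" where
  "l2_limit M S X \<longleftrightarrow> square_integrable M X \<and> (\<forall>k. square_integrable M (S k)) \<and>
     (\<lambda>k. LINT \<omega>|M. (X \<omega> - S k \<omega>)\<^sup>2) \<longlonglongrightarrow> 0"

text \<open>Convergence of the possibly infinite integrals makes \<open>X - S k\<close> square
  integrable for one \<open>k\<close>, hence \<open>X\<close> itself. From then on the real-valued
  integrals carry the same information.\<close>

lemma l2_limitI:
  assumes X[measurable]: "X \<in> borel_measurable M" and S: "\<And>k. square_integrable M (S k)"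
    and lim: "(\<lambda>k. \<integral>\<^sup>+ \<omega>. ennreal ((X \<omega> - S k \<omega>)\<^sup>2) \<partial>M) \<longlonglongrightarrow> 0"
  shows "l2_limit M S X"
proof -
  have [measurable]: "S k \<in> borel_measurable M" for k using S by measurable
  have "eventually (\<lambda>k. (\<integral>\<^sup>+ \<omega>. ennreal ((X \<omega> - S k \<omega>)\<^sup>2) \<partial>M) < 1) sequentially"
    using order_tendstoD(2)[OF lim, of 1] by simp
  then obtain k where "(\<integral>\<^sup>+ \<omega>. ennreal ((X \<omega> - S k \<omega>)\<^sup>2) \<partial>M) < 1"
    by (auto simp: eventually_sequentially)
  then have "(\<integral>\<^sup>+ \<omega>. ennreal ((X \<omega> - S k \<omega>)\<^sup>2) \<partial>M) < \<infinity>"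
    by (rule less_trans) simp
  then have "integrable M (\<lambda>\<omega>. (X \<omega> - S k \<omega>)\<^sup>2)"
    by (intro integrableI_nonneg) auto
  then have "square_integrable M (\<lambda>\<omega>. X \<omega> - S k \<omega>)" by (simp add: square_integrable_def)
  from square_integrable_add[OF this S[of k]] have sX: "square_integrable M X" by simp
  have "(LINT \<omega>|M. (X \<omega> - S k \<omega>)\<^sup>2) = enn2real (\<integral>\<^sup>+ \<omega>. ennreal ((X \<omega> - S k \<omega>)\<^sup>2) \<partial>M)" for k
    by (rule integral_eq_nn_integral) auto
  moreover have "(\<lambda>k. enn2real (\<integral>\<^sup>+ \<omega>. ennreal ((X \<omega> - S k \<omega>)\<^sup>2) \<partial>M)) \<longlonglongrightarrow> 0"
    using lim by (intro tendsto_enn2real) auto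
  ultimately show ?thesis using sX S by (simp add: l2_limit_def)
qed

lemma l2_limit_cmult:
  assumes "l2_limit M S X"
  shows "l2_limit M (\<lambda>k \<omega>. c * S k \<omega>) (\<lambda>\<omega>. c * X \<omega>)"
proof -
  have "(LINT \<omega>|M. (c * X \<omega> - c * S k \<omega>)\<^sup>2) = c\<^sup>2 * (LINT \<omega>|M. (X \<omega> - S k \<omega>)\<^sup>2)" for k
    by (simp flip: right_diff_distrib add: power_mult_distrib)
  moreover have "(\<lambda>k. c\<^sup>2 * (LINT \<omega>|M. (X \<omega> - S k \<omega>)\<^sup>2)) \<longlonglongrightarrow> c\<^sup>2 * 0"
    using assms by (intro tendsto_mult) (auto simp: l2_limit_def)
  ultimately show ?thesis
    using assms by (auto simp: l2_limit_def intro: square_integrable_cmult)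
qed

lemma l2_limit_add:
  assumes 1: "l2_limit M S X" and 2: "l2_limit M T Y"
  shows "l2_limit M (\<lambda>k \<omega>. S k \<omega> + T k \<omega>) (\<lambda>\<omega>. X \<omega> + Y \<omega>)"
proof -
  have s: "square_integrable M (\<lambda>\<omega>. X \<omega> - S k \<omega>)" "square_integrable M (\<lambda>\<omega>. Y \<omega> - T k \<omega>)" for k
    using 1 2 by (auto simp: l2_limit_def intro: square_integrable_diff)
  have "(LINT \<omega>|M. (X \<omega> + Y \<omega> - (S k \<omega> + T k \<omega>))\<^sup>2) \<le>
    2 * (LINT \<omega>|M. (X \<omega> - S k \<omega>)\<^sup>2) + 2 * (LINT \<omega>|M. (Y \<omega> - T k \<omega>)\<^sup>2)" for k
  proof -
    have "(LINT \<omega>|M. (X \<omega> + Y \<omega> - (S k \<omega> + T k \<omega>))\<^sup>2) \<le> (LINT \<omega>|M. 2 * (X \<omega> - S k \<omega>)\<^sup>2 + 2 * (Y \<omega> - T k \<omega>)\<^sup>2)"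
    proof (rule integral_mono)
      show "integrable M (\<lambda>\<omega>. (X \<omega> + Y \<omega> - (S k \<omega> + T k \<omega>))\<^sup>2)"
        using square_integrable_add[OF s, of k] by (simp add: square_integrable_def algebra_simps)
      show "integrable M (\<lambda>\<omega>. 2 * (X \<omega> - S k \<omega>)\<^sup>2 + 2 * (Y \<omega> - T k \<omega>)\<^sup>2)"
        using s[of k] by (auto simp: square_integrable_def)
      have "(a + b)\<^sup>2 \<le> 2 * a\<^sup>2 + 2 * b\<^sup>2" for a b :: real
        using zero_le_power2[of "a - b"] unfolding power2_sum power2_diff by linarith
      from this[of "X \<omega> - S k \<omega>" "Y \<omega> - T k \<omega>" for \<omega>]
      show "(X \<omega> + Y \<omega> - (S k \<omega> + T k \<omega>))\<^sup>2 \<le> 2 * (X \<omega> - S k \<omega>)\<^sup>2 + 2 * (Y \<omega> - T k \<omega>)\<^sup>2" for \<omega>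
        by (simp add: algebra_simps)
    qed
    also have "\<dots> = 2 * (LINT \<omega>|M. (X \<omega> - S k \<omega>)\<^sup>2) + 2 * (LINT \<omega>|M. (Y \<omega> - T k \<omega>)\<^sup>2)"
      using s[of k] by (subst Bochner_Integration.integral_add) (auto simp: square_integrable_def)
    finally show ?thesis .
  qed
  then have le: "norm (LINT \<omega>|M. (X \<omega> + Y \<omega> - (S k \<omega> + T k \<omega>))\<^sup>2) \<le>
    2 * (LINT \<omega>|M. (X \<omega> - S k \<omega>)\<^sup>2) + 2 * (LINT \<omega>|M. (Y \<omega> - T k \<omega>)\<^sup>2)" for k
    by simp
  have "(\<lambda>k. 2 * (LINT \<omega>|M. (X \<omega> - S k \<omega>)\<^sup>2) + 2 * (LINT \<omega>|M. (Y \<omega> - T k \<omega>)\<^sup>2)) \<longlonglongrightarrow> 2 * 0 + 2 * 0"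
    using 1 2 unfolding l2_limit_def by (intro tendsto_intros) blast+
  then have "(\<lambda>k. 2 * (LINT \<omega>|M. (X \<omega> - S k \<omega>)\<^sup>2) + 2 * (LINT \<omega>|M. (Y \<omega> - T k \<omega>)\<^sup>2)) \<longlonglongrightarrow> 0"
    by simp
  from Lim_null_comparison[OF always_eventually[OF allI[OF le]] this]
  have "(\<lambda>k. LINT \<omega>|M. (X \<omega> + Y \<omega> - (S k \<omega> + T k \<omega>))\<^sup>2) \<longlonglongrightarrow> 0" .
  then show ?thesis using 1 2 by (auto simp: l2_limit_def intro: square_integrable_add)
qed

lemma l2_limit_sum:
  assumes "finite I" "\<And>i. i \<in> I \<Longrightarrow> l2_limit M (S i) (X i)"
  shows "l2_limit M (\<lambda>k \<omega>. \<Sum>i\<in>I. S i k \<omega>) (\<lambda>\<omega>. \<Sum>i\<in>I. X i \<omega>)"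
  using assms
  by (induction I rule: finite_induct) (auto intro: l2_limit_add simp: l2_limit_def[of M "\<lambda>_ _. 0"] square_integrable_def)

lemma l2_limit_integral_sq:
  assumes "l2_limit M S X"
  shows "(\<lambda>k. LINT \<omega>|M. (S k \<omega>)\<^sup>2) \<longlonglongrightarrow> (LINT \<omega>|M. (X \<omega>)\<^sup>2)"
proof -
  have X: "square_integrable M X" and S: "\<And>k. square_integrable M (S k)"
    and lim: "(\<lambda>k. LINT \<omega>|M. (X \<omega> - S k \<omega>)\<^sup>2) \<longlonglongrightarrow> 0"
    using assms by (auto simp: l2_limit_def)
  define d where "d k = (LINT \<omega>|M. (X \<omega> - S k \<omega>)\<^sup>2)" for k
  define e where "e k = (LINT \<omega>|M. X \<omega> * (X \<omega> - S k \<omega>))" for k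
  have D: "square_integrable M (\<lambda>\<omega>. X \<omega> - S k \<omega>)" for k by (intro square_integrable_diff X S)
  have "(LINT \<omega>|M. (S k \<omega>)\<^sup>2) = (LINT \<omega>|M. (X \<omega>)\<^sup>2) - 2 * e k + d k" for k
  proof -
    have "(LINT \<omega>|M. (S k \<omega>)\<^sup>2) = (LINT \<omega>|M. (X \<omega>)\<^sup>2 - 2 * (X \<omega> * (X \<omega> - S k \<omega>)) + (X \<omega> - S k \<omega>)\<^sup>2)"
      by (intro Bochner_Integration.integral_cong refl) (simp add: power2_eq_square algebra_simps)
    then show ?thesis
      using X D[of k] square_integrable_times[OF X D[of k]] by (simp add: square_integrable_def d_def e_def)
  qed
  moreover have "e \<longlonglongrightarrow> 0"
  proof -
    have le: "norm (e k) \<le> sqrt ((LINT \<omega>|M. (X \<omega>)\<^sup>2) * d k)" for k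
      using square_integrable_cauchy_schwarz[OF X D[of k]]
      unfolding e_def d_def by (intro real_le_rsqrt) simp
    have "(\<lambda>k. sqrt ((LINT \<omega>|M. (X \<omega>)\<^sup>2) * d k)) \<longlonglongrightarrow> sqrt ((LINT \<omega>|M. (X \<omega>)\<^sup>2) * 0)"
      using lim unfolding d_def by (intro tendsto_intros)
    then have "(\<lambda>k. sqrt ((LINT \<omega>|M. (X \<omega>)\<^sup>2) * d k)) \<longlonglongrightarrow> 0" by simp
    from Lim_null_comparison[OF always_eventually[OF allI[OF le]] this] show ?thesis .
  qed
  then have "(\<lambda>k. (LINT \<omega>|M. (X \<omega>)\<^sup>2) - 2 * e k + d k) \<longlonglongrightarrow> (LINT \<omega>|M. (X \<omega>)\<^sup>2) - 2 * 0 + 0"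
    using lim unfolding d_def by (intro tendsto_intros)
  ultimately show ?thesis by simp
qed

text \<open>The exponential of an imaginary argument is 1-Lipschitz, and on a probability space the
  first absolute moment is below the root of the second.\<close>

lemma (in prob_space) l2_limit_char:
  assumes "l2_limit M S X"
  shows "(\<lambda>k. CLINT \<omega>|M. iexp (S k \<omega>)) \<longlonglongrightarrow> (CLINT \<omega>|M. iexp (X \<omega>))"
proof -
  have X: "square_integrable M X" and S: "\<And>k. square_integrable M (S k)"
    and lim: "(\<lambda>k. LINT \<omega>|M. (X \<omega> - S k \<omega>)\<^sup>2) \<longlonglongrightarrow> 0"
    using assms by (auto simp: l2_limit_def)
  have D: "square_integrable M (\<lambda>\<omega>. X \<omega> - S k \<omega>)" for k by (intro square_integrable_diff X S)
  have Da: "square_integrable M (\<lambda>\<omega>. \<bar>X \<omega> - S k \<omega>\<bar>)" for k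
    using D[of k] by (auto simp: square_integrable_def)
  have ii: "integrable M (\<lambda>\<omega>. iexp (f \<omega>))" if "square_integrable M f" for f
    using that by (intro integrable_iexp') (simp add: square_integrable_def)
  have bd: "norm ((CLINT \<omega>|M. iexp (S k \<omega>)) - (CLINT \<omega>|M. iexp (X \<omega>))) \<le> sqrt (LINT \<omega>|M. (X \<omega> - S k \<omega>)\<^sup>2)" for k
  proof -
    have "norm ((CLINT \<omega>|M. iexp (S k \<omega>)) - (CLINT \<omega>|M. iexp (X \<omega>))) = norm (CLINT \<omega>|M. iexp (S k \<omega>) - iexp (X \<omega>))"
      using ii[OF X] ii[OF S] by simp
    also have "\<dots> \<le> (LINT \<omega>|M. norm (iexp (S k \<omega>) - iexp (X \<omega>)))" by (rule integral_norm_bound)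
    also have "\<dots> \<le> (LINT \<omega>|M. \<bar>X \<omega> - S k \<omega>\<bar>)"
    proof (rule integral_mono)
      show "integrable M (\<lambda>\<omega>. norm (iexp (S k \<omega>) - iexp (X \<omega>)))"
        using ii[OF X] ii[OF S] by (intro integrable_norm Bochner_Integration.integrable_diff)
      show "integrable M (\<lambda>\<omega>. \<bar>X \<omega> - S k \<omega>\<bar>)" using square_integrable_integrable[OF Da] .
      fix \<omega>
      have "iexp (S k \<omega>) - iexp (X \<omega>) = iexp (X \<omega>) * (iexp (S k \<omega> - X \<omega>) - 1)"
        by (simp add: right_diff_distrib mult_exp_exp)
      then have "norm (iexp (S k \<omega>) - iexp (X \<omega>)) = norm (iexp (S k \<omega> - X \<omega>) - 1)"
        by (simp add: norm_mult)
      also have "\<dots> \<le> \<bar>S k \<omega> - X \<omega>\<bar>" using iexp_approx1[of "S k \<omega> - X \<omega>" 0] by simp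
      finally show "norm (iexp (S k \<omega>) - iexp (X \<omega>)) \<le> \<bar>X \<omega> - S k \<omega>\<bar>" by simp
    qed
    also have "\<dots> \<le> sqrt (LINT \<omega>|M. (X \<omega> - S k \<omega>)\<^sup>2)"
      using square_integrable_cauchy_schwarz[OF Da, of "\<lambda>_. 1" k]
      by (intro real_le_rsqrt) (simp add: square_integrable_def prob_space)
    finally show ?thesis .
  qed
  have "(\<lambda>k. sqrt (LINT \<omega>|M. (X \<omega> - S k \<omega>)\<^sup>2)) \<longlonglongrightarrow> sqrt 0" by (intro tendsto_intros lim)
  then have lim0: "(\<lambda>k. sqrt (LINT \<omega>|M. (X \<omega> - S k \<omega>)\<^sup>2)) \<longlonglongrightarrow> 0" by simp
  have "(\<lambda>k. (CLINT \<omega>|M. iexp (S k \<omega>)) - (CLINT \<omega>|M. iexp (X \<omega>))) \<longlonglongrightarrow> 0"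
    by (rule Lim_null_comparison[OF always_eventually[OF allI] lim0]) (rule bd)
  then show ?thesis by (rule LIM_zero_cancel)
qed

text \<open>This form treats the density case and the degenerate case alike and, unlike a density,
  is stable under square-mean limits.\<close>

lemma (in prob_space) centered_gaussian_char:
  assumes "centered_gaussian M X"
  shows "square_integrable M X" "(CLINT \<omega>|M. iexp (X \<omega>)) = exp (- (LINT \<omega>|M. (X \<omega>)\<^sup>2) / 2)"
proof -
  have [measurable]: "X \<in> borel_measurable M" using assms by (simp add: centered_gaussian_def)
  have "square_integrable M X \<and> (CLINT \<omega>|M. iexp (X \<omega>)) = exp (- (LINT \<omega>|M. (X \<omega>)\<^sup>2) / 2)"
  proof (cases "AE \<omega> in M. X \<omega> = 0")
    case True
    have 1: "AE \<omega> in M. (X \<omega>)\<^sup>2 = 0" using True by eventually_elim simp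
    have 2: "AE \<omega> in M. iexp (X \<omega>) = 1"
      by (rule AE_mp[OF True]) (intro AE_I2 impI, simp only: of_real_0 mult_zero_right exp_zero)
    have "integrable M (\<lambda>\<omega>. (X \<omega>)\<^sup>2)"
    proof (rule integrable_cong_AE_imp)
      show "integrable M (\<lambda>\<omega>. 0 :: real)" by simp
      show "AE \<omega> in M. 0 = (X \<omega>)\<^sup>2" using 1 by eventually_elim simp
    qed simp
    moreover have "(LINT \<omega>|M. (X \<omega>)\<^sup>2) = 0" using 1 by (rule integral_eq_zero_AE)
    moreover have "(CLINT \<omega>|M. iexp (X \<omega>)) = (CLINT \<omega>|M. 1)" by (rule integral_cong_AE[OF _ _ 2]) simp_all
    ultimately show ?thesis by (simp add: square_integrable_def prob_space)
  next
    case False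
    then obtain \<sigma> where s: "\<sigma> > 0" and d: "distributed M lborel X (normal_density 0 \<sigma>)"
      using assms by (auto simp: centered_gaussian_def)
    have "integrable lborel (\<lambda>x. normal_density 0 \<sigma> x * (x - 0)\<^sup>2)" using s by (rule integrable_normal_moment)
    then have i: "integrable M (\<lambda>\<omega>. (X \<omega>)\<^sup>2)"
      using distributed_integrable[OF d, of "\<lambda>x. x\<^sup>2"] by simp
    have v: "(LINT \<omega>|M. (X \<omega>)\<^sup>2) = \<sigma>\<^sup>2"
      using normal_distributed_variance[OF s d] normal_distributed_expectation[OF s d] by simp
    have "distributed M lborel (\<lambda>\<omega>. (X \<omega> - 0) / \<sigma>) std_normal_density"
      using d normal_standard_normal_convert[OF s, of X 0] by simp
    then have "distr M borel (\<lambda>\<omega>. X \<omega> / \<sigma>) = std_normal_distribution"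
      using distributed_distr_eq_density[of M lborel] by (simp cong: distr_cong)
    then have "char (distr M borel (\<lambda>\<omega>. X \<omega> / \<sigma>)) \<sigma> = exp (- (\<sigma>\<^sup>2) / 2)"
      by (simp add: char_std_normal_distribution)
    then have "(CLINT \<omega>|M. iexp (X \<omega>)) = exp (- (\<sigma>\<^sup>2) / 2)"
      unfolding char_def using s by (simp add: integral_distr)
    then show ?thesis using i v by (simp add: square_integrable_def)
  qed
  then show "square_integrable M X" "(CLINT \<omega>|M. iexp (X \<omega>)) = exp (- (LINT \<omega>|M. (X \<omega>)\<^sup>2) / 2)"
    by auto
qed

section \<open>The covariance form of a noise and its dual bounds\<close>

definition noise_form :: "(real \<times> (real ^ 'n) \<times> (real ^ 'n)) measure \<Rightarrow> (real \<times> (real ^ 'n) \<Rightarrow> real) \<Rightarrow> real" where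
  "noise_form \<Lambda> h = (LINT (s, y, z)|\<Lambda>. h (s, y) * h (s, z))"

text \<open>\<open>measure\<close> is 0 on sets of infinite mass. Finiteness makes the prescribed
  covariances genuine values of the covariance measure and simple functions integrable.\<close>

definition locally_finite_covariance :: "(real \<times> (real ^ 'n) \<times> (real ^ 'n)) measure \<Rightarrow> bool" where
  "locally_finite_covariance \<Lambda> \<longleftrightarrow> sets \<Lambda> = sets borel \<and>
     (\<forall>A\<in>bounded_borel. \<forall>B\<in>bounded_borel. emeasure \<Lambda> {(s, y, z). (s, y) \<in> A \<and> (s, z) \<in> B} < \<infinity>)"

text \<open>The least such \<kappa> is the squared dual norm of \<open>g\<close> with respect to the
  noise form. The two side conditions on \<open>h\<close> keep both integrals from being 0 merely by
  default.\<close>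

definition dual_bound ::
  "(real \<times> (real ^ 'n) \<times> (real ^ 'n)) measure \<Rightarrow> (real \<times> (real ^ 'n) \<Rightarrow> real) \<Rightarrow> real \<Rightarrow> bool" where
  "dual_bound \<Lambda> g \<kappa> \<longleftrightarrow> 0 \<le> \<kappa> \<and>
     (\<forall>h\<in>borel_measurable borel. plus_norm_sq \<Lambda> h < \<infinity> \<longrightarrow> integrable lborel (\<lambda>p. h p * g p) \<longrightarrow>
        (LINT p|lborel. h p * g p)\<^sup>2 \<le> \<kappa> * noise_form \<Lambda> h)"

lemma noise_form_le_plus_norm_sq:
  assumes "plus_norm_sq \<Lambda> h < \<infinity>"
  shows "noise_form \<Lambda> h \<le> enn2real (plus_norm_sq \<Lambda> h)"
proof (cases "integrable \<Lambda> (\<lambda>(s, y, z). h (s, y) * h (s, z))")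
  case True
  have "ennreal (norm (noise_form \<Lambda> h)) \<le> (\<integral>\<^sup>+x. ennreal (norm (case x of (s, y, z) \<Rightarrow> h (s, y) * h (s, z))) \<partial>\<Lambda>)"
    unfolding noise_form_def by (rule integral_norm_bound_ennreal[OF True])
  also have "\<dots> = plus_norm_sq \<Lambda> h"
    unfolding plus_norm_sq_def by (intro nn_integral_cong) (auto simp: abs_mult)
  finally have "norm (noise_form \<Lambda> h) \<le> enn2real (plus_norm_sq \<Lambda> h)"
    using assms by (metis enn2real_ennreal enn2real_mono infinity_ennreal_def norm_ge_zero)
  then show ?thesis by simp
next
  case False
  then show ?thesis by (simp add: noise_form_def not_integrable_integral_eq)
qed

lemma section_pair_measurable:
  assumes "A \<in> sets borel" "B \<in> sets borel"
  shows "{(s :: real, y :: real ^ 'n, z :: real ^ 'n). (s, y) \<in> A \<and> (s, z) \<in> B} \<in> sets borel"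
proof -
  have eq: "{(s :: real, y :: real ^ 'n, z :: real ^ 'n). (s, y) \<in> A \<and> (s, z) \<in> B} =
    (\<lambda>x. (fst x, fst (snd x))) -` A \<inter> space borel \<inter> ((\<lambda>x. (fst x, snd (snd x))) -` B \<inter> space borel)"
    by auto
  have 1: "(\<lambda>x :: real \<times> (real ^ 'n) \<times> (real ^ 'n). (fst x, fst (snd x))) \<in> borel \<rightarrow>\<^sub>M borel"
    by (intro borel_measurable_continuous_onI continuous_intros)
  have 2: "(\<lambda>x :: real \<times> (real ^ 'n) \<times> (real ^ 'n). (fst x, snd (snd x))) \<in> borel \<rightarrow>\<^sub>M borel"
    by (intro borel_measurable_continuous_onI continuous_intros)
  show ?thesis unfolding eq
    by (intro sets.Int measurable_sets[OF 1] measurable_sets[OF 2] assms)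
qed

lemma gaussian_noise_gaussian:
  assumes "gaussian_noise M \<Lambda> W" "finite F" "F \<subseteq> bounded_borel"
  shows "centered_gaussian M (\<lambda>\<omega>. \<Sum>A\<in>F. c A * W A \<omega>)"
  using assms by (simp add: gaussian_noise_def)

lemma gaussian_noise_covariance:
  assumes "gaussian_noise M \<Lambda> W" "A \<in> bounded_borel" "B \<in> bounded_borel"
  shows "(LINT \<omega>|M. W A \<omega> * W B \<omega>) = measure \<Lambda> {(s, y, z). (s, y) \<in> A \<and> (s, z) \<in> B}"
  using assms unfolding gaussian_noise_def by blast

text \<open>Both squares expand over pairs of sets, where the noise covariance and the mass of the
  section pair agree term by term. Finiteness of the plus norm makes simple functions admissible in
  \<open>dual_bound\<close>.\<close>

lemma noise_isometry:
  fixes \<Lambda> :: "(real \<times> (real ^ 'n) \<times> (real ^ 'n)) measure"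
  assumes M: "prob_space M" and W: "gaussian_noise M \<Lambda> W" and loc: "locally_finite_covariance \<Lambda>"
    and G: "finite G" "G \<subseteq> bounded_borel"
  shows "plus_norm_sq \<Lambda> (\<lambda>p. \<Sum>A\<in>G. d A * indicator A p) < \<infinity>"
    and "(LINT \<omega>|M. (\<Sum>A\<in>G. d A * W A \<omega>)\<^sup>2) = noise_form \<Lambda> (\<lambda>p. \<Sum>A\<in>G. d A * indicator A p)"
proof -
  interpret prob_space M by (rule M)
  let ?E = "\<lambda>A B. {(s, y, z). (s, y) \<in> A \<and> (s, z) \<in> B} :: (real \<times> (real ^ 'n) \<times> (real ^ 'n)) set"
  have sets: "sets \<Lambda> = sets borel" using loc by (simp add: locally_finite_covariance_def)
  have Es: "?E A B \<in> sets \<Lambda>" if "A \<in> G" "B \<in> G" for A B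
    unfolding sets using that G by (intro section_pair_measurable) (auto simp: bounded_borel_def)
  have Ef: "emeasure \<Lambda> (?E A B) < \<infinity>" if "A \<in> G" "B \<in> G" for A B
    using that G loc unfolding locally_finite_covariance_def by blast
  have sq: "square_integrable M (W A)" if "A \<in> G" for A
  proof -
    have "centered_gaussian M (\<lambda>\<omega>. \<Sum>A\<in>{A}. 1 * W A \<omega>)"
      using that G by (intro gaussian_noise_gaussian[OF W]) auto
    then show ?thesis using centered_gaussian_char(1)[of "W A"] by simp
  qed
  have prod: "(case x of (s, y, z) \<Rightarrow> (\<Sum>A\<in>G. d A * indicator A (s, y)) * (\<Sum>A\<in>G. d A * indicator A (s, z))) =
    (\<Sum>A\<in>G. \<Sum>B\<in>G. (d A * d B) * indicat_real (?E A B) x)" for x d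
    by (cases x) (auto simp: sum_product indicator_def intro!: sum.cong)
  show "plus_norm_sq \<Lambda> (\<lambda>p. \<Sum>A\<in>G. d A * indicator A p) < \<infinity>"
  proof -
    have "plus_norm_sq \<Lambda> (\<lambda>p. \<Sum>A\<in>G. d A * indicator A p) \<le>
      (\<integral>\<^sup>+x. (\<Sum>A\<in>G. \<Sum>B\<in>G. ennreal (\<bar>d A\<bar> * \<bar>d B\<bar>) * indicator (?E A B) x) \<partial>\<Lambda>)"
      unfolding plus_norm_sq_def
    proof (rule nn_integral_mono, clarify)
      fix s :: real and y z :: "real ^ 'n"
      have "\<bar>\<Sum>A\<in>G. d A * indicator A (s, y)\<bar> * \<bar>\<Sum>A\<in>G. d A * indicator A (s, z)\<bar> \<le>
        (\<Sum>A\<in>G. \<bar>d A\<bar> * indicator A (s, y)) * (\<Sum>A\<in>G. \<bar>d A\<bar> * indicator A (s, z))"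
        by (intro mult_mono order_trans[OF sum_abs] sum_mono sum_nonneg) (auto simp: abs_mult)
      also have "\<dots> = (\<Sum>A\<in>G. \<Sum>B\<in>G. (\<bar>d A\<bar> * \<bar>d B\<bar>) * indicat_real (?E A B) (s, y, z))"
        using prod[of "\<lambda>A. \<bar>d A\<bar>" "(s, y, z)"] by simp
      finally have "ennreal (\<bar>\<Sum>A\<in>G. d A * indicator A (s, y)\<bar> * \<bar>\<Sum>A\<in>G. d A * indicator A (s, z)\<bar>) \<le>
        ennreal (\<Sum>A\<in>G. \<Sum>B\<in>G. (\<bar>d A\<bar> * \<bar>d B\<bar>) * indicat_real (?E A B) (s, y, z))"
        by (rule ennreal_leI)
      also have "\<dots> = (\<Sum>A\<in>G. \<Sum>B\<in>G. ennreal (\<bar>d A\<bar> * \<bar>d B\<bar>) * indicator (?E A B) (s, y, z))"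
      proof -
        have "(\<Sum>A\<in>G. \<Sum>B\<in>G. ennreal (\<bar>d A\<bar> * \<bar>d B\<bar>) * indicator (?E A B) (s, y, z)) =
          (\<Sum>A\<in>G. \<Sum>B\<in>G. ennreal ((\<bar>d A\<bar> * \<bar>d B\<bar>) * indicat_real (?E A B) (s, y, z)))"
          by (intro sum.cong refl) (auto simp: indicator_def)
        then show ?thesis by (simp add: sum_nonneg)
      qed
      finally show "ennreal (\<bar>\<Sum>A\<in>G. d A * indicator A (s, y)\<bar> * \<bar>\<Sum>A\<in>G. d A * indicator A (s, z)\<bar>) \<le>
        (\<Sum>A\<in>G. \<Sum>B\<in>G. ennreal (\<bar>d A\<bar> * \<bar>d B\<bar>) * indicator (?E A B) (s, y, z))" .
    qed
    also have "\<dots> = (\<Sum>A\<in>G. \<Sum>B\<in>G. ennreal (\<bar>d A\<bar> * \<bar>d B\<bar>) * emeasure \<Lambda> (?E A B))"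
      using Es by (simp add: nn_integral_sum nn_integral_cmult_indicator)
    also have "\<dots> < \<infinity>"
      using Ef G(1) by (simp add: ennreal_mult_less_top)
    finally show ?thesis .
  qed
  have "(LINT \<omega>|M. (\<Sum>A\<in>G. d A * W A \<omega>)\<^sup>2) = (LINT \<omega>|M. (\<Sum>A\<in>G. \<Sum>B\<in>G. (d A * d B) * (W A \<omega> * W B \<omega>)))"
    by (intro Bochner_Integration.integral_cong refl)
      (simp add: power2_eq_square sum_product mult_ac)
  also have "\<dots> = (\<Sum>A\<in>G. \<Sum>B\<in>G. (d A * d B) * (LINT \<omega>|M. W A \<omega> * W B \<omega>))"
    using square_integrable_times[OF sq sq]
    by (simp add: Bochner_Integration.integral_sum)
  also have "\<dots> = (\<Sum>A\<in>G. \<Sum>B\<in>G. (d A * d B) * measure \<Lambda> (?E A B))"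
    by (intro sum.cong refl arg_cong2[where f = "(*)"] gaussian_noise_covariance[OF W]) (use G in auto)
  also have "\<dots> = (LINT x|\<Lambda>. (\<Sum>A\<in>G. \<Sum>B\<in>G. (d A * d B) * indicat_real (?E A B) x))"
  proof -
    have ii: "integrable \<Lambda> (indicat_real (?E A B))" if "A \<in> G" "B \<in> G" for A B
      using Es[OF that] Ef[OF that] by simp
    have m: "(LINT x|\<Lambda>. indicat_real (?E A B) x) = measure \<Lambda> (?E A B)" if "A \<in> G" "B \<in> G" for A B
      using Es[OF that] by simp
    have "(LINT x|\<Lambda>. (\<Sum>A\<in>G. \<Sum>B\<in>G. (d A * d B) * indicat_real (?E A B) x)) =
      (\<Sum>A\<in>G. \<Sum>B\<in>G. (d A * d B) * (LINT x|\<Lambda>. indicat_real (?E A B) x))"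
      using ii by (simp add: Bochner_Integration.integral_sum)
    then show ?thesis using m by simp
  qed
  also have "\<dots> = noise_form \<Lambda> (\<lambda>p. \<Sum>A\<in>G. d A * indicator A p)"
    unfolding noise_form_def prod ..
  finally show "(LINT \<omega>|M. (\<Sum>A\<in>G. d A * W A \<omega>)\<^sup>2) = noise_form \<Lambda> (\<lambda>p. \<Sum>A\<in>G. d A * indicator A p)" .
qed

text \<open>A test function \<open>g\<close> with a dual bound pairs continuously with the integrands, so the dual bound for simple
  functions passes to Wiener integrals.\<close>

lemma wiener_combination:
  fixes \<Lambda> :: "(real \<times> (real ^ 'n) \<times> (real ^ 'n)) measure" and X :: "'i \<Rightarrow> 'a \<Rightarrow> real"
  assumes M: "prob_space M" and W: "gaussian_noise M \<Lambda> W" and loc: "locally_finite_covariance \<Lambda>"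
    and I: "finite I" and X: "\<And>i. i \<in> I \<Longrightarrow> has_wiener_integral M \<Lambda> W (f i) (X i)"
  shows "square_integrable M (\<lambda>\<omega>. \<Sum>i\<in>I. a i * X i \<omega>)"
    and "(CLINT \<omega>|M. iexp (\<Sum>i\<in>I. a i * X i \<omega>)) = exp (- (LINT \<omega>|M. (\<Sum>i\<in>I. a i * X i \<omega>)\<^sup>2) / 2)"
    and "dual_bound \<Lambda> g \<kappa> \<Longrightarrow> (\<And>A. A \<in> bounded_borel \<Longrightarrow> integrable lborel (\<lambda>p. indicator A p * g p)) \<Longrightarrow>
      (\<And>i. i \<in> I \<Longrightarrow> integrable lborel (\<lambda>p. f i p * g p)) \<Longrightarrow>
      (\<Sum>i\<in>I. a i * (LINT p|lborel. f i p * g p))\<^sup>2 \<le> \<kappa> * (LINT \<omega>|M. (\<Sum>i\<in>I. a i * X i \<omega>)\<^sup>2)"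
proof -
  interpret prob_space M by (rule M)
  define Q where "Q i F c \<longleftrightarrow> (\<forall>k::nat. finite (F k) \<and> F k \<subseteq> bounded_borel) \<and>
        (\<lambda>k. plus_norm_sq \<Lambda> (\<lambda>p. f i p - (\<Sum>A\<in>F k. c k A * indicator A p))) \<longlonglongrightarrow> 0 \<and>
        (\<lambda>k. \<integral>\<^sup>+ \<omega>. ennreal ((X i \<omega> - (\<Sum>A\<in>F k. c k A * W A \<omega>))\<^sup>2) \<partial>M) \<longlonglongrightarrow> 0" for i F c
  have "\<forall>i\<in>I. \<exists>F c. Q i F c" using X unfolding has_wiener_integral_def Q_def by blast
  then obtain F c where "\<And>i. i \<in> I \<Longrightarrow> Q i (F i) (c i)" by metis
  then have Fc: "(\<forall>k::nat. finite (F i k) \<and> F i k \<subseteq> bounded_borel) \<and>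
        (\<lambda>k. plus_norm_sq \<Lambda> (\<lambda>p. f i p - (\<Sum>A\<in>F i k. c i k A * indicator A p))) \<longlonglongrightarrow> 0 \<and>
        (\<lambda>k. \<integral>\<^sup>+ \<omega>. ennreal ((X i \<omega> - (\<Sum>A\<in>F i k. c i k A * W A \<omega>))\<^sup>2) \<partial>M) \<longlonglongrightarrow> 0"
    if "i \<in> I" for i using that unfolding Q_def by blast
  have fm: "\<And>i. i \<in> I \<Longrightarrow> f i \<in> borel_measurable borel" and Xm: "\<And>i. i \<in> I \<Longrightarrow> X i \<in> borel_measurable M"
    using X by (auto simp: has_wiener_integral_def)
  define s where "s i k = (\<lambda>p. \<Sum>A\<in>F i k. c i k A * indicator A p)" for i k
  define S where "S i k = (\<lambda>\<omega>. \<Sum>A\<in>F i k. c i k A * W A \<omega>)" for i k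
  \<comment> \<open>The approximants of the different \<open>f i\<close> at stage \<open>k\<close>
    use different families of sets. Over their union, with coefficients extended by 0, the whole
    combination is one simple function.\<close>
  define G where "G k = (\<Union>i\<in>I. F i k)" for k
  define d where "d k A = (\<Sum>i\<in>I. a i * (if A \<in> F i k then c i k A else 0))" for k A
  have G: "finite (G k)" "G k \<subseteq> bounded_borel" for k using Fc I by (auto simp: G_def)
  have comb: "(\<Sum>i\<in>I. a i * (\<Sum>A\<in>F i k. c i k A * w A)) = (\<Sum>A\<in>G k. d k A * w A)" for k and w :: "_ \<Rightarrow> real"
  proof -
    have "(\<Sum>A\<in>F i k. c i k A * w A) = (\<Sum>A\<in>G k. (if A \<in> F i k then c i k A else 0) * w A)" if "i \<in> I" for i
      using that G(1)[of k] by (intro sum.mono_neutral_cong_left) (auto simp: G_def)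
    then have "(\<Sum>i\<in>I. a i * (\<Sum>A\<in>F i k. c i k A * w A)) = (\<Sum>i\<in>I. \<Sum>A\<in>G k. a i * (if A \<in> F i k then c i k A else 0) * w A)"
      by (simp add: sum_distrib_left mult.assoc)
    also have "\<dots> = (\<Sum>A\<in>G k. d k A * w A)"
      by (subst sum.swap) (simp add: d_def sum_distrib_right)
    finally show ?thesis .
  qed
  have Scomb: "(\<Sum>i\<in>I. a i * S i k \<omega>) = (\<Sum>A\<in>G k. d k A * W A \<omega>)" for k \<omega>
    unfolding S_def by (rule comb)
  have scomb: "(\<Sum>i\<in>I. a i * s i k p) = (\<Sum>A\<in>G k. d k A * indicator A p)" for k p
    unfolding s_def by (rule comb)
  have gS: "centered_gaussian M (\<lambda>\<omega>. \<Sum>A\<in>G k. d k A * W A \<omega>)" for k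
    by (rule gaussian_noise_gaussian[OF W G])
  have Sq: "square_integrable M (S i k)" if "i \<in> I" for i k
    unfolding S_def using Fc[OF that]
    by (intro centered_gaussian_char(1) gaussian_noise_gaussian[OF W]) auto
  have lim1: "l2_limit M (S i) (X i)" if "i \<in> I" for i
    using Fc[OF that] Sq[OF that] Xm[OF that] unfolding S_def by (intro l2_limitI) auto
  have lim: "l2_limit M (\<lambda>k \<omega>. \<Sum>i\<in>I. a i * S i k \<omega>) (\<lambda>\<omega>. \<Sum>i\<in>I. a i * X i \<omega>)"
    using l2_limit_sum[OF I, where S = "\<lambda>i k \<omega>. a i * S i k \<omega>" and X = "\<lambda>i \<omega>. a i * X i \<omega>"] l2_limit_cmult[OF lim1] by simp
  show "square_integrable M (\<lambda>\<omega>. \<Sum>i\<in>I. a i * X i \<omega>)" using lim by (simp add: l2_limit_def)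
  have limsq: "(\<lambda>k. LINT \<omega>|M. (\<Sum>i\<in>I. a i * S i k \<omega>)\<^sup>2) \<longlonglongrightarrow> (LINT \<omega>|M. (\<Sum>i\<in>I. a i * X i \<omega>)\<^sup>2)"
    by (rule l2_limit_integral_sq[OF lim])
  show "(CLINT \<omega>|M. iexp (\<Sum>i\<in>I. a i * X i \<omega>)) = exp (- (LINT \<omega>|M. (\<Sum>i\<in>I. a i * X i \<omega>)\<^sup>2) / 2)"
  proof (rule LIMSEQ_unique)
    show "(\<lambda>k. CLINT \<omega>|M. iexp (\<Sum>i\<in>I. a i * S i k \<omega>)) \<longlonglongrightarrow> (CLINT \<omega>|M. iexp (\<Sum>i\<in>I. a i * X i \<omega>))"
      by (rule l2_limit_char[OF lim])
    have "(CLINT \<omega>|M. iexp (\<Sum>i\<in>I. a i * S i k \<omega>)) = exp (- (LINT \<omega>|M. (\<Sum>i\<in>I. a i * S i k \<omega>)\<^sup>2) / 2)" for k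
      unfolding Scomb by (rule centered_gaussian_char(2)[OF gS])
    moreover have "(\<lambda>k. complex_of_real (exp (- (LINT \<omega>|M. (\<Sum>i\<in>I. a i * S i k \<omega>)\<^sup>2) / 2)))
      \<longlonglongrightarrow> complex_of_real (exp (- (LINT \<omega>|M. (\<Sum>i\<in>I. a i * X i \<omega>)\<^sup>2) / 2))"
      by (intro tendsto_intros limsq) auto
    ultimately show "(\<lambda>k. CLINT \<omega>|M. iexp (\<Sum>i\<in>I. a i * S i k \<omega>)) \<longlonglongrightarrow> complex_of_real (exp (- (LINT \<omega>|M. (\<Sum>i\<in>I. a i * X i \<omega>)\<^sup>2) / 2))"
      by simp
  qed
  assume g: "dual_bound \<Lambda> g \<kappa>" and gA: "\<And>A. A \<in> bounded_borel \<Longrightarrow> integrable lborel (\<lambda>p. indicator A p * g p)"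
    and gf: "\<And>i. i \<in> I \<Longrightarrow> integrable lborel (\<lambda>p. f i p * g p)"
  have k0: "0 \<le> \<kappa>" and bd: "\<And>h. h \<in> borel_measurable borel \<Longrightarrow> plus_norm_sq \<Lambda> h < \<infinity> \<Longrightarrow>
    integrable lborel (\<lambda>p. h p * g p) \<Longrightarrow> (LINT p|lborel. h p * g p)\<^sup>2 \<le> \<kappa> * noise_form \<Lambda> h"
    using g by (auto simp: dual_bound_def)
  have sm: "s i k \<in> borel_measurable borel" if "i \<in> I" for i k
    unfolding s_def using Fc[OF that] by (intro borel_measurable_sum borel_measurable_times borel_measurable_const borel_measurable_indicator) (auto simp: bounded_borel_def)
  have sg: "integrable lborel (\<lambda>p. s i k p * g p)" if "i \<in> I" for i k
  proof -
    have "integrable lborel (\<lambda>p. \<Sum>A\<in>F i k. c i k A * (indicator A p * g p))"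
      using Fc[OF that] by (intro Bochner_Integration.integrable_sum Bochner_Integration.integrable_mult_right gA) auto
    then show ?thesis unfolding s_def by (simp add: sum_distrib_right mult.assoc)
  qed
  \<comment> \<open>The dual bound is applied to the error \<open>f i - s i k\<close>, whose noise
    form is at most its plus norm; so convergence of the integrands forces convergence of the
    pairings.\<close>
  have Lim: "(\<lambda>k. LINT p|lborel. s i k p * g p) \<longlonglongrightarrow> (LINT p|lborel. f i p * g p)" if i: "i \<in> I" for i
  proof -
    let ?N = "\<lambda>k. plus_norm_sq \<Lambda> (\<lambda>p. f i p - s i k p)"
    have N: "?N \<longlonglongrightarrow> 0" using Fc[OF i] unfolding s_def by blast
    have N': "(\<lambda>k. sqrt (\<kappa> * enn2real (?N k))) \<longlonglongrightarrow> sqrt (\<kappa> * 0)"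
      using N by (intro tendsto_intros tendsto_enn2real) auto
    \<comment> \<open>The plus norm of the error need not be finite for small
      \<open>k\<close>.\<close>
    have ev: "eventually (\<lambda>k. ?N k < \<infinity>) sequentially"
      using order_tendstoD(2)[OF N, of \<infinity>] by simp
    have "eventually (\<lambda>k. norm ((LINT p|lborel. s i k p * g p) - (LINT p|lborel. f i p * g p)) \<le> sqrt (\<kappa> * enn2real (?N k))) sequentially"
      using ev
    proof eventually_elim
      case (elim k)
      have ii: "integrable lborel (\<lambda>p. (f i p - s i k p) * g p)"
        using gf[OF i] sg[OF i, of k] by (simp add: left_diff_distrib)
      have "(LINT p|lborel. (f i p - s i k p) * g p)\<^sup>2 \<le> \<kappa> * noise_form \<Lambda> (\<lambda>p. f i p - s i k p)"
        using elim ii fm[OF i] sm[OF i] by (intro bd) auto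
      also have "\<dots> \<le> \<kappa> * enn2real (?N k)"
        using k0 noise_form_le_plus_norm_sq[OF elim] by (intro mult_left_mono)
      finally have "\<bar>LINT p|lborel. (f i p - s i k p) * g p\<bar> \<le> sqrt (\<kappa> * enn2real (?N k))"
        by (intro real_le_rsqrt) simp
      then show ?case using gf[OF i] sg[OF i, of k] by (simp add: left_diff_distrib abs_minus_commute)
    qed
    moreover have "(\<lambda>k. sqrt (\<kappa> * enn2real (?N k))) \<longlonglongrightarrow> 0" using N' by simp
    ultimately have "(\<lambda>k. (LINT p|lborel. s i k p * g p) - (LINT p|lborel. f i p * g p)) \<longlonglongrightarrow> 0"
      by (rule Lim_null_comparison)
    then show ?thesis by (rule LIM_zero_cancel)
  qed
  have step: "(\<Sum>i\<in>I. a i * (LINT p|lborel. s i k p * g p))\<^sup>2 \<le> \<kappa> * (LINT \<omega>|M. (\<Sum>i\<in>I. a i * S i k \<omega>)\<^sup>2)" for k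
  proof -
    let ?h = "\<lambda>p. \<Sum>A\<in>G k. d k A * indicator A p"
    have hg: "?h p * g p = (\<Sum>i\<in>I. a i * (s i k p * g p))" for p
      unfolding scomb[symmetric] by (simp add: sum_distrib_right mult.assoc)
    have ih: "integrable lborel (\<lambda>p. ?h p * g p)"
      unfolding hg using sg by (intro Bochner_Integration.integrable_sum Bochner_Integration.integrable_mult_right)
    have hm: "?h \<in> borel_measurable borel"
      using G(2)[of k] by (intro borel_measurable_sum borel_measurable_times borel_measurable_const borel_measurable_indicator) (auto simp: bounded_borel_def)
    have "(LINT p|lborel. ?h p * g p)\<^sup>2 \<le> \<kappa> * noise_form \<Lambda> ?h"
      by (intro bd hm ih noise_isometry(1)[OF M W loc G])
    also have "noise_form \<Lambda> ?h = (LINT \<omega>|M. (\<Sum>i\<in>I. a i * S i k \<omega>)\<^sup>2)"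
      unfolding Scomb by (rule noise_isometry(2)[OF M W loc G, symmetric])
    also have "(LINT p|lborel. ?h p * g p) = (\<Sum>i\<in>I. a i * (LINT p|lborel. s i k p * g p))"
      unfolding hg using sg by (subst Bochner_Integration.integral_sum) auto
    finally show ?thesis .
  qed
  show "(\<Sum>i\<in>I. a i * (LINT p|lborel. f i p * g p))\<^sup>2 \<le> \<kappa> * (LINT \<omega>|M. (\<Sum>i\<in>I. a i * X i \<omega>)\<^sup>2)"
  proof (rule LIMSEQ_le)
    show "(\<lambda>k. (\<Sum>i\<in>I. a i * (LINT p|lborel. s i k p * g p))\<^sup>2) \<longlonglongrightarrow> (\<Sum>i\<in>I. a i * (LINT p|lborel. f i p * g p))\<^sup>2"
      by (intro tendsto_intros Lim)
    show "(\<lambda>k. \<kappa> * (LINT \<omega>|M. (\<Sum>i\<in>I. a i * S i k \<omega>)\<^sup>2)) \<longlonglongrightarrow> \<kappa> * (LINT \<omega>|M. (\<Sum>i\<in>I. a i * X i \<omega>)\<^sup>2)"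
      by (intro tendsto_intros limsq)
  qed (use step in blast)
qed

section \<open>Duhamel's formula for the heat kernel\<close>

lemma continuous_bounded_support_bounded:
  fixes f :: "'a::euclidean_space \<Rightarrow> real"
  assumes f: "continuous_on UNIV f" and supp: "\<And>x. B < norm x \<Longrightarrow> f x = 0"
  shows "\<exists>K\<ge>0. \<forall>x. \<bar>f x\<bar> \<le> K"
proof -
  have "compact (f ` cball 0 B)" by (intro compact_continuous_image continuous_on_subset[OF f]) auto
  then have "bounded (f ` cball 0 B)" by (rule compact_imp_bounded)
  then obtain K where K: "\<And>x. norm x \<le> B \<Longrightarrow> \<bar>f x\<bar> \<le> K"
    unfolding bounded_iff by (metis image_eqI mem_cball_0 real_norm_def)
  have "\<bar>f x\<bar> \<le> max K 0" for x
    using K[of x] supp[of x] by (cases "norm x \<le> B") auto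
  then show ?thesis by (intro exI[of _ "max K 0"]) auto
qed

lemma continuous_bounded_support_integrable:
  fixes f :: "'a::euclidean_space \<Rightarrow> real"
  assumes f: "continuous_on UNIV f" and supp: "\<And>x. B < norm x \<Longrightarrow> f x = 0"
  shows "integrable lborel f"
proof -
  obtain K where K: "\<And>x. \<bar>f x\<bar> \<le> K"
    using continuous_bounded_support_bounded[OF f supp] by blast
  show ?thesis
  proof (rule Bochner_Integration.integrable_bound)
    show "integrable lborel (\<lambda>x. K * indicator (cball 0 B) x)"
      by (intro Bochner_Integration.integrable_mult_right) (auto intro!: integrable_real_indicator emeasure_bounded_finite)
    show "AE x in lborel. norm (f x) \<le> norm (K * indicator (cball 0 B) x)"
      using order_trans[OF K abs_ge_self] supp by (intro AE_I2) (auto simp: indicator_def not_le)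
    show "f \<in> borel_measurable lborel" using borel_measurable_continuous_onI[OF f] by simp
  qed
qed

text \<open>Difference quotients integrate to 0 by translation invariance and converge dominatedly,
  by the mean value theorem, to the derivative. This serves as integration by parts along
  \<open>e\<close>.\<close>

lemma integral_directional_derivative_eq_0:
  fixes F F' :: "'a::euclidean_space \<Rightarrow> real"
  assumes der: "\<And>x. ((\<lambda>h. F (x + h *\<^sub>R e)) has_real_derivative F' x) (at 0)"
    and cF: "continuous_on UNIV F" and cF': "continuous_on UNIV F'"
    and supp: "\<And>x. B < norm x \<Longrightarrow> F x = 0" and supp': "\<And>x. B < norm x \<Longrightarrow> F' x = 0"
  shows "(LINT x|lborel. F' x) = 0"
proof -
  \<comment> \<open>A derivative at 0 from every base point is a derivative along the whole line, as
    the mean value theorem requires.\<close>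
  have derh: "((\<lambda>h. F (x + h *\<^sub>R e)) has_real_derivative F' (x + h *\<^sub>R e)) (at h)" for x h
    using der[of "x + h *\<^sub>R e"] DERIV_shift[of "\<lambda>h. F (x + h *\<^sub>R e)" "F' (x + h *\<^sub>R e)" 0 h]
    by (simp add: scaleR_left_distrib ac_simps)
  have [measurable]: "F \<in> borel_measurable borel" "F' \<in> borel_measurable borel"
    using cF cF' by (auto intro: borel_measurable_continuous_onI)
  obtain K' where K': "0 \<le> K'" "\<And>x. \<bar>F' x\<bar> \<le> K'"
    using continuous_bounded_support_bounded[OF cF' supp'] by blast
  have iF: "integrable lborel F" by (rule continuous_bounded_support_integrable[OF cF supp])
  have tr: "(LINT x|lborel. F (x + v)) = (LINT x|lborel. F x)" "integrable lborel (\<lambda>x. F (x + v))" for v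
  proof -
    have d: "lborel = distr lborel borel (\<lambda>x. v + x)" using lborel_distr_plus[of v] by (simp add: fun_eq_iff)
    show "(LINT x|lborel. F (x + v)) = (LINT x|lborel. F x)"
      by (subst (2) d) (simp add: integral_distr add.commute)
    show "integrable lborel (\<lambda>x. F (x + v))"
      using iF by (subst (asm) d) (simp add: integrable_distr_eq add.commute)
  qed
  define h where "h n = 1 / (real n + 1)" for n
  have h0: "0 < h n" "h n \<le> 1" for n by (auto simp: h_def)
  define D where "D n x = (F (x + h n *\<^sub>R e) - F x) / h n" for n x
  have mvt: "\<bar>D n x\<bar> \<le> K'" for n x
  proof -
    have "\<exists>z. 0 < z \<and> z < h n \<and> F (x + h n *\<^sub>R e) - F (x + 0 *\<^sub>R e) = (h n - 0) * F' (x + z *\<^sub>R e)"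
      by (rule MVT2[OF h0(1)]) (rule derh)
    then obtain z where "F (x + h n *\<^sub>R e) - F x = h n * F' (x + z *\<^sub>R e)" by auto
    then have "D n x = F' (x + z *\<^sub>R e)" using h0(1)[of n] by (simp add: D_def)
    then show ?thesis using K' by simp
  qed
  have "(\<lambda>n. LINT x|lborel. D n x) \<longlonglongrightarrow> (LINT x|lborel. F' x)"
  proof (rule integral_dominated_convergence)
    \<comment> \<open>The increments \<open>h n\<close> are at most 1, so all difference quotients
      live in the support enlarged by \<open>norm e\<close>.\<close>
    show "integrable lborel (\<lambda>x. K' * indicator (cball 0 (B + norm e)) x)"
      by (intro Bochner_Integration.integrable_mult_right) (auto intro!: integrable_real_indicator emeasure_bounded_finite)
    show "AE x in lborel. (\<lambda>n. D n x) \<longlonglongrightarrow> F' x"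
    proof (intro AE_I2)
      fix x
      have "((\<lambda>k. (F (x + k *\<^sub>R e) - F x) / k) \<longlongrightarrow> F' x) (at 0)"
        using der[of x] by (simp add: has_field_derivative_iff)
      moreover have "filterlim h (at 0) sequentially"
        unfolding filterlim_at
      proof
        show "eventually (\<lambda>n. h n \<in> UNIV \<and> h n \<noteq> 0) sequentially" using h0(1) by (simp add: less_imp_neq[symmetric] order_less_imp_not_eq2)
        show "h \<longlonglongrightarrow> 0" unfolding h_def using LIMSEQ_inverse_real_of_nat by (simp add: inverse_eq_divide add.commute)
      qed
      ultimately show "(\<lambda>n. D n x) \<longlonglongrightarrow> F' x" unfolding D_def by (rule filterlim_compose)
    qed
    show "AE x in lborel. norm (D n x) \<le> K' * indicator (cball 0 (B + norm e)) x" for n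
    proof (intro AE_I2)
      fix x
      show "norm (D n x) \<le> K' * indicator (cball 0 (B + norm e)) x"
      proof (cases "norm x \<le> B + norm e")
        case True
        then show ?thesis using mvt[of n x] by simp
      next
        case False
        have "norm (h n *\<^sub>R e) \<le> norm e" using h0[of n] by (simp add: mult_left_le_one_le)
        moreover have "norm x \<le> norm (x + h n *\<^sub>R e) + norm (h n *\<^sub>R e)"
          using norm_triangle_ineq4[of "x + h n *\<^sub>R e" "h n *\<^sub>R e"] by simp
        ultimately have "B < norm (x + h n *\<^sub>R e)" "B < norm x" using False norm_ge_zero[of e] by linarith+
        then show ?thesis using False by (simp add: D_def supp)
      qed
    qed
  qed (simp_all add: D_def)
  moreover have "(LINT x|lborel. D n x) = 0" for n
    unfolding D_def using tr iF by simp
  ultimately have "(\<lambda>n. 0) \<longlonglongrightarrow> (LINT x|lborel. F' x)" by simp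
  then show ?thesis using LIMSEQ_unique tendsto_const by blast
qed

section \<open>Derivatives, mass and scaling of the heat kernel\<close>

lemma norm_add_axis_sq:
  fixes x :: "real ^ 'n"
  shows "(norm (x + h *\<^sub>R axis k 1))\<^sup>2 = (norm x)\<^sup>2 + 2 * h * x $ k + h\<^sup>2"
proof -
  have "(norm (x + h *\<^sub>R axis k 1))\<^sup>2 = (x + h *\<^sub>R axis k 1) \<bullet> (x + h *\<^sub>R axis k 1)"
    by (rule power2_norm_eq_inner)
  also have "\<dots> = x \<bullet> x + 2 * h * (x \<bullet> axis k 1) + h\<^sup>2 * (axis k 1 \<bullet> (axis k 1 :: real ^ 'n))"
    by (simp add: inner_left_distrib inner_right_distrib inner_commute power2_eq_square)
  also have "\<dots> = (norm x)\<^sup>2 + 2 * h * x $ k + h\<^sup>2"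
    by (simp add: power2_norm_eq_inner inner_axis inner_axis_axis)
  finally show ?thesis .
qed

lemma norm_sq_eq_sum: "(norm (x :: real ^ 'n))\<^sup>2 = (\<Sum>k\<in>UNIV. (x $ k)\<^sup>2)"
  unfolding power2_norm_eq_inner inner_vec_def by (simp add: power2_eq_square)

lemma heat_kernel_nonneg [simp]: "0 \<le> heat_kernel t x"
  by (simp add: heat_kernel_def)

lemma heat_kernel_minus [simp]: "heat_kernel t (- x) = heat_kernel t x"
  by (simp add: heat_kernel_def)

lemma heat_kernel_measurable [measurable]:
  "(\<lambda>(t, x). heat_kernel t x :: real) \<in> borel_measurable (borel :: (real \<times> (real ^ 'n)) measure)"
proof -
  have "(\<lambda>p :: real \<times> (real ^ 'n). if fst p > 0 then 1 / (4 * pi * fst p) powr (real CARD('n) / 2) * exp (- ((norm (snd p))\<^sup>2 / (4 * fst p))) else 0)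
    \<in> borel_measurable (borel \<Otimes>\<^sub>M borel)" by measurable
  then show ?thesis by (simp add: heat_kernel_def case_prod_beta borel_prod cong: if_cong)
qed

lemma heat_kernel_measurable_compose [measurable (raw)]:
  assumes "f \<in> borel_measurable M" "g \<in> M \<rightarrow>\<^sub>M (borel :: (real ^ 'n) measure)"
  shows "(\<lambda>x. heat_kernel (f x) (g x)) \<in> borel_measurable M"
proof -
  have "(\<lambda>x. (f x, g x)) \<in> M \<rightarrow>\<^sub>M borel" using assms by (simp add: borel_prod[symmetric])
  from measurable_compose[OF this heat_kernel_measurable] show ?thesis by simp
qed

lemma continuous_on_heat_kernel:
  "continuous_on ({0<..} \<times> UNIV) (\<lambda>(t, x :: real ^ 'n). heat_kernel t x)"
proof -
  have "continuous_on ({0<..} \<times> UNIV) (\<lambda>p :: real \<times> (real ^ 'n). 1 / (4 * pi * fst p) powr (real CARD('n) / 2) * exp (- ((norm (snd p))\<^sup>2 / (4 * fst p))))"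
    by (intro continuous_intros) auto
  then show ?thesis
    by (rule continuous_on_eq) (auto simp: heat_kernel_def)
qed

lemma heat_kernel_DERIV_axis:
  fixes x :: "real ^ 'n"
  assumes t: "0 < t"
  shows "((\<lambda>h. heat_kernel t (x + h *\<^sub>R axis k 1)) has_real_derivative - (x $ k / (2 * t)) * heat_kernel t x) (at 0)"
proof -
  have "((\<lambda>h. 1 / (4 * pi * t) powr (real CARD('n) / 2) * exp (- (((norm x)\<^sup>2 + 2 * h * x $ k + h\<^sup>2) / (4 * t))))
    has_real_derivative - (x $ k / (2 * t)) * (1 / (4 * pi * t) powr (real CARD('n) / 2) * exp (- ((norm x)\<^sup>2 / (4 * t))))) (at 0)"
    using t by (auto intro!: derivative_eq_intros simp: field_simps)
  then show ?thesis using t by (simp add: heat_kernel_def norm_add_axis_sq)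
qed

lemma heat_kernel_DERIV_time:
  fixes x :: "real ^ 'n"
  assumes t: "0 < t"
  shows "((\<lambda>t. heat_kernel t x) has_real_derivative ((norm x)\<^sup>2 / (4 * t\<^sup>2) - real CARD('n) / (2 * t)) * heat_kernel t x) (at t)"
proof -
  have "((\<lambda>t. (4 * pi * t) powr - (real CARD('n) / 2) * exp (- ((norm x)\<^sup>2 / (4 * t))))
    has_real_derivative ((norm x)\<^sup>2 / (4 * t\<^sup>2) - real CARD('n) / (2 * t)) * ((4 * pi * t) powr - (real CARD('n) / 2) * exp (- ((norm x)\<^sup>2 / (4 * t))))) (at t)"
  proof -
    define c where "c = real CARD('n) / 2"
    have p: "((\<lambda>t. (4 * pi * t) powr - c) has_real_derivative (- c / t) * (4 * pi * t) powr - c) (at t)"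
    proof -
      have "((\<lambda>t. (4 * pi * t) powr - c) has_real_derivative (- c * (4 * pi * t) powr (- c - 1)) * (4 * pi)) (at t)"
        using t by (intro DERIV_chain2[where f = "\<lambda>z. z powr - c"] has_real_derivative_powr) (auto intro!: derivative_eq_intros)
      moreover have "(- c * (4 * pi * t) powr (- c - 1)) * (4 * pi) = (- c / t) * (4 * pi * t) powr - c"
        using t by (simp add: powr_diff)
      ultimately show ?thesis by simp
    qed
    have e: "((\<lambda>t. exp (- ((norm x)\<^sup>2 / (4 * t)))) has_real_derivative (norm x)\<^sup>2 / (4 * t\<^sup>2) * exp (- ((norm x)\<^sup>2 / (4 * t)))) (at t)"
      using t by (auto intro!: derivative_eq_intros simp: power2_eq_square)
    show ?thesis
      unfolding c_def[symmetric]
      by (rule DERIV_cong[OF DERIV_mult[OF p e]]) (use t in \<open>simp add: c_def field_simps\<close>)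
  qed
  then have "((\<lambda>t. (4 * pi * t) powr - (real CARD('n) / 2) * exp (- ((norm x)\<^sup>2 / (4 * t))))
    has_real_derivative ((norm x)\<^sup>2 / (4 * t\<^sup>2) - real CARD('n) / (2 * t)) * heat_kernel t x) (at t)"
    using t by (simp add: heat_kernel_def powr_minus_divide)
  then show ?thesis
  proof (rule has_field_derivative_transform_within_open[where S = "{0<..}"])
    show "\<And>t. t \<in> {0<..} \<Longrightarrow> (4 * pi * t) powr - (real CARD('n) / 2) * exp (- ((norm x)\<^sup>2 / (4 * t))) = heat_kernel t x"
      by (simp add: heat_kernel_def powr_minus_divide)
  qed (use t in auto)
qed

text \<open>Only the positivity of the total mass matters; its value, 1, is not needed.\<close>

definition heat_mass :: "'n::finite itself \<Rightarrow> real" where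
  "heat_mass _ = (LINT x|lborel. heat_kernel 1 (x :: real ^ 'n))"

lemma heat_kernel_integrable_1: "integrable lborel (\<lambda>x :: real ^ 'n. heat_kernel 1 x)"
proof -
  have g: "(\<integral>\<^sup>+u. ennreal (exp (- (u\<^sup>2 / 4))) \<partial>lborel) < \<infinity>"
  proof -
    have eq: "exp (- (u\<^sup>2 / 4)) = sqrt (4 * pi) * normal_density 0 (sqrt 2) u" for u :: real
      by (simp add: normal_density_def)
    have "integrable lborel (\<lambda>u :: real. exp (- (u\<^sup>2 / 4)))" unfolding eq by simp
    then show ?thesis by (subst nn_integral_eq_integral) auto
  qed
  have e: "ennreal (exp (- ((norm x)\<^sup>2 / 4))) = (\<Prod>b\<in>Basis. ennreal (exp (- ((x \<bullet> b)\<^sup>2 / 4))))" for x :: "real ^ 'n"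
  proof -
    have "(norm x)\<^sup>2 = (\<Sum>b\<in>Basis. (x \<bullet> b)\<^sup>2)"
      unfolding power2_norm_eq_inner euclidean_inner[of x x] by (simp add: power2_eq_square)
    then have "exp (- ((norm x)\<^sup>2 / 4)) = (\<Prod>b\<in>Basis. exp (- ((x \<bullet> b)\<^sup>2 / 4)))"
      by (simp add: exp_sum[symmetric] sum_negf sum_divide_distrib)
    then show ?thesis by (simp add: prod_ennreal)
  qed
  have "integrable lborel (\<lambda>x :: real ^ 'n. exp (- ((norm x)\<^sup>2 / 4)))"
  proof (rule integrableI_nonneg)
    have "(\<integral>\<^sup>+x. ennreal (exp (- ((norm (x :: real ^ 'n))\<^sup>2 / 4))) \<partial>lborel) =
      (\<Prod>b\<in>(Basis :: (real ^ 'n) set). \<integral>\<^sup>+u. ennreal (exp (- (u\<^sup>2 / 4))) \<partial>lborel)"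
      unfolding e by (rule nn_integral_lborel_prod) auto
    also have "\<dots> < \<infinity>" using g by (simp add: power_less_top_ennreal)
    finally show "(\<integral>\<^sup>+x. ennreal (exp (- ((norm (x :: real ^ 'n))\<^sup>2 / 4))) \<partial>lborel) < \<infinity>" .
  qed auto
  then show ?thesis by (simp add: heat_kernel_def)
qed

lemma heat_mass_pos: "0 < heat_mass TYPE('n::finite)"
proof -
  have "heat_mass TYPE('n) \<noteq> 0"
  proof
    assume "heat_mass TYPE('n) = 0"
    then have "AE x in lborel. heat_kernel 1 (x :: real ^ 'n) = 0"
      unfolding heat_mass_def by (simp add: integral_nonneg_eq_0_iff_AE heat_kernel_integrable_1)
    then have "AE x :: real ^ 'n in lborel. False" by eventually_elim (simp add: heat_kernel_def)
    then show False by (simp add: trivial_limit_def[symmetric] eventually_False ae_filter_eq_bot_iff)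
  qed
  moreover have "0 \<le> heat_mass TYPE('n)" unfolding heat_mass_def by (rule Bochner_Integration.integral_nonneg) simp
  ultimately show ?thesis by simp
qed

text \<open>Parabolic scaling. The Jacobian is written with an absolute value, the shape in which
  the affine substitution for Lebesgue measure delivers it.\<close>

lemma heat_kernel_scale:
  fixes z :: "real ^ 'n"
  assumes "0 < \<sigma>"
  shows "\<bar>sqrt \<sigma>\<bar> ^ CARD('n) * heat_kernel \<sigma> (sqrt \<sigma> *\<^sub>R z) = heat_kernel 1 z"
proof -
  have "sqrt \<sigma> ^ CARD('n) = \<sigma> powr (real CARD('n) / 2)"
    using assms by (simp add: powr_half_sqrt[symmetric] powr_powr flip: powr_realpow)
  then show ?thesis
    using assms by (simp add: heat_kernel_def powr_mult power_mult_distrib)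
qed

lemma lborel_heat_affine:
  fixes x :: "real ^ 'n"
  assumes "0 < \<sigma>"
  shows "lborel = density (distr lborel borel (\<lambda>z. x + (- sqrt \<sigma>) *\<^sub>R z)) (\<lambda>_. ennreal (\<bar>sqrt \<sigma>\<bar> ^ CARD('n)))"
  using lborel_affine[of "- sqrt \<sigma>" x] assms by simp

text \<open>The substitution y = x - sqrt(\<sigma>) z moves \<sigma> from the singular kernel into
  the argument of \<open>f\<close>, so that the right side remains meaningful at \<sigma> =
  0.\<close>

lemma heat_kernel_integral_affine:
  fixes f :: "real ^ 'n \<Rightarrow> real"
  assumes s: "0 < \<sigma>" and [measurable]: "f \<in> borel_measurable borel"
  shows "(LINT y|lborel. heat_kernel \<sigma> (x - y) * f y) = (LINT z|lborel. heat_kernel 1 z * f (x - sqrt \<sigma> *\<^sub>R z))"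
proof -
  let ?T = "\<lambda>z. x + (- sqrt \<sigma>) *\<^sub>R z"
  note l = lborel_heat_affine[OF s, of x]
  have "(LINT y|lborel. heat_kernel \<sigma> (x - y) * f y) =
    (LINT z|lborel. \<bar>sqrt \<sigma>\<bar> ^ CARD('n) * (heat_kernel \<sigma> (x - ?T z) * f (?T z)))"
    by (subst l) (simp add: integral_density integral_distr)
  also have "\<dots> = (LINT z|lborel. heat_kernel 1 z * f (x - sqrt \<sigma> *\<^sub>R z))"
    using heat_kernel_scale[OF s, where 'n = 'n] by (intro Bochner_Integration.integral_cong refl) (simp flip: mult.assoc)
  finally show ?thesis .
qed

lemma heat_kernel_nn_integral:
  fixes x :: "real ^ 'n"
  assumes s: "0 < \<sigma>"
  shows "(\<integral>\<^sup>+y. ennreal (heat_kernel \<sigma> (x - y)) \<partial>lborel) = ennreal (heat_mass TYPE('n))"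
proof -
  let ?T = "\<lambda>z. x + (- sqrt \<sigma>) *\<^sub>R z"
  note l = lborel_heat_affine[OF s, of x]
  have "(\<integral>\<^sup>+y. ennreal (heat_kernel \<sigma> (x - y)) \<partial>lborel) =
    (\<integral>\<^sup>+z. ennreal (\<bar>sqrt \<sigma>\<bar> ^ CARD('n)) * ennreal (heat_kernel \<sigma> (x - ?T z)) \<partial>lborel)"
    by (subst l) (simp add: nn_integral_density nn_integral_distr)
  also have "\<dots> = (\<integral>\<^sup>+z. ennreal (heat_kernel 1 (z :: real ^ 'n)) \<partial>lborel)"
    using heat_kernel_scale[OF s, where 'n = 'n] by (intro nn_integral_cong) (simp add: ennreal_mult[symmetric])
  also have "\<dots> = ennreal (heat_mass TYPE('n))"
    unfolding heat_mass_def by (rule nn_integral_eq_integral[OF heat_kernel_integrable_1]) simp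
  finally show ?thesis .
qed

section \<open>The heat flow of a smooth compactly supported function\<close>

lemma heat_kernel_slice_continuous:
  fixes x :: "real ^ 'n"
  assumes "0 < \<sigma>"
  shows "continuous_on UNIV (\<lambda>y. heat_kernel \<sigma> (x - y))"
  using assms unfolding heat_kernel_def by (auto intro!: continuous_intros)

text \<open>Continuity up to \<sigma> = 0, where the value is the mass times the function at
  \<open>x\<close>, supplies the boundary term in Duhamel's formula.\<close>

lemma continuous_heat_flow:
  fixes \<gamma> :: "real ^ 'n \<Rightarrow> real"
  assumes c: "continuous_on UNIV \<gamma>" and b: "\<And>y. \<bar>\<gamma> y\<bar> \<le> K"
  shows "continuous_on {0..} (\<lambda>\<sigma>. LINT z|lborel. heat_kernel 1 z * \<gamma> (x - sqrt \<sigma> *\<^sub>R z))"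
  unfolding continuous_on_sequentially comp_def
proof (intro allI ballI impI, elim conjE)
  fix s :: "nat \<Rightarrow> real" and \<sigma> assume s: "s \<longlonglongrightarrow> \<sigma>"
  have [measurable]: "\<gamma> \<in> borel_measurable borel" using c by (rule borel_measurable_continuous_onI)
  show "(\<lambda>n. LINT z|lborel. heat_kernel 1 z * \<gamma> (x - sqrt (s n) *\<^sub>R z)) \<longlonglongrightarrow> (LINT z|lborel. heat_kernel 1 z * \<gamma> (x - sqrt \<sigma> *\<^sub>R z))"
  proof (rule integral_dominated_convergence)
    show "integrable lborel (\<lambda>z :: real ^ 'n. heat_kernel 1 z * K)" by (intro Bochner_Integration.integrable_mult_left heat_kernel_integrable_1)
    show "AE z in lborel. (\<lambda>n. heat_kernel 1 z * \<gamma> (x - sqrt (s n) *\<^sub>R z)) \<longlonglongrightarrow> heat_kernel 1 z * \<gamma> (x - sqrt \<sigma> *\<^sub>R z)"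
    proof (intro AE_I2 tendsto_mult tendsto_const)
      fix z
      have "isCont \<gamma> (x - sqrt \<sigma> *\<^sub>R z)" using c by (simp add: continuous_on_eq_continuous_at)
      moreover have "(\<lambda>n. x - sqrt (s n) *\<^sub>R z) \<longlonglongrightarrow> x - sqrt \<sigma> *\<^sub>R z" by (intro tendsto_intros s)
      ultimately show "(\<lambda>n. \<gamma> (x - sqrt (s n) *\<^sub>R z)) \<longlonglongrightarrow> \<gamma> (x - sqrt \<sigma> *\<^sub>R z)"
        by (rule isCont_tendsto_compose)
    qed
    show "AE z in lborel. norm (heat_kernel 1 z * \<gamma> (x - sqrt (s n) *\<^sub>R z)) \<le> heat_kernel 1 z * K" for n
      using b by (intro AE_I2) (simp add: abs_mult mult_left_mono)
  qed simp_all
qed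

text \<open>The pure first and second derivatives along the axes are carried as explicit functions;
  the Laplacian is the sum of the second ones. One radius bounds all supports.\<close>

definition smooth_bump :: "(real ^ 'n \<Rightarrow> real) \<Rightarrow> ('n \<Rightarrow> real ^ 'n \<Rightarrow> real) \<Rightarrow> ('n \<Rightarrow> real ^ 'n \<Rightarrow> real) \<Rightarrow> bool" where
  "smooth_bump \<gamma> \<gamma>1 \<gamma>2 \<longleftrightarrow> continuous_on UNIV \<gamma> \<and> (\<forall>k. continuous_on UNIV (\<gamma>1 k)) \<and> (\<forall>k. continuous_on UNIV (\<gamma>2 k)) \<and>
     (\<forall>k x. ((\<lambda>h. \<gamma> (x + h *\<^sub>R axis k 1)) has_real_derivative \<gamma>1 k x) (at 0)) \<and>
     (\<forall>k x. ((\<lambda>h. \<gamma>1 k (x + h *\<^sub>R axis k 1)) has_real_derivative \<gamma>2 k x) (at 0)) \<and>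
     (\<exists>B. \<forall>x. B < norm x \<longrightarrow> \<gamma> x = 0 \<and> (\<forall>k. \<gamma>1 k x = 0 \<and> \<gamma>2 k x = 0))"

text \<open>The first factor on the left is the logarithmic time derivative of the kernel. The
  kernel solves the heat equation, so the left side pairs its Laplacian with the bump, and Green's
  identity moves the Laplacian across.\<close>

lemma heat_flow_green:
  fixes \<gamma> :: "real ^ 'n \<Rightarrow> real"
  assumes g: "smooth_bump \<gamma> \<gamma>1 \<gamma>2" and s: "0 < \<sigma>"
  shows "(LINT y|lborel. ((norm (x - y))\<^sup>2 / (4 * \<sigma>\<^sup>2) - real CARD('n) / (2 * \<sigma>)) * heat_kernel \<sigma> (x - y) * \<gamma> y) =
    (LINT y|lborel. heat_kernel \<sigma> (x - y) * (\<Sum>k\<in>UNIV. \<gamma>2 k y))"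
proof -
  obtain B where B: "\<And>x. B < norm x \<Longrightarrow> \<gamma> x = 0" "\<And>x k. B < norm x \<Longrightarrow> \<gamma>1 k x = 0" "\<And>x k. B < norm x \<Longrightarrow> \<gamma>2 k x = 0"
    using g unfolding smooth_bump_def by blast
  have cont: "continuous_on UNIV \<gamma>" "continuous_on UNIV (\<gamma>1 k)" "continuous_on UNIV (\<gamma>2 k)" for k
    using g unfolding smooth_bump_def by blast+
  have d1: "((\<lambda>h. \<gamma> (x + h *\<^sub>R axis k 1)) has_real_derivative \<gamma>1 k x) (at 0)"
    and d2: "((\<lambda>h. \<gamma>1 k (x + h *\<^sub>R axis k 1)) has_real_derivative \<gamma>2 k x) (at 0)" for k x
    using g unfolding smooth_bump_def by blast+
  define H where "H y = heat_kernel \<sigma> (x - y)" for y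
  define a where "a k y = (x - y) $ k / (2 * \<sigma>)" for k y
  have cH: "continuous_on UNIV H" unfolding H_def by (rule heat_kernel_slice_continuous[OF s])
  have ca: "continuous_on UNIV (a k)" for k unfolding a_def by (intro continuous_intros) (use s in auto)
  have dH: "((\<lambda>h. H (y + h *\<^sub>R axis k 1)) has_real_derivative a k y * H y) (at 0)" for y k
  proof -
    have "((\<lambda>h. heat_kernel \<sigma> ((y - x) + h *\<^sub>R axis k 1)) has_real_derivative - ((y - x) $ k / (2 * \<sigma>)) * heat_kernel \<sigma> (y - x)) (at 0)"
      by (rule heat_kernel_DERIV_axis[OF s])
    moreover have "heat_kernel \<sigma> ((y - x) + h *\<^sub>R axis k 1) = H (y + h *\<^sub>R axis k 1)" for h
      unfolding H_def using heat_kernel_minus[of \<sigma> "x - (y + h *\<^sub>R axis k 1)"] by (simp add: algebra_simps)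
    moreover have "heat_kernel \<sigma> (y - x) = H y"
      unfolding H_def using heat_kernel_minus[of \<sigma> "x - y"] by simp
    moreover have "- ((y - x) $ k / (2 * \<sigma>)) = a k y" using s by (simp add: a_def field_simps)
    ultimately show ?thesis by (simp only:)
  qed
  have da: "((\<lambda>h. a k (y + h *\<^sub>R axis k 1)) has_real_derivative - 1 / (2 * \<sigma>)) (at 0)" for y k
    unfolding a_def using s by (auto intro!: derivative_eq_intros simp: axis_def field_simps)
  \<comment> \<open>The second derivative of \<open>H\<close> along axis \<open>k\<close>: since
    \<open>a k\<close> is the logarithmic derivative, it is ((a k)^2 + (a k)') H with (a k)' = -1/(2
    \<sigma>).\<close>
  define H2 where "H2 k y = ((a k y)\<^sup>2 - 1 / (2 * \<sigma>)) * H y" for k y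
  have key: "(LINT y|lborel. H y * \<gamma>2 k y) = (LINT y|lborel. H2 k y * \<gamma> y)" for k
  proof -
    have "(LINT y|lborel. H y * \<gamma>2 k y - H2 k y * \<gamma> y) = 0"
    \<comment> \<open>The antisymmetric Green expression: the products of two first derivatives
      cancel when it is differentiated.\<close>
    proof (rule integral_directional_derivative_eq_0[where F = "\<lambda>y. H y * \<gamma>1 k y - (a k y * H y) * \<gamma> y" and e = "axis k 1" and B = B])
      fix y
      show "((\<lambda>h. H (y + h *\<^sub>R axis k 1) * \<gamma>1 k (y + h *\<^sub>R axis k 1) - (a k (y + h *\<^sub>R axis k 1) * H (y + h *\<^sub>R axis k 1)) * \<gamma> (y + h *\<^sub>R axis k 1))
        has_real_derivative H y * \<gamma>2 k y - H2 k y * \<gamma> y) (at 0)"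
        by (rule DERIV_cong[OF DERIV_diff[OF DERIV_mult[OF dH d2] DERIV_mult[OF DERIV_mult[OF da dH] d1]]])
          (simp add: H2_def algebra_simps power2_eq_square)
    qed (auto intro!: continuous_intros cont cH ca simp: H2_def[abs_def] B)
    moreover have "integrable lborel (\<lambda>y. H y * \<gamma>2 k y)"
      by (rule continuous_bounded_support_integrable[where B = B]) (auto intro!: continuous_intros cont cH simp: B)
    moreover have "integrable lborel (\<lambda>y. H2 k y * \<gamma> y)"
      by (rule continuous_bounded_support_integrable[where B = B]) (auto intro!: continuous_intros cont cH ca simp: H2_def B)
    ultimately show ?thesis by simp
  qed
  have "(LINT y|lborel. H y * (\<Sum>k\<in>UNIV. \<gamma>2 k y)) = (\<Sum>k\<in>UNIV. LINT y|lborel. H y * \<gamma>2 k y)"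
    unfolding sum_distrib_left
    by (intro Bochner_Integration.integral_sum continuous_bounded_support_integrable[where B = B])
      (auto intro!: continuous_intros cont cH simp: B)
  also have "\<dots> = (LINT y|lborel. (\<Sum>k\<in>UNIV. H2 k y * \<gamma> y))"
    unfolding key
    by (intro Bochner_Integration.integral_sum[symmetric] continuous_bounded_support_integrable[where B = B])
      (auto intro!: continuous_intros cont cH ca simp: H2_def B)
  also have "\<dots> = (LINT y|lborel. ((norm (x - y))\<^sup>2 / (4 * \<sigma>\<^sup>2) - real CARD('n) / (2 * \<sigma>)) * H y * \<gamma> y)"
  proof (intro Bochner_Integration.integral_cong refl)
    fix y
    have "(\<Sum>k\<in>UNIV. (a k y)\<^sup>2 - 1 / (2 * \<sigma>)) = (norm (x - y))\<^sup>2 / (4 * \<sigma>\<^sup>2) - real CARD('n) / (2 * \<sigma>)"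
      by (simp add: a_def norm_sq_eq_sum sum_subtractf power_divide power_mult_distrib sum_divide_distrib)
    then show "(\<Sum>k\<in>UNIV. H2 k y * \<gamma> y) = ((norm (x - y))\<^sup>2 / (4 * \<sigma>\<^sup>2) - real CARD('n) / (2 * \<sigma>)) * H y * \<gamma> y"
      by (simp add: H2_def flip: sum_distrib_right)
  qed
  finally show ?thesis by (simp add: H_def)
qed

text \<open>Differentiation under the integral puts the time derivative on the kernel;
  \<open>heat_flow_green\<close> then trades it for the Laplacian of the bump.\<close>

lemma heat_flow_DERIV:
  fixes \<gamma> :: "real ^ 'n \<Rightarrow> real"
  assumes g: "smooth_bump \<gamma> \<gamma>1 \<gamma>2" and s: "0 < \<sigma>"
  shows "((\<lambda>\<sigma>. LINT y|lborel. heat_kernel \<sigma> (x - y) * \<gamma> y) has_real_derivative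
    (LINT y|lborel. heat_kernel \<sigma> (x - y) * (\<Sum>k\<in>UNIV. \<gamma>2 k y))) (at \<sigma>)"
proof -
  obtain B where B: "\<And>x. B < norm x \<Longrightarrow> \<gamma> x = 0"
    using g unfolding smooth_bump_def by blast
  have cont: "continuous_on UNIV \<gamma>" using g unfolding smooth_bump_def by blast
  obtain a b where ab: "cball 0 B \<subseteq> cbox a (b :: real ^ 'n)"
    using bounded_subset_cbox_symmetric[OF bounded_cball] by metis
  \<comment> \<open>The Leibniz rule is applied to gauge integrals over a box, so the integrals are
    first confined to a box containing the support.\<close>
  have to_HK: "(LINT y|lborel. f y * \<gamma> y) = integral (cbox a b) (\<lambda>y. f y * \<gamma> y)"
    if f: "continuous_on UNIV f" for f
  proof -
    have i: "integrable lborel (\<lambda>y. f y * \<gamma> y)"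
      by (rule continuous_bounded_support_integrable[where B = B]) (auto intro!: continuous_intros f cont simp: B)
    have "(LINT y|lborel. f y * \<gamma> y) = integral UNIV (\<lambda>y. f y * \<gamma> y)"
      using has_integral_integral_lborel[OF i] by (simp add: integral_unique)
    also have "\<dots> = integral UNIV (\<lambda>y. if y \<in> cbox a b then f y * \<gamma> y else 0)"
    proof (rule arg_cong[where f = "integral UNIV"], rule ext)
      fix y
      show "f y * \<gamma> y = (if y \<in> cbox a b then f y * \<gamma> y else 0)"
        using ab B[of y] by (cases "norm y \<le> B") (auto simp: not_le subset_iff)
    qed
    also have "\<dots> = integral (cbox a b) (\<lambda>y. f y * \<gamma> y)"
      by (rule integral_restrict_UNIV)
    finally show ?thesis .
  qed
  let ?f = "\<lambda>\<sigma> y. heat_kernel \<sigma> (x - y) * \<gamma> y"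
  let ?d = "\<lambda>\<sigma> y. ((norm (x - y))\<^sup>2 / (4 * \<sigma>\<^sup>2) - real CARD('n) / (2 * \<sigma>)) * heat_kernel \<sigma> (x - y)"
  have "((\<lambda>\<sigma>. integral (cbox a b) (?f \<sigma>)) has_real_derivative integral (cbox a b) (\<lambda>y. ?d \<sigma> y * \<gamma> y)) (at \<sigma> within {0<..})"
  proof (rule leibniz_rule_field_derivative)
    fix \<tau> :: real and y assume "\<tau> \<in> {0<..}" "y \<in> cbox a b"
    then show "((\<lambda>\<sigma>. ?f \<sigma> y) has_real_derivative ?d \<tau> y * \<gamma> y) (at \<tau> within {0<..})"
      by (intro DERIV_cmult_right has_field_derivative_at_within[OF heat_kernel_DERIV_time]) simp
  next
    fix \<tau> :: real assume "\<tau> \<in> {0<..}"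
    then show "?f \<tau> integrable_on cbox a b"
      by (intro integrable_continuous continuous_intros continuous_on_subset[OF heat_kernel_slice_continuous] continuous_on_subset[OF cont]) auto
  next
    have "continuous_on ({0<..} \<times> cbox a b) (\<lambda>p. heat_kernel (fst p) (x - snd p))"
    proof -
      have "continuous_on ({0<..} \<times> cbox a b) (\<lambda>p. (fst p, x - snd p))" by (intro continuous_intros)
      moreover have "(\<lambda>p. (fst p, x - snd p)) ` ({0<..} \<times> cbox a b) \<subseteq> {0<..} \<times> UNIV" by auto
      ultimately show ?thesis
        using continuous_on_compose2[OF continuous_on_heat_kernel, of "{0<..} \<times> cbox a b" "\<lambda>p. (fst p, x - snd p)"] by simp
    qed
    moreover have "continuous_on ({0<..} \<times> cbox a b) (\<lambda>p. \<gamma> (snd p))"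
      by (rule continuous_on_compose2[OF cont]) (auto intro!: continuous_intros)
    ultimately have "continuous_on ({0<..} \<times> cbox a b) (\<lambda>p. ?d (fst p) (snd p) * \<gamma> (snd p))"
      by (intro continuous_intros) auto
    then show "continuous_on ({0<..} \<times> cbox a b) (\<lambda>(\<tau>, y). ?d \<tau> y * \<gamma> y)"
      by (simp add: case_prod_beta)
  qed (use s in auto)
  then have D: "((\<lambda>\<sigma>. integral (cbox a b) (?f \<sigma>)) has_real_derivative integral (cbox a b) (\<lambda>y. ?d \<sigma> y * \<gamma> y)) (at \<sigma>)"
    using s by (simp add: at_within_open[OF _ open_greaterThan])
  have cd: "continuous_on UNIV (?d \<sigma>)"
    using s by (intro continuous_intros heat_kernel_slice_continuous) auto
  have "((\<lambda>\<sigma>. LINT y|lborel. ?f \<sigma> y) has_real_derivative integral (cbox a b) (\<lambda>y. ?d \<sigma> y * \<gamma> y)) (at \<sigma>)"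
    by (rule has_field_derivative_transform_within_open[OF D, where S = "{0<..}"])
      (use s in \<open>auto simp: to_HK[OF heat_kernel_slice_continuous]\<close>)
  also have "integral (cbox a b) (\<lambda>y. ?d \<sigma> y * \<gamma> y) = (LINT y|lborel. ?d \<sigma> y * \<gamma> y)"
    by (rule to_HK[OF cd, symmetric])
  also have "\<dots> = (LINT y|lborel. heat_kernel \<sigma> (x - y) * (\<Sum>k\<in>UNIV. \<gamma>2 k y))"
    by (rule heat_flow_green[OF g s])
  finally show ?thesis .
qed

text \<open>One differentiates \<open>\<alpha>(s)\<close> times the heat flow of \<open>\<gamma>\<close> at time \<open>t - s\<close> in \<open>s\<close>; the boundary term at \<open>s = t\<close> is
  \<open>\<alpha>(t) \<gamma>(x)\<close> times the mass of the kernel.\<close>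

lemma duhamel_has_integral:
  fixes \<gamma> :: "real ^ 'n \<Rightarrow> real"
  assumes g: "smooth_bump \<gamma> \<gamma>1 \<gamma>2"
    and \<alpha>: "\<And>s. (\<alpha> has_real_derivative \<alpha>' s) (at s)" and \<alpha>0: "\<alpha> 0 = 0" and t: "0 \<le> t"
  shows "((\<lambda>s. LINT y|lborel. heat_kernel (t - s) (x - y) * (\<alpha>' s * \<gamma> y - \<alpha> s * (\<Sum>k\<in>UNIV. \<gamma>2 k y)))
    has_integral heat_mass TYPE('n) * \<alpha> t * \<gamma> x) {0..t}"
proof -
  obtain B where B: "\<And>x. B < norm x \<Longrightarrow> \<gamma> x = 0" "\<And>x k. B < norm x \<Longrightarrow> \<gamma>2 k x = 0"
    using g unfolding smooth_bump_def by blast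
  have cont: "continuous_on UNIV \<gamma>" "continuous_on UNIV (\<gamma>2 k)" for k
    using g unfolding smooth_bump_def by blast+
  obtain K where K: "\<And>y. \<bar>\<gamma> y\<bar> \<le> K" using continuous_bounded_support_bounded[OF cont(1) B(1)] by blast
  have [measurable]: "\<gamma> \<in> borel_measurable borel" using cont by (intro borel_measurable_continuous_onI)
  define V where "V \<sigma> = (LINT z|lborel. heat_kernel 1 z * \<gamma> (x - sqrt \<sigma> *\<^sub>R z))" for \<sigma>
  define L where "L \<sigma> = (LINT y|lborel. heat_kernel \<sigma> (x - y) * (\<Sum>k\<in>UNIV. \<gamma>2 k y))" for \<sigma>
  have Veq: "V \<sigma> = (LINT y|lborel. heat_kernel \<sigma> (x - y) * \<gamma> y)" if "0 < \<sigma>" for \<sigma>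
    unfolding V_def using that by (simp add: heat_kernel_integral_affine)
  have V0: "V 0 = heat_mass TYPE('n) * \<gamma> x" by (simp add: V_def heat_mass_def)
  have cV: "continuous_on {0..} V" unfolding V_def by (rule continuous_heat_flow[OF cont(1) K])
  have dV: "(V has_real_derivative L \<sigma>) (at \<sigma>)" if "0 < \<sigma>" for \<sigma>
    unfolding L_def
    by (rule has_field_derivative_transform_within_open[OF heat_flow_DERIV[OF g that, of x], where S = "{0<..}"])
      (use that Veq in auto)
  have c\<alpha>: "continuous_on S \<alpha>" for S
    using \<alpha> by (meson DERIV_isCont continuous_at_imp_continuous_on)
  have "((\<lambda>s. \<alpha>' s * V (t - s) - \<alpha> s * L (t - s)) has_integral \<alpha> t * V (t - t) - \<alpha> 0 * V (t - 0)) {0..t}"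
  \<comment> \<open>\<open>V\<close> is differentiable only at positive times, so at s = t nothing
    but continuity is available; the interior form of the theorem asks for no more.\<close>
  proof (rule fundamental_theorem_of_calculus_interior[OF t, where f = "\<lambda>s. \<alpha> s * V (t - s)"])
    show "continuous_on {0..t} (\<lambda>s. \<alpha> s * V (t - s))"
      by (intro continuous_intros c\<alpha> continuous_on_compose2[OF cV]) auto
    fix s assume s: "s \<in> {0<..<t}"
    have "((\<lambda>s. V (t - s)) has_real_derivative L (t - s) * (- 1)) (at s)"
      by (rule DERIV_chain2[OF dV]) (use s in \<open>auto intro!: derivative_eq_intros\<close>)
    from DERIV_mult[OF \<alpha> this]
    have "((\<lambda>s. \<alpha> s * V (t - s)) has_real_derivative \<alpha>' s * V (t - s) - \<alpha> s * L (t - s)) (at s)"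
      by (rule DERIV_cong) simp
    then show "((\<lambda>s. \<alpha> s * V (t - s)) has_vector_derivative \<alpha>' s * V (t - s) - \<alpha> s * L (t - s)) (at s)"
      by (simp add: has_real_derivative_iff_has_vector_derivative)
  qed
  then have main: "((\<lambda>s. \<alpha>' s * V (t - s) - \<alpha> s * L (t - s)) has_integral heat_mass TYPE('n) * \<alpha> t * \<gamma> x) {0..t}"
    using \<alpha>0 V0 by (simp add: ac_simps)
  show ?thesis
  \<comment> \<open>At s = t the kernel is 0 by definition instead of a point mass, so this single
    point is discarded.\<close>
  proof (rule has_integral_spike[OF _ _ main])
    show "negligible {t}" by simp
    fix s assume s: "s \<in> {0..t} - {t}"
    then have ts: "0 < t - s" by auto
    have ch: "continuous_on UNIV (\<lambda>y. heat_kernel (t - s) (x - y))" by (rule heat_kernel_slice_continuous[OF ts])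
    have i1: "integrable lborel (\<lambda>y. heat_kernel (t - s) (x - y) * \<gamma> y)"
      by (rule continuous_bounded_support_integrable[where B = B]) (auto intro!: continuous_intros ch cont simp: B)
    have i2: "integrable lborel (\<lambda>y. heat_kernel (t - s) (x - y) * (\<Sum>k\<in>UNIV. \<gamma>2 k y))"
      by (rule continuous_bounded_support_integrable[where B = B]) (auto intro!: continuous_intros ch cont simp: B)
    have "(LINT y|lborel. heat_kernel (t - s) (x - y) * (\<alpha>' s * \<gamma> y - \<alpha> s * (\<Sum>k\<in>UNIV. \<gamma>2 k y))) =
      (LINT y|lborel. \<alpha>' s * (heat_kernel (t - s) (x - y) * \<gamma> y) - \<alpha> s * (heat_kernel (t - s) (x - y) * (\<Sum>k\<in>UNIV. \<gamma>2 k y)))"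
      by (intro Bochner_Integration.integral_cong refl) (simp add: right_diff_distrib ac_simps)
    also have "\<dots> = \<alpha>' s * V (t - s) - \<alpha> s * L (t - s)"
      using i1 i2 by (simp add: Veq[OF ts] L_def)
    finally show "(LINT y|lborel. heat_kernel (t - s) (x - y) * (\<alpha>' s * \<gamma> y - \<alpha> s * (\<Sum>k\<in>UNIV. \<gamma>2 k y))) =
      \<alpha>' s * V (t - s) - \<alpha> s * L (t - s)" .
  qed
qed

definition heat_integrand :: "real \<times> (real ^ 'n) \<Rightarrow> real \<times> (real ^ 'n) \<Rightarrow> real" where
  "heat_integrand = (\<lambda>(t, x) (s, y). indicator {0..t} s * heat_kernel (t - s) (x - y))"

lemma heat_integrand_measurable [measurable]:
  "heat_integrand q \<in> borel_measurable (borel :: (real \<times> (real ^ 'n)) measure)"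
proof -
  have "heat_integrand q \<in> borel_measurable (borel \<Otimes>\<^sub>M borel)"
    unfolding heat_integrand_def case_prod_beta by measurable
  then show ?thesis by (simp add: borel_prod)
qed

lemma heat_integrand_nonneg [simp]: "0 \<le> heat_integrand q p"
  by (simp add: heat_integrand_def case_prod_beta)

text \<open>Every time slice before \<open>t\<close> carries the same mass \<open>heat_mass\<close>,
  so the total mass is \<open>t\<close> times that.\<close>

lemma heat_integrand_integrable:
  fixes \<psi> :: "real \<times> (real ^ 'n) \<Rightarrow> real"
  assumes t: "0 \<le> fst q" and [measurable]: "\<psi> \<in> borel_measurable borel" and K: "\<And>p. \<bar>\<psi> p\<bar> \<le> K"
  shows "integrable lborel (\<lambda>p. heat_integrand q p * \<psi> p)"
proof -
  obtain t x where q: "q = (t, x)" by (cases q)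
  have "integrable lborel (heat_integrand q)"
  proof (rule integrableI_nonneg)
    have "(\<integral>\<^sup>+p. ennreal (heat_integrand q p) \<partial>lborel) = (\<integral>\<^sup>+s. \<integral>\<^sup>+y. ennreal (heat_integrand q (s, y)) \<partial>lborel \<partial>lborel)"
      unfolding lborel_prod[symmetric]
      by (intro lborel.nn_integral_fst[symmetric]) (simp add: lborel_prod)
    also have "\<dots> \<le> (\<integral>\<^sup>+s. ennreal (heat_mass TYPE('n)) * indicator {0..t} s \<partial>lborel)"
    proof (rule nn_integral_mono)
      fix s
      show "(\<integral>\<^sup>+y. ennreal (heat_integrand q (s, y)) \<partial>lborel) \<le> ennreal (heat_mass TYPE('n)) * indicator {0..t} s"
      proof (cases "0 \<le> s \<and> s < t")
        case True
        then have ts: "0 < t - s" by simp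
        have "(\<integral>\<^sup>+y. ennreal (heat_integrand q (s, y)) \<partial>lborel) = (\<integral>\<^sup>+y. ennreal (heat_kernel (t - s) (x - y)) \<partial>lborel)"
          using True by (simp add: q heat_integrand_def)
        also have "\<dots> = ennreal (heat_mass TYPE('n))"
          by (rule heat_kernel_nn_integral[OF ts])
        finally show ?thesis using True by simp
      next
        case False
        then have "heat_integrand q (s, y) = 0" for y
          by (auto simp: q heat_integrand_def heat_kernel_def indicator_def)
        then show ?thesis by simp
      qed
    qed
    also have "\<dots> = ennreal (heat_mass TYPE('n)) * ennreal t" using t by (simp add: nn_integral_cmult_indicator q)
    also have "\<dots> < \<infinity>" by (simp add: ennreal_mult_less_top)
    finally show "(\<integral>\<^sup>+p. ennreal (heat_integrand q p) \<partial>lborel) < \<infinity>" .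
  qed auto
  then have "integrable lborel (\<lambda>p. heat_integrand q p * K)" by simp
  then show ?thesis
    by (rule Bochner_Integration.integrable_bound)
      (auto simp: abs_mult intro!: mult_left_mono order_trans[OF K])
qed

text \<open>Here \<psi> is the heat operator (d/ds - Laplacian) applied to the product of \<alpha>
  and \<gamma>; Fubini reduces the space-time pairing to the time-slice formula.\<close>

lemma duhamel:
  fixes \<gamma> :: "real ^ 'n \<Rightarrow> real"
  assumes g: "smooth_bump \<gamma> \<gamma>1 \<gamma>2"
    and \<alpha>: "\<And>s. (\<alpha> has_real_derivative \<alpha>' s) (at s)" and \<alpha>0: "\<alpha> 0 = 0" and t: "0 \<le> t"
    and \<psi>: "\<And>s y. \<psi> (s, y) = \<alpha>' s * \<gamma> y - \<alpha> s * (\<Sum>k\<in>UNIV. \<gamma>2 k y)"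
    and \<psi>m: "\<psi> \<in> borel_measurable borel" and K: "\<And>p. \<bar>\<psi> p\<bar> \<le> K"
  shows "(LINT p|lborel. heat_integrand (t, x) p * \<psi> p) = heat_mass TYPE('n) * \<alpha> t * \<gamma> x"
proof -
  have i: "integrable lborel (\<lambda>p. heat_integrand (t, x) p * \<psi> p)"
    using heat_integrand_integrable[of "(t, x)", OF _ \<psi>m K] t by simp
  have unc: "(\<lambda>(s, y). heat_integrand (t, x) (s, y) * \<psi> (s, y)) = (\<lambda>p. heat_integrand (t, x) p * \<psi> p)" by auto
  have i': "integrable (lborel \<Otimes>\<^sub>M lborel) (\<lambda>(s, y). heat_integrand (t, x) (s, y) * \<psi> (s, y))"
    using i by (simp only: unc lborel_prod)
  have eq: "(LINT y|lborel. heat_integrand (t, x) (s, y) * \<psi> (s, y)) =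
    (if s \<in> {0..t} then LINT y|lborel. heat_kernel (t - s) (x - y) * (\<alpha>' s * \<gamma> y - \<alpha> s * (\<Sum>k\<in>UNIV. \<gamma>2 k y)) else 0)" for s
    by (simp add: heat_integrand_def \<psi>)
  have i2: "integrable lborel (\<lambda>s. LINT y|lborel. heat_integrand (t, x) (s, y) * \<psi> (s, y))"
    using lborel_pair.integrable_fst'[OF i'] by simp
  have "(LINT p|lborel. heat_integrand (t, x) p * \<psi> p) = (LINT s|lborel. LINT y|lborel. heat_integrand (t, x) (s, y) * \<psi> (s, y))"
    using lborel_pair.integral_fst'[OF i'] by (simp only: unc lborel_prod)
  also have "((\<lambda>s. LINT y|lborel. heat_integrand (t, x) (s, y) * \<psi> (s, y)) has_integral \<dots>) UNIV"
    by (rule has_integral_integral_lborel[OF i2])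
  then have "((\<lambda>s. LINT y|lborel. heat_kernel (t - s) (x - y) * (\<alpha>' s * \<gamma> y - \<alpha> s * (\<Sum>k\<in>UNIV. \<gamma>2 k y)))
    has_integral (LINT s|lborel. LINT y|lborel. heat_integrand (t, x) (s, y) * \<psi> (s, y))) {0..t}"
    unfolding eq has_integral_restrict_UNIV .
  from has_integral_unique[OF this duhamel_has_integral[OF g \<alpha> \<alpha>0 t]]
  have "(LINT s|lborel. LINT y|lborel. heat_integrand (t, x) (s, y) * \<psi> (s, y)) = heat_mass TYPE('n) * \<alpha> t * \<gamma> x" .
  finally show ?thesis .
qed

section \<open>Localized test functions\<close>

lemma max_0_power_DERIV:
  fixes u :: real
  shows "((\<lambda>u. max 0 u ^ (n + 2)) has_real_derivative real (n + 2) * max 0 u ^ (n + 1)) (at u)"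
proof -
  consider "u < 0" | "u = 0" | "0 < u" by linarith
  then show ?thesis
  proof cases
    case 1
    have "((\<lambda>_. 0) has_real_derivative 0) (at u)" by simp
    then have "((\<lambda>u. max 0 u ^ (n + 2)) has_real_derivative 0) (at u)"
      by (rule has_field_derivative_transform_within_open[where S = "{..<0}"]) (use 1 in auto)
    then show ?thesis using 1 by simp
  next
    case 2
    have "((\<lambda>h. max 0 h ^ (n + 2) / h) \<longlongrightarrow> 0) (at (0::real))"
    proof (rule Lim_null_comparison)
      show "\<forall>\<^sub>F h :: real in at 0. norm (max 0 h ^ (n + 2) / h) \<le> \<bar>h\<bar> ^ (n + 1)"
      proof (intro always_eventually allI)
        fix h :: real
        show "norm (max 0 h ^ (n + 2) / h) \<le> \<bar>h\<bar> ^ (n + 1)"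
        proof (cases "0 < h")
          case False
          then have "max 0 h = 0" by simp
          then have "norm (max 0 h ^ (n + 2) / h) = 0" by simp
          then show ?thesis using zero_le_power[OF abs_ge_zero, of h "n + 1"] by linarith
        qed simp
      qed
      have "((\<lambda>h. \<bar>h\<bar> ^ (n + 1)) \<longlongrightarrow> \<bar>0\<bar> ^ (n + 1)) (at (0::real))" by (intro tendsto_intros)
      then show "((\<lambda>h. \<bar>h\<bar> ^ (n + 1)) \<longlongrightarrow> 0) (at (0::real))" by simp
    qed
    then show ?thesis using 2 by (simp add: has_field_derivative_iff)
  next
    case 3
    have "((\<lambda>u. u ^ (n + 2)) has_real_derivative real (n + 2) * u ^ (n + 1)) (at u)"
      using DERIV_pow[of "n + 2" u] by simp
    then have "((\<lambda>u. max 0 u ^ (n + 2)) has_real_derivative real (n + 2) * u ^ (n + 1)) (at u)"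
      by (rule has_field_derivative_transform_within_open[where S = "{0<..}"]) (use 3 in auto)
    then show ?thesis using 3 by simp
  qed
qed

section \<open>Polynomial bumps and their heat sources\<close>

definition bump_profile :: "real ^ 'n \<Rightarrow> real \<Rightarrow> real ^ 'n \<Rightarrow> real" where
  "bump_profile c r y = max 0 (1 - (norm (y - c))\<^sup>2 / r\<^sup>2)"

text \<open>The cube makes the truncated profile twice continuously differentiable: two derivatives
  cost two powers and leave the continuous first power.\<close>

definition space_bump :: "real ^ 'n \<Rightarrow> real \<Rightarrow> real ^ 'n \<Rightarrow> real" where
  "space_bump c r y = bump_profile c r y ^ 3"

definition space_bump1 :: "real ^ 'n \<Rightarrow> real \<Rightarrow> 'n \<Rightarrow> real ^ 'n \<Rightarrow> real" where
  "space_bump1 c r k y = - 6 * (y - c) $ k / r\<^sup>2 * bump_profile c r y ^ 2"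

definition space_bump2 :: "real ^ 'n \<Rightarrow> real \<Rightarrow> 'n \<Rightarrow> real ^ 'n \<Rightarrow> real" where
  "space_bump2 c r k y = - 6 / r\<^sup>2 * bump_profile c r y ^ 2 + 24 * ((y - c) $ k)\<^sup>2 / r ^ 4 * bump_profile c r y"

text \<open>One time derivative is taken, so a square is enough. The scale is r^2 because the
  geometry is parabolic.\<close>

definition time_bump :: "real \<Rightarrow> real \<Rightarrow> real \<Rightarrow> real" where
  "time_bump t0 r s = max 0 (1 - ((s - t0) / r\<^sup>2)\<^sup>2) ^ 2"

definition time_bump1 :: "real \<Rightarrow> real \<Rightarrow> real \<Rightarrow> real" where
  "time_bump1 t0 r s = - 4 * (s - t0) / r ^ 4 * max 0 (1 - ((s - t0) / r\<^sup>2)\<^sup>2)"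

text \<open>The heat operator applied to the product of the time bump and the space bump.\<close>

definition bump_source :: "real \<Rightarrow> real ^ 'n \<Rightarrow> real \<Rightarrow> real \<times> (real ^ 'n) \<Rightarrow> real" where
  "bump_source t0 c r = (\<lambda>(s, y). time_bump1 t0 r s * space_bump c r y - time_bump t0 r s * (\<Sum>k\<in>UNIV. space_bump2 c r k y))"

lemma max_0_power_DERIV':
  fixes u :: real
  assumes "2 \<le> m"
  shows "((\<lambda>u. max 0 u ^ m) has_real_derivative real m * max 0 u ^ (m - 1)) (at u)"
  using max_0_power_DERIV[of "m - 2" u] assms by (simp add: numeral_2_eq_2 Suc_diff_Suc)

lemma bump_profile_bounds: "0 \<le> bump_profile c r y" "bump_profile c r y \<le> 1"
  by (auto simp: bump_profile_def)

lemma bump_profile_eq_0: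
  assumes "0 < r" "r \<le> norm (y - c)"
  shows "bump_profile c r y = 0"
proof -
  have "r\<^sup>2 \<le> (norm (y - c))\<^sup>2" using assms by (intro power_mono) auto
  then show ?thesis using assms by (simp add: bump_profile_def field_simps)
qed

lemma bump_profile_DERIV:
  assumes r: "0 < r" and n: "2 \<le> n"
  shows "((\<lambda>h. bump_profile c r (y + h *\<^sub>R axis k 1) ^ n) has_real_derivative
    real n * bump_profile c r y ^ (n - 1) * (- 2 * (y - c) $ k / r\<^sup>2)) (at 0)"
proof -
  define q where "q h = 1 - (norm (y - c + h *\<^sub>R axis k 1))\<^sup>2 / r\<^sup>2" for h
  have q: "(q has_real_derivative - 2 * (y - c) $ k / r\<^sup>2) (at 0)"
    unfolding q_def norm_add_axis_sq using r
    by (auto intro!: derivative_eq_intros simp: field_simps power2_eq_square power4_eq_xxxx)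
  have "bump_profile c r (y + h *\<^sub>R axis k 1) = max 0 (q h)" for h
    by (simp add: bump_profile_def q_def algebra_simps)
  then show ?thesis
    using DERIV_chain2[OF max_0_power_DERIV'[OF n, of "q 0"] q] by (simp add: bump_profile_def q_def)
qed

lemma continuous_bump_profile [continuous_intros]: "0 < r \<Longrightarrow> continuous_on S (bump_profile c r)"
  unfolding bump_profile_def[abs_def] by (intro continuous_intros) auto

lemma smooth_space_bump:
  fixes c :: "real ^ 'n"
  assumes r: "0 < r"
  shows "smooth_bump (space_bump c r) (space_bump1 c r) (space_bump2 c r)"
  unfolding smooth_bump_def
proof (intro conjI allI)
  show "continuous_on UNIV (space_bump c r)"
    unfolding space_bump_def[abs_def] by (intro continuous_intros r)
  show "continuous_on UNIV (space_bump1 c r k)" "continuous_on UNIV (space_bump2 c r k)" for k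
    unfolding space_bump1_def[abs_def] space_bump2_def[abs_def] using r by (auto intro!: continuous_intros)
  show "((\<lambda>h. space_bump c r (x + h *\<^sub>R axis k 1)) has_real_derivative space_bump1 c r k x) (at 0)" for k x
    unfolding space_bump_def space_bump1_def
  proof -
    have "((\<lambda>h. bump_profile c r (x + h *\<^sub>R axis k 1) ^ 3) has_real_derivative
      real 3 * bump_profile c r x ^ (3 - 1) * (- 2 * (x - c) $ k / r\<^sup>2)) (at 0)"
      by (rule bump_profile_DERIV[OF r]) simp
    then show "((\<lambda>h. bump_profile c r (x + h *\<^sub>R axis k 1) ^ 3) has_real_derivative
      - 6 * (x - c) $ k / r\<^sup>2 * bump_profile c r x ^ 2) (at 0)"
      by (rule DERIV_cong) simp
  qed
  show "((\<lambda>h. space_bump1 c r k (x + h *\<^sub>R axis k 1)) has_real_derivative space_bump2 c r k x) (at 0)" for k x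
  proof -
    have l: "((\<lambda>h. - 6 * (x + h *\<^sub>R axis k 1 - c) $ k / r\<^sup>2) has_real_derivative - 6 / r\<^sup>2) (at 0)"
      using r by (auto intro!: derivative_eq_intros simp: axis_def power2_eq_square power4_eq_xxxx field_simps)
    have "((\<lambda>h. - 6 * (x + h *\<^sub>R axis k 1 - c) $ k / r\<^sup>2 * bump_profile c r (x + h *\<^sub>R axis k 1) ^ 2) has_real_derivative
      - 6 / r\<^sup>2 * bump_profile c r (x + 0 *\<^sub>R axis k 1) ^ 2 +
      (real 2 * bump_profile c r x ^ (2 - 1) * (- 2 * (x - c) $ k / r\<^sup>2)) * (- 6 * (x + 0 *\<^sub>R axis k 1 - c) $ k / r\<^sup>2)) (at 0)"
      by (rule DERIV_mult[OF l bump_profile_DERIV[OF r]]) simp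
    then show ?thesis
      unfolding space_bump1_def space_bump2_def
      by (rule DERIV_cong) (use r in \<open>simp add: power2_eq_square power4_eq_xxxx field_simps\<close>)
  qed
  show "\<exists>B. \<forall>x. B < norm x \<longrightarrow> space_bump c r x = 0 \<and> (\<forall>k. space_bump1 c r k x = 0 \<and> space_bump2 c r k x = 0)"
  proof (intro exI[of _ "norm c + r"] allI impI)
    fix x :: "real ^ 'n" assume "norm c + r < norm x"
    then have "r \<le> norm (x - c)" using norm_triangle_ineq2[of x c] by linarith
    then have "bump_profile c r x = 0" by (rule bump_profile_eq_0[OF r])
    then show "space_bump c r x = 0 \<and> (\<forall>k. space_bump1 c r k x = 0 \<and> space_bump2 c r k x = 0)"
      by (simp add: space_bump_def space_bump1_def space_bump2_def)
  qed
qed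

lemma space_bump_bounds: "0 \<le> space_bump c r y" "space_bump c r y \<le> 1"
  using bump_profile_bounds[of c r y] by (auto simp: space_bump_def power_le_one)

lemma space_bump_ge:
  fixes c :: "real ^ 'n"
  assumes r: "0 < r" and z: "norm (y - c) \<le> r / 2"
  shows "1 / 4 \<le> space_bump c r y"
proof -
  have "(norm (y - c))\<^sup>2 \<le> (r / 2)\<^sup>2" using z by (intro power_mono) auto
  then have "(norm (y - c))\<^sup>2 / r\<^sup>2 \<le> 1 / 4" using r by (simp add: field_simps power2_eq_square)
  then have "3 / 4 \<le> bump_profile c r y" unfolding bump_profile_def by (simp add: le_max_iff_disj)
  then have "(3 / 4) ^ 3 \<le> space_bump c r y" unfolding space_bump_def by (rule power_mono) simp
  then show ?thesis by (simp add: power3_eq_cube)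
qed

lemma space_bump_center [simp]: "space_bump c r c = 1"
  by (simp add: space_bump_def bump_profile_def)

lemma time_bump_center [simp]: "time_bump t0 r t0 = 1"
  by (simp add: time_bump_def)

lemma time_profile_eq_0:
  fixes r s t0 :: real
  assumes "0 < r" "r\<^sup>2 \<le> \<bar>s - t0\<bar>"
  shows "max 0 (1 - ((s - t0) / r\<^sup>2)\<^sup>2) = 0"
proof -
  have "1 \<le> \<bar>(s - t0) / r\<^sup>2\<bar>" unfolding abs_divide using assms by simp
  then have "1 \<le> \<bar>(s - t0) / r\<^sup>2\<bar>\<^sup>2" by (rule one_le_power)
  then have "1 \<le> ((s - t0) / r\<^sup>2)\<^sup>2" by (simp only: power2_abs)
  then show ?thesis by simp
qed

lemma time_bump_DERIV:
  assumes r: "0 < r"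
  shows "(time_bump t0 r has_real_derivative time_bump1 t0 r s) (at s)"
proof -
  have q: "((\<lambda>s. 1 - ((s - t0) / r\<^sup>2)\<^sup>2) has_real_derivative - 2 * (s - t0) / r ^ 4) (at s)"
    using r by (auto intro!: derivative_eq_intros simp: power2_eq_square power4_eq_xxxx field_simps)
  show ?thesis
    unfolding time_bump_def[abs_def] time_bump1_def
    by (rule DERIV_cong[OF DERIV_chain2[OF max_0_power_DERIV' q]]) simp_all
qed

lemma time_bump_bounds: "0 \<le> time_bump t0 r s" "time_bump t0 r s \<le> 1"
  by (auto simp: time_bump_def intro!: power_le_one)

lemma time_bump1_bound:
  assumes r: "0 < r"
  shows "\<bar>time_bump1 t0 r s\<bar> \<le> 4 / r\<^sup>2"
proof (cases "r\<^sup>2 \<le> \<bar>s - t0\<bar>")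
  case True
  then show ?thesis using time_profile_eq_0[OF r True] by (simp add: time_bump1_def)
next
  case False
  have "\<bar>time_bump1 t0 r s\<bar> = 4 * \<bar>s - t0\<bar> / r ^ 4 * max 0 (1 - ((s - t0) / r\<^sup>2)\<^sup>2)"
    by (simp add: time_bump1_def abs_mult abs_divide del: right_diff_distrib_numeral)
  also have "\<dots> \<le> 4 * r\<^sup>2 / r ^ 4 * 1"
    using False r by (intro mult_mono divide_right_mono) auto
  also have "\<dots> = 4 / r\<^sup>2" using r by (simp add: power2_eq_square power4_eq_xxxx)
  finally show ?thesis .
qed

lemma space_bump_laplacian_bound:
  fixes c :: "real ^ 'n"
  assumes r: "0 < r"
  shows "\<bar>\<Sum>k\<in>UNIV. space_bump2 c r k y\<bar> \<le> (6 * real CARD('n) + 24) / r\<^sup>2"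
proof (cases "r \<le> norm (y - c)")
  case True
  then show ?thesis using bump_profile_eq_0[OF r True] by (simp add: space_bump2_def)
next
  case False
  define m where "m = bump_profile c r y"
  have m: "0 \<le> m" "m \<le> 1" "m\<^sup>2 \<le> 1" using bump_profile_bounds[of c r y] by (auto simp: m_def power_le_one)
  have sq: "(norm (y - c))\<^sup>2 \<le> r\<^sup>2" using False by (intro power_mono) auto
  have "(\<Sum>k\<in>UNIV. space_bump2 c r k y) = - (6 * real CARD('n) / r\<^sup>2 * m\<^sup>2) + 24 * (norm (y - c))\<^sup>2 / r ^ 4 * m"
    by (simp add: space_bump2_def m_def sum.distrib sum_subtractf norm_sq_eq_sum sum_distrib_left sum_distrib_right sum_divide_distrib)
  then have "\<bar>\<Sum>k\<in>UNIV. space_bump2 c r k y\<bar> \<le> \<bar>6 * real CARD('n) / r\<^sup>2 * m\<^sup>2\<bar> + \<bar>24 * (norm (y - c))\<^sup>2 / r ^ 4 * m\<bar>"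
    by linarith
  also have "\<dots> \<le> 6 * real CARD('n) / r\<^sup>2 * 1 + 24 * r\<^sup>2 / r ^ 4 * 1"
    using m sq r unfolding abs_mult by (intro add_mono mult_mono) (auto intro!: divide_right_mono)
  also have "\<dots> = (6 * real CARD('n) + 24) / r\<^sup>2" using r by (simp add: add_divide_distrib power2_eq_square power4_eq_xxxx)
  finally show ?thesis .
qed

lemma bump_source_measurable [measurable]:
  assumes "0 < r"
  shows "bump_source t0 c r \<in> borel_measurable (borel :: (real \<times> (real ^ 'n)) measure)"
proof -
  have g: "smooth_bump (space_bump c r) (space_bump1 c r) (space_bump2 c r)" by (rule smooth_space_bump[OF assms])
  have "continuous_on UNIV (space_bump c r)" "\<And>k. continuous_on UNIV (space_bump2 c r k)"
    using g unfolding smooth_bump_def by blast+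
  then have [measurable]: "space_bump c r \<in> borel_measurable borel" "\<And>k. space_bump2 c r k \<in> borel_measurable borel"
    by (auto intro: borel_measurable_continuous_onI)
  have [measurable]: "time_bump t0 r \<in> borel_measurable borel" "time_bump1 t0 r \<in> borel_measurable borel"
    unfolding time_bump_def[abs_def] time_bump1_def[abs_def] by measurable
  have "bump_source t0 c r \<in> borel_measurable (borel \<Otimes>\<^sub>M borel)"
    unfolding bump_source_def case_prod_beta by measurable
  then show ?thesis by (simp add: borel_prod)
qed

text \<open>The time derivative contributes 4 and the Laplacian 6 N + 24, all in units of
  r^-2.\<close>

definition bump_source_bound :: "'n::finite itself \<Rightarrow> real" where
  "bump_source_bound _ = 6 * real CARD('n) + 28"

lemma bump_source_bound_pos: "0 < bump_source_bound TYPE('n::finite)"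
  by (simp add: bump_source_bound_def add_nonneg_pos)

lemma bump_source_le:
  fixes p :: "real \<times> (real ^ 'n)"
  assumes r: "0 < r"
  shows "\<bar>bump_source t0 c r p\<bar> \<le> bump_source_bound TYPE('n) / r\<^sup>2"
proof -
  obtain s y where p: "p = (s, y)" by (cases p)
  have "\<bar>bump_source t0 c r p\<bar> \<le> \<bar>time_bump1 t0 r s\<bar> * \<bar>space_bump c r y\<bar> + \<bar>time_bump t0 r s\<bar> * \<bar>\<Sum>k\<in>UNIV. space_bump2 c r k y\<bar>"
    unfolding p bump_source_def using abs_triangle_ineq4[of "time_bump1 t0 r s * space_bump c r y" "time_bump t0 r s * (\<Sum>k\<in>UNIV. space_bump2 c r k y)"]
    by (simp add: abs_mult)
  also have "\<dots> \<le> 4 / r\<^sup>2 * 1 + 1 * ((6 * real CARD('n) + 24) / r\<^sup>2)"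
    using r space_bump_bounds[of c r y] time_bump_bounds[of t0 r s]
    by (intro add_mono mult_mono time_bump1_bound space_bump_laplacian_bound) auto
  also have "\<dots> = bump_source_bound TYPE('n) / r\<^sup>2" by (simp add: bump_source_bound_def add_divide_distrib)
  finally show ?thesis .
qed

lemma bump_source_eq_0_time:
  assumes "0 < r" "r\<^sup>2 \<le> \<bar>s - t0\<bar>"
  shows "bump_source t0 c r (s, y) = 0"
  using time_profile_eq_0[OF assms] by (simp add: bump_source_def time_bump_def time_bump1_def)

lemma bump_source_eq_0_space:
  assumes "0 < r" "r \<le> norm (y - c)"
  shows "bump_source t0 c r (s, y) = 0"
  using bump_profile_eq_0[OF assms] by (simp add: bump_source_def space_bump_def space_bump2_def)

lemma bump_source_shift: "bump_source t0 c r (s, y - z) = bump_source t0 (c + z) r (s, y)"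
  by (simp add: bump_source_def space_bump_def space_bump2_def bump_profile_def algebra_simps)

lemma space_bump_shift: "space_bump c r (x - z) = space_bump (c + z) r x"
  by (simp add: space_bump_def bump_profile_def algebra_simps)

text \<open>The condition \<open>r\<^sup>2 < t0\<close> makes the time bump vanish at time 0,
  matching the zero initial condition in Duhamel's formula.\<close>

lemma heat_integral_bump_source:
  fixes x :: "real ^ 'n"
  assumes r: "0 < r" "r\<^sup>2 < t0" and t: "0 \<le> t"
  shows "(LINT p|lborel. heat_integrand (t, x) p * bump_source t0 c r p) = heat_mass TYPE('n) * time_bump t0 r t * space_bump c r x"
proof (rule duhamel[OF smooth_space_bump[OF r(1)] time_bump_DERIV[OF r(1)] _ t _ bump_source_measurable[OF r(1)] bump_source_le[OF r(1)]])
  show "time_bump t0 r 0 = 0" using time_profile_eq_0[OF r(1), of 0 t0] r by (simp add: time_bump_def)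
  show "bump_source t0 c r (s, y) = time_bump1 t0 r s * space_bump c r y - time_bump t0 r s * (\<Sum>k\<in>UNIV. space_bump2 c r k y)" for s y
    by (simp add: bump_source_def)
qed

lemma time_bump_eq_0: "0 < r \<Longrightarrow> r\<^sup>2 \<le> \<bar>t - t0\<bar> \<Longrightarrow> time_bump t0 r t = 0"
  using time_profile_eq_0[of r t t0] by (simp add: time_bump_def)

lemma space_bump_eq_0: "0 < r \<Longrightarrow> r \<le> norm (x - c) \<Longrightarrow> space_bump c r x = 0"
  using bump_profile_eq_0[of r x c] by (simp add: space_bump_def)

text \<open>The pairing with G vanishes outside a parabolic cylinder around the centre. The spatial
  radius is 2 r because the coloured test function is a bump of radius r averaged over shifts of
  length at most r.\<close>

definition localized_dual ::
  "(real \<times> (real ^ 'n) \<times> (real ^ 'n)) measure \<Rightarrow> real \<Rightarrow> real ^ 'n \<Rightarrow> real \<Rightarrow> (real \<times> (real ^ 'n) \<Rightarrow> real) \<Rightarrow> real \<Rightarrow> bool" where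
  "localized_dual \<Lambda> t0 c r g \<kappa> \<longleftrightarrow> 0 < \<kappa> \<and> dual_bound \<Lambda> g \<kappa> \<and> g \<in> borel_measurable borel \<and> (\<exists>K. \<forall>p. \<bar>g p\<bar> \<le> K) \<and>
     (\<forall>t x. 0 \<le> t \<longrightarrow> r\<^sup>2 \<le> \<bar>t - t0\<bar> \<or> 2 * r \<le> norm (x - c) \<longrightarrow> (LINT p|lborel. heat_integrand (t, x) p * g p) = 0)"

text \<open>The only property of the noise on which the final estimate draws besides local
  finiteness. The ratio pairing^2 / \<kappa> is at least C r^(2 - \<beta>), with one C for all
  centres and radii.\<close>

definition has_localized_duals :: "(real \<times> (real ^ 'n) \<times> (real ^ 'n)) measure \<Rightarrow> real \<Rightarrow> bool" where
  "has_localized_duals \<Lambda> \<beta> \<longleftrightarrow> (\<exists>C>0. \<forall>t0 c r. 0 < r \<longrightarrow> r\<^sup>2 < t0 \<longrightarrow>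
     (\<exists>g \<kappa>. localized_dual \<Lambda> t0 c r g \<kappa> \<and>
       C * \<kappa> * r powr (2 - \<beta>) \<le> (LINT p|lborel. heat_integrand (t0, c) p * g p)\<^sup>2))"

lemma measure_lborel_cball:
  fixes c :: "real ^ 'n"
  assumes "0 \<le> r"
  shows "measure lborel (cball c r) = unit_ball_vol (real CARD('n)) * r ^ CARD('n)"
  using assms by (simp add: measure_def emeasure_cball)

lemma square_integrable_bounded_support:
  fixes f :: "'a::euclidean_space \<Rightarrow> real"
  assumes m: "f \<in> borel_measurable borel" and K: "\<And>x. \<bar>f x\<bar> \<le> K" and A: "bounded A" "A \<in> sets borel" and s: "\<And>x. x \<notin> A \<Longrightarrow> f x = 0"
  shows "square_integrable lborel f" "(LINT x|lborel. (f x)\<^sup>2) \<le> K\<^sup>2 * measure lborel A"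
proof -
  have le: "(f x)\<^sup>2 \<le> K\<^sup>2 * indicator A x" for x
    using power_mono[OF K[of x], of 2] s[of x] by (cases "x \<in> A") auto
  have i: "integrable lborel (\<lambda>x. K\<^sup>2 * indicator A x)"
    using A by (intro Bochner_Integration.integrable_mult_right integrable_real_indicator emeasure_bounded_finite) auto
  have i2: "integrable lborel (\<lambda>x. (f x)\<^sup>2)"
    by (rule Bochner_Integration.integrable_bound[OF i]) (use m le in auto)
  then show "square_integrable lborel f" using m by (simp add: square_integrable_def)
  have "(LINT x|lborel. (f x)\<^sup>2) \<le> (LINT x|lborel. K\<^sup>2 * indicator A x)"
    using i2 i le by (intro integral_mono) auto
  then show "(LINT x|lborel. (f x)\<^sup>2) \<le> K\<^sup>2 * measure lborel A" using A by simp
qed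

section \<open>White noise\<close>

lemma white_covariance_map_measurable:
  "(\<lambda>(s, y). (s, y, y)) \<in> borel \<rightarrow>\<^sub>M (borel :: (real \<times> (real ^ 'n) \<times> (real ^ 'n)) measure)"
  unfolding case_prod_beta by (intro borel_measurable_continuous_onI continuous_intros)

lemma locally_finite_white: "locally_finite_covariance (white_covariance :: (real \<times> (real ^ 'n) \<times> (real ^ 'n)) measure)"
  unfolding locally_finite_covariance_def
proof (intro conjI ballI)
  show "sets (white_covariance :: (real \<times> (real ^ 'n) \<times> (real ^ 'n)) measure) = sets borel" by (simp add: white_covariance_def)
  fix A B :: "(real \<times> (real ^ 'n)) set" assume AB: "A \<in> bounded_borel" "B \<in> bounded_borel"
  have m: "{(s, y, z). (s, y) \<in> A \<and> (s, z) \<in> B} \<in> sets borel"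
    using AB by (intro section_pair_measurable) (auto simp: bounded_borel_def)
  have "emeasure white_covariance {(s, y, z). (s, y) \<in> A \<and> (s, z) \<in> B} =
    emeasure lborel ((\<lambda>(s, y). (s, y, y)) -` {(s, y, z). (s, y) \<in> A \<and> (s, z) \<in> B})"
    unfolding white_covariance_def using white_covariance_map_measurable m by (subst emeasure_distr) simp_all
  also have "(\<lambda>(s, y). (s, y, y)) -` {(s, y, z). (s, y) \<in> A \<and> (s, z) \<in> B} = A \<inter> B" by auto
  also have "emeasure lborel (A \<inter> B) < \<infinity>"
    using AB by (intro emeasure_bounded_finite bounded_Int) (auto simp: bounded_borel_def)
  finally show "emeasure white_covariance {(s, y, z). (s, y) \<in> A \<and> (s, z) \<in> B} < \<infinity>" .
qed

text \<open>On the diagonal the noise form and the plus norm both reduce to the integral of the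
  square of \<open>h\<close>, so the bound is the Cauchy-Schwarz inequality.\<close>

lemma white_dual_bound:
  fixes g :: "real \<times> (real ^ 'n) \<Rightarrow> real"
  assumes g: "square_integrable lborel g" and k: "(LINT p|lborel. (g p)\<^sup>2) \<le> \<kappa>"
  shows "dual_bound white_covariance g \<kappa>"
  unfolding dual_bound_def
proof (intro conjI ballI impI)
  show "0 \<le> \<kappa>" using order_trans[OF Bochner_Integration.integral_nonneg k] by simp
  fix h :: "real \<times> (real ^ 'n) \<Rightarrow> real"
  assume [measurable]: "h \<in> borel_measurable borel" and fin: "plus_norm_sq white_covariance h < \<infinity>"
  have hm: "(\<lambda>(s, y, z). h (s, y) * h (s, z)) \<in> borel_measurable borel"
    and hm': "(\<lambda>(s, y, z). ennreal (\<bar>h (s, y)\<bar> * \<bar>h (s, z)\<bar>)) \<in> borel_measurable borel"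
  proof -
    have m1[measurable]: "(\<lambda>x :: real \<times> (real ^ 'n) \<times> (real ^ 'n). (fst x, fst (snd x))) \<in> borel \<rightarrow>\<^sub>M borel"
      by (intro borel_measurable_continuous_onI continuous_intros)
    have m2[measurable]: "(\<lambda>x :: real \<times> (real ^ 'n) \<times> (real ^ 'n). (fst x, snd (snd x))) \<in> borel \<rightarrow>\<^sub>M borel"
      by (intro borel_measurable_continuous_onI continuous_intros)
    have [measurable]: "(\<lambda>x :: real \<times> (real ^ 'n) \<times> (real ^ 'n). h (fst x, fst (snd x))) \<in> borel_measurable borel"
      "(\<lambda>x :: real \<times> (real ^ 'n) \<times> (real ^ 'n). h (fst x, snd (snd x))) \<in> borel_measurable borel"
      using measurable_compose[OF m1, of h] measurable_compose[OF m2, of h] by simp_all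
    show "(\<lambda>(s, y, z). h (s, y) * h (s, z)) \<in> borel_measurable borel"
      "(\<lambda>(s, y, z). ennreal (\<bar>h (s, y)\<bar> * \<bar>h (s, z)\<bar>)) \<in> borel_measurable borel"
      unfolding case_prod_beta by measurable
  qed
  have "plus_norm_sq white_covariance h = (\<integral>\<^sup>+p. ennreal ((h p)\<^sup>2) \<partial>lborel)"
    unfolding plus_norm_sq_def white_covariance_def
    by (subst nn_integral_distr) (use white_covariance_map_measurable hm' in \<open>auto simp: case_prod_beta power2_eq_square intro!: nn_integral_cong\<close>)
  then have i: "square_integrable lborel h"
    using fin unfolding square_integrable_def by (auto intro!: integrableI_nonneg)
  have nf: "noise_form white_covariance h = (LINT p|lborel. (h p)\<^sup>2)"
    unfolding noise_form_def white_covariance_def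
    by (subst integral_distr) (use white_covariance_map_measurable hm in \<open>auto simp: case_prod_beta power2_eq_square intro!: Bochner_Integration.integral_cong\<close>)
  have "(LINT p|lborel. h p * g p)\<^sup>2 \<le> (LINT p|lborel. (h p)\<^sup>2) * (LINT p|lborel. (g p)\<^sup>2)"
    by (rule square_integrable_cauchy_schwarz[OF i g])
  also have "\<dots> \<le> (LINT p|lborel. (h p)\<^sup>2) * \<kappa>" by (intro mult_left_mono k) simp
  finally show "(LINT p|lborel. h p * g p)\<^sup>2 \<le> \<kappa> * noise_form white_covariance h" by (simp add: nf mult.commute)
qed

lemma white_has_localized_duals:
  assumes N: "CARD('n::finite) = 1"
  shows "has_localized_duals (white_covariance :: (real \<times> (real ^ 'n) \<times> (real ^ 'n)) measure) 1"
proof -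
  define K where "K = bump_source_bound TYPE('n)"
  define V where "V = unit_ball_vol 1"
  define m where "m = heat_mass TYPE('n)"
  have pos: "0 < K" "0 < V" "0 < m"
    using bump_source_bound_pos heat_mass_pos by (auto simp: K_def V_def m_def)
  show ?thesis
    unfolding has_localized_duals_def
  \<comment> \<open>The value for which C \<kappa> r equals m^2, where m is the pairing at the
    centre.\<close>
  proof (intro exI[of _ "m\<^sup>2 / (2 * K\<^sup>2 * V)"] conjI allI impI)
    show "0 < m\<^sup>2 / (2 * K\<^sup>2 * V)" using pos by simp
    fix t0 r :: real and c :: "real ^ 'n"
    assume r: "0 < r" "r\<^sup>2 < t0"
    \<comment> \<open>In dimension 1 the supporting cylinder has measure 2 V r^3, and the source is
      at most K / r^2 there, so its squared norm is at most 2 K^2 V / r.\<close>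
    let ?g = "bump_source t0 c r" and ?k = "2 * K\<^sup>2 * V / r"
    let ?A = "{t0 - r\<^sup>2 .. t0 + r\<^sup>2} \<times> cball c r"
    have A: "measure lborel ?A = 2 * V * r ^ 3"
    proof -
      have "emeasure lborel ?A = emeasure lborel {t0 - r\<^sup>2 .. t0 + r\<^sup>2} * emeasure lborel (cball c r)"
        unfolding lborel_prod[symmetric] by (rule lborel.emeasure_pair_measure_Times) auto
      then show ?thesis using r N by (simp add: measure_def emeasure_cball V_def enn2real_mult power2_eq_square power3_eq_cube)
    qed
    have z: "?g p = 0" if "p \<notin> ?A" for p
    proof -
      obtain s y where p: "p = (s, y)" by (cases p)
      have "r\<^sup>2 \<le> \<bar>s - t0\<bar> \<or> r \<le> norm (y - c)"
        using that unfolding p by (auto simp: dist_norm norm_minus_commute)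
      then show ?thesis unfolding p using bump_source_eq_0_time[OF r(1)] bump_source_eq_0_space[OF r(1)] by blast
    qed
    have Ab: "bounded ?A" "?A \<in> sets borel"
      by (auto intro!: bounded_Times borel_closed closed_Times)
    note sq = square_integrable_bounded_support[OF bump_source_measurable[OF r(1)] bump_source_le[OF r(1)] Ab z]
    have "(LINT p|lborel. (?g p)\<^sup>2) \<le> (K / r\<^sup>2)\<^sup>2 * (2 * V * r ^ 3)" using sq(2) A by (simp add: K_def)
    also have "\<dots> = ?k" using r by (simp add: power2_eq_square power3_eq_cube)
    finally have le: "(LINT p|lborel. (?g p)\<^sup>2) \<le> ?k" .
    have db: "dual_bound white_covariance ?g ?k"
      using le by (intro white_dual_bound sq(1))
    show "\<exists>g \<kappa>. localized_dual white_covariance t0 c r g \<kappa> \<and>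
       m\<^sup>2 / (2 * K\<^sup>2 * V) * \<kappa> * r powr (2 - 1) \<le> (LINT p|lborel. heat_integrand (t0, c) p * g p)\<^sup>2"
      unfolding localized_dual_def
    proof (rule exI[of _ ?g], rule exI[of _ ?k], intro conjI allI impI)
      show "dual_bound white_covariance ?g ?k" by (rule db)
      show "?g \<in> borel_measurable borel" by (rule bump_source_measurable[OF r(1)])
      show "0 < ?k" using pos r by simp
      show "\<exists>K. \<forall>p. \<bar>?g p\<bar> \<le> K" using bump_source_le[OF r(1)] by blast
      fix t and x :: "real ^ 'n" assume t: "0 \<le> t" and "r\<^sup>2 \<le> \<bar>t - t0\<bar> \<or> 2 * r \<le> norm (x - c)"
      then have "time_bump t0 r t = 0 \<or> space_bump c r x = 0"
        using r by (auto intro: time_bump_eq_0 space_bump_eq_0)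
      then show "(LINT p|lborel. heat_integrand (t, x) p * ?g p) = 0"
        unfolding heat_integral_bump_source[OF r t] by auto
    next
      have "0 \<le> t0" using r order_trans[OF zero_le_power2 less_imp_le[OF r(2)]] by simp
      then have "(LINT p|lborel. heat_integrand (t0, c) p * ?g p) = m"
        using heat_integral_bump_source[OF r, of t0 c c] by (simp add: m_def)
      then show "m\<^sup>2 / (2 * K\<^sup>2 * V) * ?k * r powr (2 - 1) \<le> (LINT p|lborel. heat_integrand (t0, c) p * ?g p)\<^sup>2"
        using pos r by simp
    qed
  qed
qed

section \<open>The Riesz kernel as a superposition of balls\<close>

text \<open>Write H(e) for the integral of \<open>h y * k y e\<close> over y. Inserting the
  representation of \<open>f\<close> turns the quadratic form into the integral of H^2, and the
  pairing on the left into the integral of H \<Psi>; Cauchy-Schwarz in e finishes.\<close>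

lemma kernel_dual:
  fixes k :: "'v::euclidean_space \<Rightarrow> 'e::euclidean_space \<Rightarrow> real" and f :: "'v \<times> 'v \<Rightarrow> real"
  assumes k: "(\<lambda>(y, e). k y e) \<in> borel_measurable borel" and k0: "\<And>y e. 0 \<le> k y e"
    and f: "f \<in> borel_measurable borel" and f0: "\<And>p. 0 \<le> f p"
    and rep: "AE p in lborel. (\<integral>\<^sup>+e. ennreal (k (fst p) e * k (snd p) e) \<partial>lborel) = ennreal (f p)"
    and h[measurable]: "h \<in> borel_measurable borel"
    and hint: "integrable lborel (\<lambda>p. f p * (h (fst p) * h (snd p)))"
    and \<Psi>: "square_integrable lborel \<Psi>"
  shows "(LINT y|lborel. h y * (LINT e|lborel. k y e * \<Psi> e))\<^sup>2 \<le>
    (LINT e|lborel. (\<Psi> e)\<^sup>2) * (LINT p|lborel. f p * (h (fst p) * h (snd p)))"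
    and "0 \<le> (LINT p|lborel. f p * (h (fst p) * h (snd p)))"
proof -
  have \<Psi>m[measurable]: "\<Psi> \<in> borel_measurable borel" using \<Psi> by (simp add: square_integrable_def)
  have [measurable]: "f \<in> borel_measurable borel" by (rule f)
  have kc[measurable (raw)]: "(\<lambda>x. k (a x) (b x)) \<in> borel_measurable N"
    if "a \<in> N \<rightarrow>\<^sub>M borel" "b \<in> N \<rightarrow>\<^sub>M borel" for a b and N :: "'x measure"
  proof -
    have "(\<lambda>x. (a x, b x)) \<in> N \<rightarrow>\<^sub>M borel" using that by (simp add: borel_prod[symmetric])
    from measurable_compose[OF this k] show ?thesis by simp
  qed
  have fst_m[measurable]: "fst \<in> (borel :: ('v \<times> 'v) measure) \<rightarrow>\<^sub>M borel" and snd_m[measurable]: "snd \<in> (borel :: ('v \<times> 'v) measure) \<rightarrow>\<^sub>M borel"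
    by (simp_all add: borel_prod[symmetric])
  define F where "F p e = (h (fst p) * h (snd p)) * (k (fst p) e * k (snd p) e)" for p e
  define X where "X e = (\<integral>\<^sup>+y. ennreal (\<bar>h y\<bar> * k y e) \<partial>lborel)" for e
  define H where "H e = (LINT y|lborel. h y * k y e)" for e
  have Fm: "(\<lambda>(p, e). F p e) \<in> borel_measurable (lborel \<Otimes>\<^sub>M lborel)"
    unfolding F_def case_prod_beta by measurable
  have Fm': "(\<lambda>(p, e). ennreal \<bar>F p e\<bar>) \<in> borel_measurable (lborel \<Otimes>\<^sub>M lborel)"
    using Fm by (simp add: case_prod_beta)
  have Xm[measurable]: "X \<in> borel_measurable borel"
    unfolding X_def by measurable
  have Hm[measurable]: "H \<in> borel_measurable borel"
    unfolding H_def by measurable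
  have nnF: "(\<integral>\<^sup>+p. \<integral>\<^sup>+e. ennreal \<bar>F p e\<bar> \<partial>lborel \<partial>lborel) = (\<integral>\<^sup>+p. ennreal \<bar>f p * (h (fst p) * h (snd p))\<bar> \<partial>lborel)"
  proof (rule nn_integral_cong_AE)
    show "AE p in lborel. (\<integral>\<^sup>+e. ennreal \<bar>F p e\<bar> \<partial>lborel) = ennreal \<bar>f p * (h (fst p) * h (snd p))\<bar>"
      using rep
    proof eventually_elim
      case (elim p)
      have "(\<integral>\<^sup>+e. ennreal \<bar>F p e\<bar> \<partial>lborel) = (\<integral>\<^sup>+e. ennreal \<bar>h (fst p) * h (snd p)\<bar> * ennreal (k (fst p) e * k (snd p) e) \<partial>lborel)"
        using k0 by (intro nn_integral_cong) (simp add: F_def abs_mult ennreal_mult)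
      also have "\<dots> = ennreal \<bar>h (fst p) * h (snd p)\<bar> * ennreal (f p)"
        unfolding elim[symmetric] by (rule nn_integral_cmult) measurable
      also have "\<dots> = ennreal \<bar>f p * (h (fst p) * h (snd p))\<bar>"
        using f0 by (simp add: ennreal_mult[symmetric] abs_mult mult.commute)
      finally show ?case .
    qed
  qed
  have finF: "(\<integral>\<^sup>+p. \<integral>\<^sup>+e. ennreal \<bar>F p e\<bar> \<partial>lborel \<partial>lborel) < \<infinity>"
    unfolding nnF using hint by (simp add: integrable_iff_bounded)
  have iF: "integrable (lborel \<Otimes>\<^sub>M lborel) (\<lambda>(p, e). F p e)"
  proof (rule integrableI_bounded[OF Fm])
    have "(\<integral>\<^sup>+x. ennreal (norm (case x of (p, e) \<Rightarrow> F p e)) \<partial>(lborel \<Otimes>\<^sub>M lborel)) = (\<integral>\<^sup>+p. \<integral>\<^sup>+e. ennreal \<bar>F p e\<bar> \<partial>lborel \<partial>lborel)"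
      using lborel.nn_integral_fst[OF Fm'] by (simp add: case_prod_unfold)
    then show "(\<integral>\<^sup>+x. ennreal (norm (case x of (p, e) \<Rightarrow> F p e)) \<partial>(lborel \<Otimes>\<^sub>M lborel)) < \<infinity>" using finF by simp
  qed
  have FX: "(\<integral>\<^sup>+p. ennreal \<bar>F p e\<bar> \<partial>lborel) = X e * X e" for e
  proof -
    have "(\<integral>\<^sup>+p. ennreal \<bar>F p e\<bar> \<partial>lborel) = (\<integral>\<^sup>+p. ennreal (\<bar>h (fst p)\<bar> * k (fst p) e) * ennreal (\<bar>h (snd p)\<bar> * k (snd p) e) \<partial>(lborel \<Otimes>\<^sub>M lborel))"
      unfolding lborel_prod using k0 by (intro nn_integral_cong) (simp add: F_def abs_mult ennreal_mult[symmetric] ac_simps)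
    also have "\<dots> = (\<integral>\<^sup>+y. \<integral>\<^sup>+z. ennreal (\<bar>h y\<bar> * k y e) * ennreal (\<bar>h z\<bar> * k z e) \<partial>lborel \<partial>lborel)"
    proof -
      have "(\<lambda>(y, z). ennreal (\<bar>h y\<bar> * k y e) * ennreal (\<bar>h z\<bar> * k z e)) \<in> borel_measurable (lborel \<Otimes>\<^sub>M lborel)"
        unfolding case_prod_beta by measurable
      from lborel.nn_integral_fst[OF this] show ?thesis by (simp add: case_prod_unfold)
    qed
    also have "\<dots> = (\<integral>\<^sup>+y. ennreal (\<bar>h y\<bar> * k y e) * X e \<partial>lborel)"
      unfolding X_def by (intro nn_integral_cong nn_integral_cmult) measurable
    also have "\<dots> = X e * X e" unfolding X_def by (rule nn_integral_multc) measurable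
    finally show ?thesis .
  qed
  have finX: "(\<integral>\<^sup>+e. X e * X e \<partial>lborel) < \<infinity>"
  proof -
    have "(\<integral>\<^sup>+e. X e * X e \<partial>lborel) = (\<integral>\<^sup>+p. \<integral>\<^sup>+e. ennreal \<bar>F p e\<bar> \<partial>lborel \<partial>lborel)"
      using lborel_pair.Fubini'[OF Fm'] FX by simp
    then show ?thesis using finF by simp
  qed
  \<comment> \<open>\<open>H e\<close> is a genuine integral only where \<open>X e\<close> is
    finite, which is almost every e. At the other points the bound of \<open>H\<close> by
    \<open>X\<close> is trivial.\<close>
  have AEX: "AE e in lborel. X e < \<infinity>"
  proof -
    have "AE e in lborel. X e * X e \<noteq> \<infinity>" using finX by (intro nn_integral_PInf_AE) auto
    then show ?thesis by eventually_elim (auto simp: ennreal_mult_eq_top_iff less_top)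
  qed
  have H_int: "integrable lborel (\<lambda>y. h y * k y e)" if "X e < \<infinity>" for e
    using that k0 unfolding X_def by (intro integrableI_bounded) (auto simp: abs_mult)
  have HF: "AE e in lborel. (LINT p|lborel. F p e) = (H e)\<^sup>2"
    using AEX
  proof eventually_elim
    case (elim e)
    have ip: "integrable (lborel \<Otimes>\<^sub>M lborel) (\<lambda>(y, z). F (y, z) e)"
    proof (rule integrableI_bounded)
      show "(\<lambda>(y, z). F (y, z) e) \<in> borel_measurable (lborel \<Otimes>\<^sub>M lborel)"
        unfolding F_def case_prod_beta fst_conv snd_conv by measurable
      have "(\<integral>\<^sup>+x. ennreal (norm (case x of (y, z) \<Rightarrow> F (y, z) e)) \<partial>(lborel \<Otimes>\<^sub>M lborel)) = X e * X e"
        unfolding FX[symmetric] lborel_prod by (intro nn_integral_cong) auto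
      then show "(\<integral>\<^sup>+x. ennreal (norm (case x of (y, z) \<Rightarrow> F (y, z) e)) \<partial>(lborel \<Otimes>\<^sub>M lborel)) < \<infinity>"
        using elim by (simp add: ennreal_mult_less_top)
    qed
    have "(LINT p|lborel. F p e) = (LINT y|lborel. LINT z|lborel. F (y, z) e)"
    proof -
      have "(\<lambda>(y, z). F (y, z) e) = (\<lambda>p. F p e)" by auto
      then show ?thesis using lborel_pair.integral_fst'[OF ip] by (simp only: lborel_prod)
    qed
    also have "\<dots> = (LINT y|lborel. LINT z|lborel. (h y * k y e) * (h z * k z e))"
      by (intro Bochner_Integration.integral_cong refl) (simp add: F_def ac_simps)
    also have "\<dots> = (H e)\<^sup>2" by (simp add: H_def power2_eq_square)
    finally show ?case .
  qed
  have Hle: "ennreal \<bar>H e\<bar> \<le> X e" for e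
  proof (cases "X e < \<infinity>")
    case True
    have "ennreal (norm (H e)) \<le> (\<integral>\<^sup>+y. ennreal (norm (h y * k y e)) \<partial>lborel)"
      unfolding H_def by (rule integral_norm_bound_ennreal[OF H_int[OF True]])
    then show ?thesis using k0 by (simp add: X_def abs_mult)
  next
    case False
    then have "X e = \<top>" by (simp add: less_top[symmetric])
    then show ?thesis by simp
  qed
  have sH: "square_integrable lborel H"
    unfolding square_integrable_def
  proof
    have "(\<integral>\<^sup>+e. ennreal ((H e)\<^sup>2) \<partial>lborel) \<le> (\<integral>\<^sup>+e. X e * X e \<partial>lborel)"
    proof (rule nn_integral_mono)
      fix e
      have "ennreal ((H e)\<^sup>2) = ennreal \<bar>H e\<bar> * ennreal \<bar>H e\<bar>"
        by (simp add: ennreal_mult[symmetric] power2_eq_square)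
      also have "\<dots> \<le> X e * X e" by (intro mult_mono Hle) auto
      finally show "ennreal ((H e)\<^sup>2) \<le> X e * X e" .
    qed
    also note finX
    finally show "integrable lborel (\<lambda>e. (H e)\<^sup>2)" by (intro integrableI_nonneg) auto
  qed simp
  have H2: "(LINT e|lborel. (H e)\<^sup>2) = (LINT p|lborel. f p * (h (fst p) * h (snd p)))"
  proof -
    have m1: "(\<lambda>e. LINT p|lborel. F p e) \<in> borel_measurable lborel" unfolding F_def by measurable
    have m2: "(\<lambda>p. LINT e|lborel. F p e) \<in> borel_measurable lborel" unfolding F_def by measurable
    have "(LINT e|lborel. (H e)\<^sup>2) = (LINT e|lborel. LINT p|lborel. F p e)"
      by (rule integral_cong_AE) (use HF m1 in auto)
    also have "\<dots> = (LINT p|lborel. LINT e|lborel. F p e)"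
      using lborel_pair.Fubini_integral[OF iF] by simp
    also have "\<dots> = (LINT p|lborel. f p * (h (fst p) * h (snd p)))"
    proof (rule integral_cong_AE[OF m2])
      show "AE p in lborel. (LINT e|lborel. F p e) = f p * (h (fst p) * h (snd p))"
        using rep
      proof eventually_elim
        case (elim p)
        have "(LINT e|lborel. k (fst p) e * k (snd p) e) = enn2real (\<integral>\<^sup>+e. ennreal (k (fst p) e * k (snd p) e) \<partial>lborel)"
          using k0 by (intro integral_eq_nn_integral) auto
        then show ?case using elim f0 by (simp add: F_def mult.commute)
      qed
    qed measurable
    finally show ?thesis .
  qed
  have swap: "(LINT y|lborel. h y * (LINT e|lborel. k y e * \<Psi> e)) = (LINT e|lborel. H e * \<Psi> e)"
  proof -
    have m: "(\<lambda>(y, e). h y * k y e * \<Psi> e) \<in> borel_measurable (lborel \<Otimes>\<^sub>M lborel)"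
      unfolding case_prod_beta by measurable
    have m': "(\<lambda>(y, e). ennreal \<bar>h y * k y e * \<Psi> e\<bar>) \<in> borel_measurable (lborel \<Otimes>\<^sub>M lborel)"
      using m by (simp add: case_prod_beta)
    have i: "integrable (lborel \<Otimes>\<^sub>M lborel) (\<lambda>(y, e). h y * k y e * \<Psi> e)"
    proof (rule integrableI_bounded[OF m])
      have "(\<integral>\<^sup>+x. ennreal (norm (case x of (y, e) \<Rightarrow> h y * k y e * \<Psi> e)) \<partial>(lborel \<Otimes>\<^sub>M lborel)) = (\<integral>\<^sup>+y. \<integral>\<^sup>+e. ennreal \<bar>h y * k y e * \<Psi> e\<bar> \<partial>lborel \<partial>lborel)"
        using lborel.nn_integral_fst[OF m'] by (simp add: case_prod_unfold)
      also have "\<dots> = (\<integral>\<^sup>+e. \<integral>\<^sup>+y. ennreal \<bar>h y * k y e * \<Psi> e\<bar> \<partial>lborel \<partial>lborel)"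
        using lborel_pair.Fubini'[OF m'] by simp
      also have "\<dots> = (\<integral>\<^sup>+e. X e * ennreal \<bar>\<Psi> e\<bar> \<partial>lborel)"
      proof (rule nn_integral_cong)
        fix e
        have "(\<integral>\<^sup>+y. ennreal \<bar>h y * k y e * \<Psi> e\<bar> \<partial>lborel) = (\<integral>\<^sup>+y. ennreal (\<bar>h y\<bar> * k y e) * ennreal \<bar>\<Psi> e\<bar> \<partial>lborel)"
          using k0 by (intro nn_integral_cong) (simp add: abs_mult ennreal_mult)
        also have "\<dots> = X e * ennreal \<bar>\<Psi> e\<bar>" unfolding X_def by (rule nn_integral_multc) measurable
        finally show "(\<integral>\<^sup>+y. ennreal \<bar>h y * k y e * \<Psi> e\<bar> \<partial>lborel) = X e * ennreal \<bar>\<Psi> e\<bar>" .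
      qed
      also have "\<dots> \<le> (\<integral>\<^sup>+e. X e * X e + ennreal ((\<Psi> e)\<^sup>2) \<partial>lborel)"
      proof (rule nn_integral_mono)
        fix e
        have sq: "ennreal ((\<Psi> e)\<^sup>2) = ennreal \<bar>\<Psi> e\<bar> * ennreal \<bar>\<Psi> e\<bar>"
          by (simp add: ennreal_mult[symmetric] power2_eq_square)
        show "X e * ennreal \<bar>\<Psi> e\<bar> \<le> X e * X e + ennreal ((\<Psi> e)\<^sup>2)"
        \<comment> \<open>\<open>X e\<close> may be infinite, so instead of completing a square the
          larger of the two factors is squared.\<close>
        proof (cases "X e \<le> ennreal \<bar>\<Psi> e\<bar>")
          case True
          then have "X e * ennreal \<bar>\<Psi> e\<bar> \<le> ennreal ((\<Psi> e)\<^sup>2)" unfolding sq by (intro mult_right_mono) auto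
          then show ?thesis by (rule order_trans) simp
        next
          case False
          then have "X e * ennreal \<bar>\<Psi> e\<bar> \<le> X e * X e" by (intro mult_left_mono) auto
          then show ?thesis by (rule order_trans) simp
        qed
      qed
      also have "\<dots> = (\<integral>\<^sup>+e. X e * X e \<partial>lborel) + (\<integral>\<^sup>+e. ennreal ((\<Psi> e)\<^sup>2) \<partial>lborel)"
        by (rule nn_integral_add) auto
      also have "\<dots> < \<infinity>"
        using finX \<Psi> by (simp add: square_integrable_def integrable_iff_bounded)
      finally show "(\<integral>\<^sup>+x. ennreal (norm (case x of (y, e) \<Rightarrow> h y * k y e * \<Psi> e)) \<partial>(lborel \<Otimes>\<^sub>M lborel)) < \<infinity>" .
    qed
    have "(LINT y|lborel. h y * (LINT e|lborel. k y e * \<Psi> e)) = (LINT y|lborel. LINT e|lborel. h y * k y e * \<Psi> e)"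
      by (simp add: mult.assoc)
    also have "\<dots> = (LINT e|lborel. LINT y|lborel. h y * k y e * \<Psi> e)"
      using lborel_pair.Fubini_integral[OF i] by simp
    also have "\<dots> = (LINT e|lborel. H e * \<Psi> e)" by (simp add: H_def)
    finally show ?thesis .
  qed
  show "(LINT y|lborel. h y * (LINT e|lborel. k y e * \<Psi> e))\<^sup>2 \<le>
    (LINT e|lborel. (\<Psi> e)\<^sup>2) * (LINT p|lborel. f p * (h (fst p) * h (snd p)))"
    unfolding swap H2[symmetric] using square_integrable_cauchy_schwarz[OF sH \<Psi>] by (simp add: mult.commute)
  show "0 \<le> (LINT p|lborel. f p * (h (fst p) * h (snd p)))"
    unfolding H2[symmetric] by simp
qed

section \<open>Translation and rotation invariance of Lebesgue measure\<close>

lemma nn_integral_lborel_translate: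
  fixes g :: "'a::euclidean_space \<Rightarrow> ennreal"
  assumes [measurable]: "g \<in> borel_measurable borel"
  shows "(\<integral>\<^sup>+x. g (v + x) \<partial>lborel) = (\<integral>\<^sup>+x. g x \<partial>lborel)"
  by (subst (2) lborel_distr_plus[of v, symmetric]) (simp add: nn_integral_distr)

text \<open>The usual uniqueness argument for Haar measure: the image of Lebesgue measure is translation invariant
  and agrees with it on the unit ball.\<close>

lemma lborel_distr_orthogonal:
  fixes T :: "'a::euclidean_space \<Rightarrow> 'a"
  assumes T: "orthogonal_transformation T"
  shows "distr lborel borel T = lborel"
proof (rule measure_eqI)
  let ?\<mu> = "distr lborel borel T"
  have lin: "linear T" using T by (rule orthogonal_transformation_linear)
  have Tn: "norm (T x) = norm x" for x using T by (rule orthogonal_transformation_norm)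
  have Tm[measurable]: "T \<in> borel \<rightarrow>\<^sub>M borel"
    by (intro borel_measurable_continuous_onI linear_continuous_on linear_linear[THEN iffD2] lin)
  show "sets ?\<mu> = sets lborel" by simp
  fix A assume "A \<in> sets ?\<mu>"
  then have A[measurable]: "A \<in> sets borel" by simp
  let ?B = "cball 0 1 :: 'a set"
  have B[measurable]: "?B \<in> sets borel" by simp
  have trans: "(\<integral>\<^sup>+w. g (w + y) \<partial>lborel) = (\<integral>\<^sup>+w. g w \<partial>lborel)" if "g \<in> borel_measurable borel" for g :: "'a \<Rightarrow> ennreal" and y
    using nn_integral_lborel_translate[OF that, of y] by (simp add: add.commute)
  have neg: "(\<integral>\<^sup>+w. g (- w) \<partial>lborel) = (\<integral>\<^sup>+w. g w \<partial>lborel)" if [measurable]: "g \<in> borel_measurable borel" for g :: "'a \<Rightarrow> ennreal"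
  proof -
    have d: "lborel = distr lborel borel (\<lambda>x :: 'a. - x)" using lborel_affine[of "-1" "0 :: 'a"] by (simp add: density_1)
    show ?thesis by (subst (2) d) (simp add: nn_integral_distr)
  qed
  have \<mu>: "(\<integral>\<^sup>+w. g w \<partial>?\<mu>) = (\<integral>\<^sup>+w. g (T w) \<partial>lborel)" if "g \<in> borel_measurable borel" for g :: "'a \<Rightarrow> ennreal"
    using that by (simp add: nn_integral_distr)
  \<comment> \<open>\<open>T\<close> is onto, so a shift of \<open>T w\<close> is the image of a
    shift of \<open>w\<close>: the image measure is translation invariant.\<close>
  have \<mu>trans: "(\<integral>\<^sup>+w. g (T w - y) \<partial>lborel) = (\<integral>\<^sup>+w. g (T w) \<partial>lborel)" if [measurable]: "g \<in> borel_measurable borel" for g :: "'a \<Rightarrow> ennreal" and y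
  proof -
    have "surj T" using T by (rule orthogonal_transformation_surj)
    then obtain y' where y: "y = T y'" by blast
    have "T w - y = T (w + (- y'))" for w using lin by (simp add: y linear_diff)
    then show ?thesis using trans[of "\<lambda>w. g (T w)" "- y'"] by simp
  qed
  \<comment> \<open>The product is rewritten as a double integral; the shifts y to y + T w and then
    T w to T w - y, with Fubini in between, move \<open>A\<close> from Lebesgue measure to the image
    measure and the unit ball the other way.\<close>
  have "(\<integral>\<^sup>+y. indicator A y \<partial>lborel) * (\<integral>\<^sup>+w. indicator ?B (T w) \<partial>lborel) =
    (\<integral>\<^sup>+w. \<integral>\<^sup>+y. indicator A y * indicator ?B (T w) \<partial>lborel \<partial>lborel)"
  proof -
    have "(\<integral>\<^sup>+y. indicator A y * indicator ?B (T w) \<partial>lborel) = emeasure lborel A * indicator ?B (T w)" for w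
      by (simp add: nn_integral_multc)
    moreover have "(\<lambda>w. indicator ?B (T w) :: ennreal) \<in> borel_measurable lborel" by measurable
    ultimately show ?thesis by (simp add: nn_integral_cmult)
  qed
  also have "\<dots> = (\<integral>\<^sup>+w. \<integral>\<^sup>+y. indicator A (y + T w) * indicator ?B (T w) \<partial>lborel \<partial>lborel)"
  proof (rule nn_integral_cong)
    fix w
    show "(\<integral>\<^sup>+y. indicator A y * indicator ?B (T w) \<partial>lborel) = (\<integral>\<^sup>+y. indicator A (y + T w) * indicator ?B (T w) \<partial>lborel :: ennreal)"
      using trans[of "\<lambda>y. indicator A y * indicator ?B (T w)" "T w"] by simp
  qed
  also have "\<dots> = (\<integral>\<^sup>+y. \<integral>\<^sup>+w. indicator A (y + T w) * indicator ?B (T w) \<partial>lborel \<partial>lborel)"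
    by (rule lborel_pair.Fubini'[symmetric]) measurable
  also have "\<dots> = (\<integral>\<^sup>+y. \<integral>\<^sup>+w. indicator A (T w) * indicator ?B (T w - y) \<partial>lborel \<partial>lborel)"
  proof (rule nn_integral_cong)
    fix y
    show "(\<integral>\<^sup>+w. indicator A (y + T w) * indicator ?B (T w) \<partial>lborel) = (\<integral>\<^sup>+w. indicator A (T w) * indicator ?B (T w - y) \<partial>lborel :: ennreal)"
      using \<mu>trans[of "\<lambda>v. indicator A (y + v) * indicator ?B v" y] by simp
  qed
  also have "\<dots> = (\<integral>\<^sup>+w. \<integral>\<^sup>+y. indicator A (T w) * indicator ?B (T w - y) \<partial>lborel \<partial>lborel)"
    by (rule lborel_pair.Fubini') measurable
  also have "\<dots> = (\<integral>\<^sup>+w. indicator A (T w) * emeasure lborel ?B \<partial>lborel)"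
  proof (rule nn_integral_cong)
    fix w
    have "(\<integral>\<^sup>+y. indicator ?B (T w - y) \<partial>lborel) = (\<integral>\<^sup>+y. indicator ?B (y + T w) \<partial>lborel :: ennreal)"
      using neg[of "\<lambda>y. indicator ?B (y + T w)"] by (simp add: add.commute)
    also have "\<dots> = emeasure lborel ?B" using trans[of "indicator ?B" "T w"] by simp
    finally show "(\<integral>\<^sup>+y. indicator A (T w) * indicator ?B (T w - y) \<partial>lborel) = indicator A (T w) * emeasure lborel ?B"
      by (simp add: nn_integral_cmult)
  qed
  also have "\<dots> = (\<integral>\<^sup>+w. indicator A (T w) \<partial>lborel) * emeasure lborel ?B" by (rule nn_integral_multc) measurable
  \<comment> \<open>\<open>T\<close> preserves the norm, so the ball has the same mass under both
    measures; this fixes the proportionality factor at 1.\<close>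
  also have "(\<integral>\<^sup>+w. indicator ?B (T w) \<partial>lborel) = emeasure lborel ?B"
  proof -
    have "(indicator ?B (T w) :: ennreal) = indicator ?B w" for w using Tn[of w] by (simp split: split_indicator)
    then show ?thesis by simp
  qed
  finally have eq: "emeasure lborel A * emeasure lborel ?B = (\<integral>\<^sup>+w. indicator A (T w) \<partial>lborel) * emeasure lborel ?B" by simp
  have "emeasure lborel ?B \<noteq> 0" "emeasure lborel ?B \<noteq> \<top>"
    using less_imp_neq[OF unit_ball_vol_pos[of "real DIM('a)"], symmetric] by (simp_all add: emeasure_cball)
  then have "emeasure lborel A = (\<integral>\<^sup>+w. indicator A (T w) \<partial>lborel)"
    using eq by (metis ennreal_mult_right_cong mult.commute ennreal_mult_cancel_left)
  then show "emeasure ?\<mu> A = emeasure lborel A" using \<mu>[of "indicator A"] by simp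
qed

text \<open>The index e = (\<rho>, w) is a ball of radius \<rho> centred at w. Squaring the weight
  gives \<rho>^-(N + \<beta> + 1); the volume of admissible centres is of order \<rho>^N, and
  integrating the remaining \<rho>^(-1 - \<beta>) from order |x| to infinity gives
  |x|^-\<beta>.\<close>

definition ball_kernel :: "real \<Rightarrow> real ^ 'n \<Rightarrow> real \<times> (real ^ 'n) \<Rightarrow> real" where
  "ball_kernel \<beta> y = (\<lambda>(\<rho>, w). if norm (y - w) < \<rho> then \<rho> powr (- (real CARD('n) + \<beta> + 1) / 2) else 0)"

definition ball_overlap :: "real \<Rightarrow> real ^ 'n \<Rightarrow> ennreal" where
  "ball_overlap \<beta> x = (\<integral>\<^sup>+e. ennreal (ball_kernel \<beta> 0 e * ball_kernel \<beta> x e) \<partial>lborel)"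

lemma ball_kernel_nonneg [simp]: "0 \<le> ball_kernel \<beta> y e"
  by (simp add: ball_kernel_def split: prod.split)

lemma ball_kernel_measurable:
  "(\<lambda>(y, e). ball_kernel \<beta> y e) \<in> borel_measurable (borel :: ((real ^ 'n) \<times> real \<times> (real ^ 'n)) measure)"
proof -
  have "(\<lambda>x :: (real ^ 'n) \<times> real \<times> (real ^ 'n). if norm (fst x - snd (snd x)) < fst (snd x) then fst (snd x) powr (- (real CARD('n) + \<beta> + 1) / 2) else 0)
    \<in> borel_measurable (borel \<Otimes>\<^sub>M (borel \<Otimes>\<^sub>M borel))"
    by measurable
  then show ?thesis by (simp add: borel_prod ball_kernel_def case_prod_beta cong: if_cong)
qed

lemma ball_kernel_measurable_compose [measurable (raw)]:
  assumes "f \<in> N \<rightarrow>\<^sub>M (borel :: (real ^ 'n) measure)" "g \<in> N \<rightarrow>\<^sub>M borel"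
  shows "(\<lambda>x. ball_kernel \<beta> (f x) (g x)) \<in> borel_measurable N"
proof -
  have "(\<lambda>x. (f x, g x)) \<in> N \<rightarrow>\<^sub>M borel" using assms by (simp add: borel_prod[symmetric])
  from measurable_compose[OF this ball_kernel_measurable] show ?thesis by simp
qed

lemma ball_kernel_shift: "ball_kernel \<beta> (v + y) (\<rho>, v + w) = ball_kernel \<beta> y (\<rho>, w)"
  by (simp add: ball_kernel_def)

lemma ball_overlap_translate:
  "(\<integral>\<^sup>+e. ennreal (ball_kernel \<beta> y e * ball_kernel \<beta> z e) \<partial>lborel) = ball_overlap \<beta> (z - y)"
proof -
  have "(\<integral>\<^sup>+e. ennreal (ball_kernel \<beta> y e * ball_kernel \<beta> z e) \<partial>lborel) =
    (\<integral>\<^sup>+e. ennreal (ball_kernel \<beta> y ((0, y) + e) * ball_kernel \<beta> z ((0, y) + e)) \<partial>lborel)"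
    by (rule nn_integral_lborel_translate[symmetric]) measurable
  also have "\<dots> = ball_overlap \<beta> (z - y)"
    unfolding ball_overlap_def
  proof (intro nn_integral_cong, clarify)
    fix \<rho> w
    show "ennreal (ball_kernel \<beta> y ((0, y) + (\<rho>, w)) * ball_kernel \<beta> z ((0, y) + (\<rho>, w))) =
      ennreal (ball_kernel \<beta> 0 (\<rho>, w) * ball_kernel \<beta> (z - y) (\<rho>, w))"
      using ball_kernel_shift[of \<beta> y 0 \<rho> w] ball_kernel_shift[of \<beta> y "z - y" \<rho> w] by simp
  qed
  finally show ?thesis .
qed

lemma ball_kernel_scale:
  fixes y w :: "real ^ 'n"
  assumes "0 < c"
  shows "ball_kernel \<beta> (c *\<^sub>R y) (c * \<rho>, c *\<^sub>R w) = c powr (- (real CARD('n) + \<beta> + 1) / 2) * ball_kernel \<beta> y (\<rho>, w)"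
proof -
  have "norm (c *\<^sub>R y - c *\<^sub>R w) = c * norm (y - w)"
    using assms by (simp flip: scaleR_diff_right)
  moreover have "0 < \<rho>" if "norm (y - w) < \<rho>" using that norm_ge_zero[of "y - w"] by linarith
  ultimately show ?thesis using assms by (auto simp: ball_kernel_def powr_mult)
qed

text \<open>Scaling radius and centre together gives c^(N + 1) from the volume element and c^-(N +
  \<beta> + 1) from the two kernels.\<close>

lemma ball_overlap_scale:
  fixes x :: "real ^ 'n"
  assumes c: "0 < c"
  shows "ball_overlap \<beta> (c *\<^sub>R x) = ennreal (c powr - \<beta>) * ball_overlap \<beta> x"
proof -
  let ?g = "- (real CARD('n) + \<beta> + 1) / 2"
  have l: "(lborel :: (real \<times> (real ^ 'n)) measure) = density (distr lborel borel (\<lambda>e. c *\<^sub>R e)) (\<lambda>_. ennreal (c ^ (CARD('n) + 1)))"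
  proof -
    have "DIM(real \<times> (real ^ 'n)) = CARD('n) + 1" by simp
    then show ?thesis using lborel_affine[of c "0 :: real \<times> (real ^ 'n)"] c by (simp only: add_0) simp
  qed
  have "ball_overlap \<beta> (c *\<^sub>R x) = (\<integral>\<^sup>+e. ennreal (c ^ (CARD('n) + 1)) * ennreal (ball_kernel \<beta> 0 (c *\<^sub>R e) * ball_kernel \<beta> (c *\<^sub>R x) (c *\<^sub>R e)) \<partial>lborel)"
    unfolding ball_overlap_def by (subst l) (simp add: nn_integral_density nn_integral_distr case_prod_beta)
  also have "\<dots> = (\<integral>\<^sup>+e. ennreal (c powr - \<beta>) * ennreal (ball_kernel \<beta> 0 e * ball_kernel \<beta> x e) \<partial>lborel)"
  proof (rule nn_integral_cong, clarify)
    fix \<rho> :: real and w :: "real ^ 'n"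
    have p: "c ^ (CARD('n) + 1) * (c powr ?g * c powr ?g) = c powr - \<beta>"
    proof -
      have "c powr ?g * c powr ?g = c powr - (real CARD('n) + \<beta> + 1)"
        unfolding powr_add[symmetric] by (rule arg_cong[where f = "\<lambda>a. c powr a"]) (simp add: field_simps)
      moreover have "c ^ (CARD('n) + 1) = c powr real (CARD('n) + 1)" by (rule powr_realpow[OF c, symmetric])
      ultimately show ?thesis by (simp add: powr_add[symmetric] del: power_Suc)
    qed
    have "ball_kernel \<beta> 0 (c *\<^sub>R (\<rho>, w)) = c powr ?g * ball_kernel \<beta> 0 (\<rho>, w)"
      "ball_kernel \<beta> (c *\<^sub>R x) (c *\<^sub>R (\<rho>, w)) = c powr ?g * ball_kernel \<beta> x (\<rho>, w)"
      using ball_kernel_scale[OF c, of \<beta> 0 \<rho> w] ball_kernel_scale[OF c, of \<beta> x \<rho> w] by simp_all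
    then have "c ^ (CARD('n) + 1) * (ball_kernel \<beta> 0 (c *\<^sub>R (\<rho>, w)) * ball_kernel \<beta> (c *\<^sub>R x) (c *\<^sub>R (\<rho>, w))) =
      (c ^ (CARD('n) + 1) * (c powr ?g * c powr ?g)) * (ball_kernel \<beta> 0 (\<rho>, w) * ball_kernel \<beta> x (\<rho>, w))"
      by (simp only: ac_simps)
    then show "ennreal (c ^ (CARD('n) + 1)) * ennreal (ball_kernel \<beta> 0 (c *\<^sub>R (\<rho>, w)) * ball_kernel \<beta> (c *\<^sub>R x) (c *\<^sub>R (\<rho>, w))) =
      ennreal (c powr - \<beta>) * ennreal (ball_kernel \<beta> 0 (\<rho>, w) * ball_kernel \<beta> x (\<rho>, w))"
      using c unfolding p by (simp only: ennreal_mult[symmetric] zero_le_power less_imp_le mult_nonneg_nonneg ball_kernel_nonneg powr_ge_zero)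
  qed
  also have "\<dots> = ennreal (c powr - \<beta>) * ball_overlap \<beta> x"
    unfolding ball_overlap_def by (rule nn_integral_cmult) measurable
  finally show ?thesis .
qed

text \<open>With the radius frozen by Tonelli, only the centres are rotated, and Lebesgue measure is
  invariant under that.\<close>

lemma ball_overlap_rotate:
  fixes T :: "real ^ 'n \<Rightarrow> real ^ 'n"
  assumes T: "orthogonal_transformation T"
  shows "ball_overlap \<beta> (T x) = ball_overlap \<beta> x"
proof -
  have lin: "linear T" using T by (rule orthogonal_transformation_linear)
  have Tm[measurable]: "T \<in> borel \<rightarrow>\<^sub>M borel"
    by (intro borel_measurable_continuous_onI linear_continuous_on linear_linear[THEN iffD2] lin)
  have n: "norm (T y - T w) = norm (y - w)" for y w
    using T lin by (simp flip: linear_diff add: orthogonal_transformation_norm)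
  have nn: "ball_overlap \<beta> x = (\<integral>\<^sup>+\<rho>. \<integral>\<^sup>+w. ennreal (ball_kernel \<beta> 0 (\<rho>, w) * ball_kernel \<beta> x (\<rho>, w)) \<partial>lborel \<partial>lborel)" for x
  proof -
    have "(\<lambda>e. ennreal (ball_kernel \<beta> 0 e * ball_kernel \<beta> x e)) \<in> borel_measurable (lborel \<Otimes>\<^sub>M lborel)"
      by (simp add: lborel_prod)
    from lborel.nn_integral_fst[OF this] show ?thesis by (simp add: ball_overlap_def lborel_prod)
  qed
  have "(\<integral>\<^sup>+w. ennreal (ball_kernel \<beta> 0 (\<rho>, w) * ball_kernel \<beta> (T x) (\<rho>, w)) \<partial>lborel) =
    (\<integral>\<^sup>+w. ennreal (ball_kernel \<beta> 0 (\<rho>, w) * ball_kernel \<beta> x (\<rho>, w)) \<partial>lborel)" for \<rho>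
  proof -
    have "(\<integral>\<^sup>+w. ennreal (ball_kernel \<beta> 0 (\<rho>, w) * ball_kernel \<beta> (T x) (\<rho>, w)) \<partial>lborel) =
      (\<integral>\<^sup>+w. ennreal (ball_kernel \<beta> 0 (\<rho>, T w) * ball_kernel \<beta> (T x) (\<rho>, T w)) \<partial>lborel)"
      by (subst lborel_distr_orthogonal[OF T, symmetric]) (simp add: nn_integral_distr)
    also have "\<dots> = (\<integral>\<^sup>+w. ennreal (ball_kernel \<beta> 0 (\<rho>, w) * ball_kernel \<beta> x (\<rho>, w)) \<partial>lborel)"
      using n[of 0] n[of x] lin by (intro nn_integral_cong) (simp add: ball_kernel_def linear_0)
    finally show ?thesis .
  qed
  then show ?thesis unfolding nn by simp
qed

lemma nn_integral_powr_to_inf: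
  assumes "a < - 1" "0 < R"
  shows "(\<integral>\<^sup>+\<rho>. ennreal (\<rho> powr a) * indicator {R..} \<rho> \<partial>lborel) = ennreal (- (R powr (a + 1)) / (a + 1))"
proof -
  have "((\<lambda>x. x powr a) has_integral - (R powr (a + 1)) / (a + 1)) {R..}"
    using has_integral_powr_to_inf[OF assms] .
  then have "((\<lambda>x. if x \<in> {R..} then x powr a else 0) has_integral - (R powr (a + 1)) / (a + 1)) UNIV"
    by (simp only: has_integral_restrict_UNIV)
  then have "(\<integral>\<^sup>+x. ennreal (if x \<in> {R..} then x powr a else 0) \<partial>lborel) = ennreal (- (R powr (a + 1)) / (a + 1))"
    by (intro nn_integral_has_integral_lborel) auto
  moreover have "(\<integral>\<^sup>+x. ennreal (if x \<in> {R..} then x powr a else 0) \<partial>lborel) = (\<integral>\<^sup>+\<rho>. ennreal (\<rho> powr a) * indicator {R..} \<rho> \<partial>lborel)"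
    by (intro nn_integral_cong) (simp split: split_indicator)
  ultimately show ?thesis by (simp only:)
qed

lemma nn_integral_powr_from_0:
  assumes "- 1 < a" "0 \<le> R"
  shows "(\<integral>\<^sup>+\<rho>. ennreal (\<rho> powr a) * indicator {0..R} \<rho> \<partial>lborel) = ennreal (R powr (a + 1) / (a + 1))"
proof -
  have "((\<lambda>x. x powr a) has_integral (R powr (a + 1) / (a + 1))) {0..R}"
    using has_integral_powr_from_0[OF assms] .
  then have "((\<lambda>x. if x \<in> {0..R} then x powr a else 0) has_integral (R powr (a + 1) / (a + 1))) UNIV"
    by (simp only: has_integral_restrict_UNIV)
  then have "(\<integral>\<^sup>+x. ennreal (if x \<in> {0..R} then x powr a else 0) \<partial>lborel) = ennreal (R powr (a + 1) / (a + 1))"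
    by (intro nn_integral_has_integral_lborel) auto
  moreover have "(\<integral>\<^sup>+x. ennreal (if x \<in> {0..R} then x powr a else 0) \<partial>lborel) = (\<integral>\<^sup>+\<rho>. ennreal (\<rho> powr a) * indicator {0..R} \<rho> \<partial>lborel)"
    by (intro nn_integral_cong) (simp split: split_indicator)
  ultimately show ?thesis by simp
qed

text \<open>A ball containing both 0 and x has radius above |x|/2, and its centre ranges over volume
  at most V \<rho>^N. What remains is \<rho>^(-1 - \<beta>), integrable at infinity because \<beta>
  is positive.\<close>

lemma ball_overlap_finite:
  fixes x :: "real ^ 'n"
  assumes b: "0 < \<beta>" and x: "x \<noteq> 0"
  shows "ball_overlap \<beta> x < \<infinity>"
proof -
  let ?g = "- (real CARD('n) + \<beta> + 1)" and ?V = "unit_ball_vol (real CARD('n))"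
  let ?R = "norm x / 2"
  have R: "0 < ?R" using x by simp
  have "ball_overlap \<beta> x = (\<integral>\<^sup>+\<rho>. \<integral>\<^sup>+w. ennreal (ball_kernel \<beta> 0 (\<rho>, w) * ball_kernel \<beta> x (\<rho>, w)) \<partial>lborel \<partial>lborel)"
  proof -
    have "(\<lambda>e. ennreal (ball_kernel \<beta> 0 e * ball_kernel \<beta> x e)) \<in> borel_measurable (lborel \<Otimes>\<^sub>M lborel)"
      by (simp add: lborel_prod)
    from lborel.nn_integral_fst[OF this] show ?thesis by (simp add: ball_overlap_def lborel_prod)
  qed
  also have "\<dots> \<le> (\<integral>\<^sup>+\<rho>. ennreal ?V * (ennreal (\<rho> powr (- 1 - \<beta>)) * indicator {?R..} \<rho>) \<partial>lborel)"
  proof (rule nn_integral_mono)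
    fix \<rho> :: real
    show "(\<integral>\<^sup>+w. ennreal (ball_kernel \<beta> 0 (\<rho>, w) * ball_kernel \<beta> x (\<rho>, w)) \<partial>lborel) \<le> ennreal ?V * (ennreal (\<rho> powr (- 1 - \<beta>)) * indicator {?R..} \<rho>)"
    proof (cases "?R \<le> \<rho>")
      case True
      then have rho: "0 < \<rho>" using R by linarith
      have "(\<integral>\<^sup>+w. ennreal (ball_kernel \<beta> 0 (\<rho>, w) * ball_kernel \<beta> x (\<rho>, w)) \<partial>lborel) \<le> (\<integral>\<^sup>+w. ennreal (\<rho> powr ?g) * indicator (cball (0 :: real ^ 'n) \<rho>) w \<partial>lborel)"
      proof (rule nn_integral_mono)
        fix w :: "real ^ 'n"
        have "\<rho> powr (?g / 2) * \<rho> powr (?g / 2) = \<rho> powr ?g"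
          unfolding powr_add[symmetric] by (rule arg_cong[where f = "\<lambda>a. \<rho> powr a"]) (simp add: field_simps)
        then show "ennreal (ball_kernel \<beta> 0 (\<rho>, w) * ball_kernel \<beta> x (\<rho>, w)) \<le> ennreal (\<rho> powr ?g) * indicator (cball 0 \<rho>) w"
          by (auto simp: ball_kernel_def split: split_indicator)
      qed
      also have "\<dots> = ennreal (\<rho> powr ?g) * emeasure lborel (cball 0 \<rho> :: (real ^ 'n) set)"
        by (rule nn_integral_cmult_indicator) simp
      also have "\<dots> = ennreal (\<rho> powr ?g * (?V * \<rho> ^ CARD('n)))" using rho by (simp add: emeasure_cball ennreal_mult)
      also have "\<rho> powr ?g * (?V * \<rho> ^ CARD('n)) = ?V * \<rho> powr (- 1 - \<beta>)"
        using rho by (simp add: powr_add[symmetric] minus_diff_commute flip: powr_realpow)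
      finally show ?thesis using True by (simp add: ennreal_mult)
    next
      case False
      have "ball_kernel \<beta> 0 (\<rho>, w) * ball_kernel \<beta> x (\<rho>, w) = 0" for w
      proof (rule ccontr)
        assume "ball_kernel \<beta> 0 (\<rho>, w) * ball_kernel \<beta> x (\<rho>, w) \<noteq> 0"
        then have "norm w < \<rho>" "norm (x - w) < \<rho>" by (auto simp: ball_kernel_def split: if_splits)
        then have "norm x < 2 * \<rho>" using norm_triangle_ineq[of "x - w" w] by simp
        then show False using False by simp
      qed
      then have "(\<integral>\<^sup>+w. ennreal (ball_kernel \<beta> 0 (\<rho>, w) * ball_kernel \<beta> x (\<rho>, w)) \<partial>lborel) = 0" by (simp only: ennreal_0 nn_integral_const mult_zero_left)
      then show ?thesis by (simp only: zero_le)
    qed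
  qed
  also have "\<dots> = ennreal ?V * (\<integral>\<^sup>+\<rho>. ennreal (\<rho> powr (- 1 - \<beta>)) * indicator {?R..} \<rho> \<partial>lborel)"
    by (rule nn_integral_cmult) measurable
  also have "\<dots> < \<infinity>"
    using nn_integral_powr_to_inf[of "- 1 - \<beta>", OF _ R] b by (simp add: ennreal_mult_less_top)
  finally show ?thesis .
qed

lemma ball_overlap_pos:
  fixes x :: "real ^ 'n"
  shows "0 < ball_overlap \<beta> x"
proof -
  let ?g = "- (real CARD('n) + \<beta> + 1) / 2"
  \<comment> \<open>Balls of these radii with centre within 1 of the origin contain both 0 and x,
    and they form a set of positive measure.\<close>
  let ?A = "{norm x + 1 <..< norm x + 2} \<times> ball (0 :: real ^ 'n) 1"
  have "emeasure lborel ?A = emeasure lborel {norm x + 1 <..< norm x + 2} * emeasure lborel (ball (0 :: real ^ 'n) 1)"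
    unfolding lborel_prod[symmetric] by (rule lborel.emeasure_pair_measure_Times) auto
  then have A: "emeasure lborel ?A \<noteq> 0"
    using less_imp_neq[OF unit_ball_vol_pos[of "real CARD('n)"], symmetric] by (simp add: emeasure_ball)
  have "ball_overlap \<beta> x \<noteq> 0"
  proof
    assume "ball_overlap \<beta> x = 0"
    then have "AE e in lborel. ennreal (ball_kernel \<beta> 0 e * ball_kernel \<beta> x e) = 0"
      unfolding ball_overlap_def by (subst (asm) nn_integral_0_iff_AE) auto
    then have "AE e in lborel. e \<notin> ?A"
    proof eventually_elim
      case (elim e)
      obtain \<rho> w where e: "e = (\<rho>, w)" by (cases e)
      show ?case
      proof
        assume "e \<in> ?A"
        then have "norm w < 1" "norm x + 1 < \<rho>" by (auto simp: e)
        moreover have "norm (x - w) \<le> norm x + norm w" by (rule norm_triangle_ineq4)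
        ultimately have "norm w < \<rho>" "norm (x - w) < \<rho>" "0 < \<rho>" using norm_ge_zero[of x] by linarith+
        then have "0 < ball_kernel \<beta> 0 e * ball_kernel \<beta> x e" by (simp add: ball_kernel_def e)
        then have "0 < ennreal (ball_kernel \<beta> 0 e * ball_kernel \<beta> x e)" by (simp only: ennreal_less_zero_iff)
        then show False using elim by simp
      qed
    qed
    moreover have "?A \<in> sets lborel" by (auto intro!: borel_open open_Times)
    ultimately have "emeasure lborel ?A = 0" by (subst (asm) AE_iff_measurable[of ?A]) auto
    then show False using A by simp
  qed
  then show ?thesis by (simp add: zero_less_iff_neq_zero)
qed

text \<open>The Riesz kernel is a superposition of indicator products of balls. By scaling and rotation the overlap
  integral is homogeneous and radial, hence a multiple of the kernel.\<close>

lemma ball_kernel_represents: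
  assumes b: "0 < \<beta>"
  shows "\<exists>A>0. \<forall>y z :: real ^ 'n. y \<noteq> z \<longrightarrow>
    (\<integral>\<^sup>+e. ennreal (ball_kernel \<beta> y e * ball_kernel \<beta> z e) \<partial>lborel) = ennreal (A * norm (y - z) powr - \<beta>)"
proof -
  define e0 where "e0 = (axis undefined 1 :: real ^ 'n)"
  have e0: "norm e0 = 1" by (simp add: e0_def)
  have "e0 \<noteq> 0" using e0 by auto
  then have fin: "ball_overlap \<beta> e0 < \<infinity>" by (rule ball_overlap_finite[OF b])
  define A where "A = enn2real (ball_overlap \<beta> e0)"
  have A: "ball_overlap \<beta> e0 = ennreal A" using fin by (simp add: A_def)
  have A0: "0 < A" using ball_overlap_pos[of \<beta> e0] unfolding A by simp
  have "(\<integral>\<^sup>+e. ennreal (ball_kernel \<beta> y e * ball_kernel \<beta> z e) \<partial>lborel) = ennreal (A * norm (y - z) powr - \<beta>)"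
    if yz: "y \<noteq> z" for y z :: "real ^ 'n"
  proof -
    define r where "r = norm (z - y)"
    have r: "0 < r" using yz by (simp add: r_def)
    have "norm (r *\<^sub>R e0) = norm (z - y)" using e0 by (simp add: r_def)
    then obtain T where T: "orthogonal_transformation T" "T (r *\<^sub>R e0) = z - y"
      by (rule orthogonal_transformation_exists)
    have "ball_overlap \<beta> (z - y) = ball_overlap \<beta> (r *\<^sub>R e0)"
      unfolding T(2)[symmetric] by (rule ball_overlap_rotate[OF T(1)])
    also have "\<dots> = ennreal (r powr - \<beta>) * ennreal A" by (simp add: ball_overlap_scale[OF r] A)
    also have "\<dots> = ennreal (A * norm (y - z) powr - \<beta>)"
      using A0 by (simp add: ennreal_mult[symmetric] r_def norm_minus_commute mult.commute)
    finally show ?thesis by (simp add: ball_overlap_translate)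
  qed
  then show ?thesis using A0 by blast
qed

section \<open>Coloured noise\<close>

lemma AE_off_diagonal: "AE p in lborel. fst p \<noteq> (snd p :: 'a::euclidean_space)"
proof -
  have "AE p in lborel \<Otimes>\<^sub>M lborel. fst p \<noteq> (snd p :: 'a)"
  proof (rule lborel_pair.AE_pair_measure)
    have "{p :: 'a \<times> 'a. fst p = snd p} \<in> sets borel" by (intro borel_closed closed_Collect_eq continuous_intros)
    then have "- {p :: 'a \<times> 'a. fst p = snd p} \<in> sets borel" by (rule borel_comp)
    moreover have "{p \<in> space (lborel \<Otimes>\<^sub>M lborel). fst p \<noteq> (snd p :: 'a)} = - {p. fst p = snd p}"
      by (auto simp: space_pair_measure)
    ultimately show "{p \<in> space (lborel \<Otimes>\<^sub>M lborel). fst p \<noteq> (snd p :: 'a)} \<in> sets (lborel \<Otimes>\<^sub>M lborel)"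
      by (simp only: lborel_prod sets_lborel)
    show "AE x in lborel. AE y in lborel. fst (x, y) \<noteq> (snd (x, y) :: 'a)"
    proof (rule AE_I2)
      fix x :: 'a
      show "AE y in lborel. fst (x, y) \<noteq> (snd (x, y) :: 'a)"
        using AE_lborel_singleton[of x] by eventually_elim auto
    qed
  qed
  then show ?thesis unfolding lborel_prod .
qed

text \<open>Layer-cake formula: |v|^-\<beta> is \<beta> times the integral of \<rho>^(-\<beta> - 1)
  over \<rho> from |v| to infinity. Exchanging the integrals leaves volumes of balls.\<close>

lemma riesz_kernel_locally_integrable:
  assumes b: "0 < \<beta>" "\<beta> < real CARD('n)" and R: "0 < R"
  shows "(\<integral>\<^sup>+v. ennreal (norm (v :: real ^ 'n) powr - \<beta>) * indicator (cball 0 R) v \<partial>lborel) < \<infinity>"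
proof -
  let ?V = "unit_ball_vol (real CARD('n))" and ?N = "CARD('n)"
  let ?f = "\<lambda>(v :: real ^ 'n) \<rho>. ennreal \<beta> * (ennreal (\<rho> powr (- \<beta> - 1)) * indicator {norm v..} \<rho>) * indicator (cball 0 R) v"
  have m: "(\<lambda>(v, \<rho>). ?f v \<rho>) \<in> borel_measurable (lborel \<Otimes>\<^sub>M lborel)"
  proof -
    have eq: "(indicator {norm v..} \<rho> :: ennreal) = (if norm v \<le> \<rho> then 1 else 0)" for v :: "real ^ 'n" and \<rho> by simp
    have eq2: "(indicator (cball 0 R) v :: ennreal) = (if norm v \<le> R then 1 else 0)" for v :: "real ^ 'n" by simp
    show ?thesis unfolding eq eq2 case_prod_beta by measurable
  qed
  have "(\<integral>\<^sup>+v. ennreal (norm (v :: real ^ 'n) powr - \<beta>) * indicator (cball 0 R) v \<partial>lborel) = (\<integral>\<^sup>+v. \<integral>\<^sup>+\<rho>. ?f v \<rho> \<partial>lborel \<partial>lborel)"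
  proof (rule nn_integral_cong_AE)
    show "AE v :: real ^ 'n in lborel. ennreal (norm v powr - \<beta>) * indicator (cball 0 R) v = (\<integral>\<^sup>+\<rho>. ?f v \<rho> \<partial>lborel)"
      using AE_lborel_singleton[of "0 :: real ^ 'n"]
    proof eventually_elim
      case (elim v)
      then have v: "0 < norm v" by simp
      have "(\<integral>\<^sup>+\<rho>. ?f v \<rho> \<partial>lborel) = ennreal \<beta> * ennreal (- (norm v powr (- \<beta> - 1 + 1)) / (- \<beta> - 1 + 1)) * indicator (cball 0 R) v"
        using nn_integral_powr_to_inf[of "- \<beta> - 1", OF _ v] b by (simp add: nn_integral_multc nn_integral_cmult)
      also have "ennreal \<beta> * ennreal (- (norm v powr (- \<beta> - 1 + 1)) / (- \<beta> - 1 + 1)) = ennreal (norm v powr - \<beta>)"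
        using b by (simp add: ennreal_mult[symmetric])
      finally show ?case by simp
    qed
  qed
  also have "\<dots> = (\<integral>\<^sup>+\<rho>. \<integral>\<^sup>+v. ?f v \<rho> \<partial>lborel \<partial>lborel)"
    using lborel_pair.Fubini'[OF m] by simp
  \<comment> \<open>The ball has radius min(\<rho>, R). Below R the integrand is a multiple of
    \<rho>^(N - \<beta> - 1), integrable at 0 since \<beta> < N; above R the volume is fixed and 0 <
    \<beta> gives convergence at infinity.\<close>
  also have "\<dots> \<le> (\<integral>\<^sup>+\<rho>. ennreal (\<beta> * ?V) * (ennreal (\<rho> powr (real ?N - \<beta> - 1)) * indicator {0..R} \<rho>) +
    ennreal (\<beta> * ?V * R ^ ?N) * (ennreal (\<rho> powr (- \<beta> - 1)) * indicator {R..} \<rho>) \<partial>lborel)"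
  proof (rule nn_integral_mono)
    fix \<rho> :: real
    let ?c = "ennreal \<beta> * ennreal (\<rho> powr (- \<beta> - 1))"
    have le: "(\<integral>\<^sup>+v. ?f v \<rho> \<partial>lborel) \<le> ?c * emeasure lborel (cball (0 :: real ^ 'n) (min \<rho> R))"
    proof -
      have "(\<integral>\<^sup>+v. ?f v \<rho> \<partial>lborel) = (\<integral>\<^sup>+v. ?c * indicator (cball (0 :: real ^ 'n) (min \<rho> R)) v \<partial>lborel)"
        by (intro nn_integral_cong) (simp split: split_indicator add: mult.assoc)
      also have "\<dots> = ?c * emeasure lborel (cball (0 :: real ^ 'n) (min \<rho> R))"
        by (rule nn_integral_cmult_indicator) simp
      finally show ?thesis by simp
    qed
    consider "\<rho> < 0" | "0 \<le> \<rho>" "\<rho> \<le> R" | "R < \<rho>" by linarith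
    then show "(\<integral>\<^sup>+v. ?f v \<rho> \<partial>lborel) \<le> ennreal (\<beta> * ?V) * (ennreal (\<rho> powr (real ?N - \<beta> - 1)) * indicator {0..R} \<rho>) +
      ennreal (\<beta> * ?V * R ^ ?N) * (ennreal (\<rho> powr (- \<beta> - 1)) * indicator {R..} \<rho>)"
    proof cases
      case 1
      then have "cball (0 :: real ^ 'n) (min \<rho> R) = {}" by simp
      then show ?thesis using le by simp
    next
      case 2
      have "?c * emeasure lborel (cball (0 :: real ^ 'n) (min \<rho> R)) = ennreal (\<beta> * ?V) * ennreal (\<rho> powr (real ?N - \<beta> - 1))"
      proof (cases "\<rho> = 0")
        case False
        then have "0 < \<rho>" using 2 by simp
        then have "\<rho> powr (real ?N - \<beta> - 1) = \<rho> powr (- \<beta> - 1) * \<rho> ^ ?N"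
        proof -
          have "real ?N - \<beta> - 1 = (- \<beta> - 1) + real ?N" by simp
          then have "\<rho> powr (real ?N - \<beta> - 1) = \<rho> powr (- \<beta> - 1) * \<rho> powr real ?N" by (simp only: powr_add)
          then show ?thesis using \<open>0 < \<rho>\<close> by (simp add: powr_realpow)
        qed
        then show ?thesis using 2 b by (simp add: emeasure_cball min_absorb1 ennreal_mult[symmetric] ac_simps)
      qed simp
      then show ?thesis using le 2 by (simp add: add_increasing2)
    next
      case 3
      have "?c * emeasure lborel (cball (0 :: real ^ 'n) (min \<rho> R)) = ennreal (\<beta> * ?V * R ^ ?N) * ennreal (\<rho> powr (- \<beta> - 1))"
        using 3 R b by (simp add: emeasure_cball min_absorb2 ennreal_mult[symmetric] ac_simps)
      then show ?thesis using le 3 by (simp add: add_increasing)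
    qed
  qed
  also have "\<dots> = ennreal (\<beta> * ?V) * (\<integral>\<^sup>+\<rho>. ennreal (\<rho> powr (real ?N - \<beta> - 1)) * indicator {0..R} \<rho> \<partial>lborel) +
    ennreal (\<beta> * ?V * R ^ ?N) * (\<integral>\<^sup>+\<rho>. ennreal (\<rho> powr (- \<beta> - 1)) * indicator {R..} \<rho> \<partial>lborel)"
    by (simp add: nn_integral_add nn_integral_cmult)
  also have "\<dots> < \<infinity>"
    using nn_integral_powr_from_0[of "real ?N - \<beta> - 1" R] nn_integral_powr_to_inf[of "- \<beta> - 1" R] b R
    by (simp add: ennreal_mult_less_top)
  finally show ?thesis .
qed

lemma locally_finite_colored:
  assumes b: "0 < \<beta>" "\<beta> < real CARD('n)"
  shows "locally_finite_covariance (colored_covariance \<beta> :: (real \<times> (real ^ 'n) \<times> (real ^ 'n)) measure)"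
  unfolding locally_finite_covariance_def
proof (intro conjI ballI)
  let ?\<Lambda> = "colored_covariance \<beta> :: (real \<times> (real ^ 'n) \<times> (real ^ 'n)) measure"
  show "sets ?\<Lambda> = sets borel" by (simp add: colored_covariance_def)
  fix A B :: "(real \<times> (real ^ 'n)) set" assume AB: "A \<in> bounded_borel" "B \<in> bounded_borel"
  then have "bounded (A \<union> B)" by (auto simp: bounded_borel_def)
  then obtain R where R: "0 < R" "\<And>p. p \<in> A \<union> B \<Longrightarrow> norm p \<le> R" unfolding bounded_pos by blast
  have R': "\<bar>s\<bar> \<le> R" "norm y \<le> R" if "(s, y) \<in> A \<union> B" for s y
    using R(2)[OF that] norm_fst_le[of s y] norm_snd_le[of y s] by auto
  let ?E = "{(s, y, z). (s, y) \<in> A \<and> (s, z) \<in> B}"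
  let ?D = "cball (0 :: real ^ 'n) R"
  let ?I = "\<integral>\<^sup>+v. ennreal (norm (v :: real ^ 'n) powr - \<beta>) * indicator (cball 0 (2 * R)) v \<partial>lborel"
  have E: "?E \<in> sets borel" using AB by (intro section_pair_measurable) (auto simp: bounded_borel_def)
  \<comment> \<open>If both points have norm at most R, their difference has norm at most 2 R.
    Replacing \<open>z\<close> by \<open>y + v\<close> then separates the three integrals.\<close>
  let ?f = "\<lambda>(s, y, z). indicator {- R..R} s * (indicator ?D y * (ennreal (norm (y - z) powr - \<beta>) * indicator (cball 0 (2 * R)) (z - y)))"
  have [measurable]: "?D \<in> sets borel" "cball (0 :: real ^ 'n) (2 * R) \<in> sets borel" by simp_all
  have fm: "?f \<in> borel_measurable (lborel \<Otimes>\<^sub>M (lborel \<Otimes>\<^sub>M lborel))"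
    unfolding case_prod_beta by measurable
  have fm2: "(\<lambda>p. ?f (s, p)) \<in> borel_measurable (lborel \<Otimes>\<^sub>M lborel)" for s
    unfolding case_prod_beta fst_conv snd_conv by measurable
  have rm: "(\<lambda>(s :: real, y :: real ^ 'n, z). ennreal (norm (y - z) powr - \<beta>)) \<in> borel_measurable borel"
  proof -
    have "(\<lambda>(s :: real, y :: real ^ 'n, z). ennreal (norm (y - z) powr - \<beta>)) \<in> borel_measurable (borel \<Otimes>\<^sub>M (borel \<Otimes>\<^sub>M borel))"
      unfolding case_prod_beta by measurable
    then show ?thesis by (simp add: borel_prod)
  qed
  have "emeasure ?\<Lambda> ?E = (\<integral>\<^sup>+x. (case x of (s, y, z) \<Rightarrow> ennreal (norm (y - z) powr - \<beta>)) * indicator ?E x \<partial>lborel)"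
    unfolding colored_covariance_def using E rm by (intro emeasure_density) simp_all
  also have "\<dots> \<le> (\<integral>\<^sup>+x. ?f x \<partial>lborel)"
  proof (rule nn_integral_mono, clarify)
    fix s :: real and y z :: "real ^ 'n"
    have "norm (z - y) \<le> norm z + norm y" by (rule norm_triangle_ineq4)
    then show "ennreal (norm (y - z) powr - \<beta>) * indicator ?E (s, y, z) \<le>
      indicator {- R..R} s * (indicator ?D y * (ennreal (norm (y - z) powr - \<beta>) * indicator (cball 0 (2 * R)) (z - y)))"
      using R'[of s y] R'[of s z] by (auto split: split_indicator)
  qed
  also have "\<dots> = (\<integral>\<^sup>+s. \<integral>\<^sup>+p. ?f (s, p) \<partial>lborel \<partial>lborel)"
  proof -
    have "?f \<in> borel_measurable (lborel \<Otimes>\<^sub>M (lborel :: ((real ^ 'n) \<times> (real ^ 'n)) measure))"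
      using fm by (subst (asm) lborel_prod)
    from lborel.nn_integral_fst[OF this] show ?thesis by (simp only: lborel_prod)
  qed
  also have "\<dots> = (\<integral>\<^sup>+s. \<integral>\<^sup>+y. \<integral>\<^sup>+z. ?f (s, y, z) \<partial>lborel \<partial>lborel \<partial>lborel)"
  proof (rule nn_integral_cong)
    fix s
    show "(\<integral>\<^sup>+p. ?f (s, p) \<partial>lborel) = (\<integral>\<^sup>+y. \<integral>\<^sup>+z. ?f (s, y, z) \<partial>lborel \<partial>lborel)"
      using lborel.nn_integral_fst[OF fm2[of s]] by (simp only: lborel_prod)
  qed
  also have "\<dots> = (\<integral>\<^sup>+s. \<integral>\<^sup>+y. indicator {- R..R} s * (indicator ?D y * ?I) \<partial>lborel \<partial>lborel)"
  proof (intro nn_integral_cong)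
    fix s :: real and y :: "real ^ 'n"
    have "(\<integral>\<^sup>+z. ?f (s, y, z) \<partial>lborel) = indicator {- R..R} s * (indicator ?D y * (\<integral>\<^sup>+z. ennreal (norm (y - z) powr - \<beta>) * indicator (cball 0 (2 * R)) (z - y) \<partial>lborel))"
      by (simp add: nn_integral_cmult)
    also have "(\<integral>\<^sup>+z. ennreal (norm (y - z) powr - \<beta>) * indicator (cball 0 (2 * R)) (z - y) \<partial>lborel) = ?I"
      by (subst nn_integral_lborel_translate[symmetric, where v = y]) simp_all
    finally show "(\<integral>\<^sup>+z. ?f (s, y, z) \<partial>lborel) = indicator {- R..R} s * (indicator ?D y * ?I)" .
  qed
  also have "\<dots> = emeasure lborel {- R..R} * (emeasure lborel ?D * ?I)"
    by (simp add: nn_integral_cmult nn_integral_multc)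
  also have "\<dots> < \<infinity>"
    using riesz_kernel_locally_integrable[OF b, of "2 * R"] R by (simp add: ennreal_mult_less_top emeasure_cball)
  finally show "emeasure ?\<Lambda> ?E < \<infinity>" .
qed

text \<open>A finite plus norm is absolute integrability against the space-time kernel, so Fubini
  decomposes the noise form into purely spatial Riesz forms, one for almost every time. This fits
  the noise being white in time.\<close>

lemma colored_form_slices:
  fixes h :: "real \<times> (real ^ 'n) \<Rightarrow> real"
  assumes h[measurable]: "h \<in> borel_measurable borel" and fin: "plus_norm_sq (colored_covariance \<beta>) h < \<infinity>"
  defines "q \<equiv> \<lambda>s. LINT p|lborel. norm (fst p - snd p) powr - \<beta> * (h (s, fst p) * h (s, snd p))"
  shows "AE s in lborel. integrable lborel (\<lambda>p :: (real ^ 'n) \<times> (real ^ 'n). norm (fst p - snd p) powr - \<beta> * (h (s, fst p) * h (s, snd p)))"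
    and "integrable lborel q" and "(LINT s|lborel. q s) = noise_form (colored_covariance \<beta>) h"
proof -
  have hc[measurable (raw)]: "(\<lambda>x. h (a x, b x)) \<in> borel_measurable N"
    if "a \<in> N \<rightarrow>\<^sub>M borel" "b \<in> N \<rightarrow>\<^sub>M borel" for a b and N :: "'x measure"
  proof -
    have "(\<lambda>x. (a x, b x)) \<in> N \<rightarrow>\<^sub>M borel" using that by (simp add: borel_prod[symmetric])
    from measurable_compose[OF this h] show ?thesis .
  qed
  let ?r = "\<lambda>(s :: real, y :: real ^ 'n, z). norm (y - z) powr - \<beta>"
  let ?H = "\<lambda>(s :: real, y :: real ^ 'n, z). h (s, y) * h (s, z)"
  have rm: "?r \<in> borel_measurable borel" and Hm: "?H \<in> borel_measurable borel"
    and Am: "(\<lambda>(s :: real, y :: real ^ 'n, z). ennreal (\<bar>h (s, y)\<bar> * \<bar>h (s, z)\<bar>)) \<in> borel_measurable borel"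
  proof -
    have "?r \<in> borel_measurable (borel \<Otimes>\<^sub>M (borel \<Otimes>\<^sub>M borel))" "?H \<in> borel_measurable (borel \<Otimes>\<^sub>M (borel \<Otimes>\<^sub>M borel))"
      "(\<lambda>(s :: real, y :: real ^ 'n, z). ennreal (\<bar>h (s, y)\<bar> * \<bar>h (s, z)\<bar>)) \<in> borel_measurable (borel \<Otimes>\<^sub>M (borel \<Otimes>\<^sub>M borel))"
      unfolding case_prod_beta by measurable
    then show "?r \<in> borel_measurable borel" "?H \<in> borel_measurable borel"
      "(\<lambda>(s :: real, y :: real ^ 'n, z). ennreal (\<bar>h (s, y)\<bar> * \<bar>h (s, z)\<bar>)) \<in> borel_measurable borel"
      by (simp_all add: borel_prod)
  qed
  have dens: "colored_covariance \<beta> = density lborel (\<lambda>x. ennreal (?r x))"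
    unfolding colored_covariance_def by (intro arg_cong[where f = "density lborel"]) auto
  let ?G = "\<lambda>(s, p). norm (fst p - snd p) powr - \<beta> * (h (s, fst p) * h (s, snd p))"
  have Geq: "?G = (\<lambda>x. ?r x * ?H x)" by auto
  have iG: "integrable lborel ?G"
  proof (rule integrableI_bounded)
    show "?G \<in> borel_measurable lborel" unfolding Geq using rm Hm by simp
    have "(\<integral>\<^sup>+x. ennreal (norm (?G x)) \<partial>lborel) = (\<integral>\<^sup>+x. ennreal (?r x) * (case x of (s, y, z) \<Rightarrow> ennreal (\<bar>h (s, y)\<bar> * \<bar>h (s, z)\<bar>)) \<partial>lborel)"
      by (intro nn_integral_cong) (auto simp: abs_mult ennreal_mult[symmetric])
    also have "\<dots> = plus_norm_sq (colored_covariance \<beta>) h"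
      unfolding plus_norm_sq_def dens using rm Am by (subst nn_integral_density) auto
    finally show "(\<integral>\<^sup>+x. ennreal (norm (?G x)) \<partial>lborel) < \<infinity>" using fin by simp
  qed
  then have iG': "integrable (lborel \<Otimes>\<^sub>M lborel) (\<lambda>(s, p). ?G (s, p))" by (simp add: lborel_prod)
  show "AE s in lborel. integrable lborel (\<lambda>p :: (real ^ 'n) \<times> (real ^ 'n). norm (fst p - snd p) powr - \<beta> * (h (s, fst p) * h (s, snd p)))"
    using lborel_pair.AE_integrable_fst'[OF iG'] by simp
  show "integrable lborel q" unfolding q_def using lborel_pair.integrable_fst'[OF iG'] by simp
  have "(LINT s|lborel. q s) = (LINT x|lborel. ?G x)"
    unfolding q_def using lborel_pair.integral_fst'[OF iG'] by (simp add: lborel_prod)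
  also have "\<dots> = noise_form (colored_covariance \<beta>) h"
    unfolding noise_form_def dens Geq using rm Hm by (subst integral_density) (auto intro!: Bochner_Integration.integral_cong)
  finally show "(LINT s|lborel. q s) = noise_form (colored_covariance \<beta>) h" .
qed

section \<open>The test function for coloured noise\<close>

definition tent :: "real \<Rightarrow> real ^ 'n \<Rightarrow> real" where
  "tent r z = max 0 (r - norm z)"

text \<open>The closed form of \<open>ball_source\<close> integrated against the ball kernel.
  \<open>tent r z\<close> is the length of the interval of radii between |z| and r.\<close>

definition smeared_source :: "real \<Rightarrow> real ^ 'n \<Rightarrow> real \<Rightarrow> real \<times> (real ^ 'n) \<Rightarrow> real" where
  "smeared_source t0 c r = (\<lambda>(s, y). LINT z|lborel. tent r z * bump_source t0 c r (s, y - z))"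

lemma tent_measurable [measurable]: "tent r \<in> borel_measurable borel"
  unfolding tent_def[abs_def] by measurable

lemma tent_bounds: "0 \<le> tent r z" "0 < r \<Longrightarrow> tent r z \<le> r * indicator (cball 0 r) z"
  by (auto simp: tent_def split: split_indicator)

lemma bump_source_measurable_compose:
  assumes r: "0 < r" and "a \<in> N \<rightarrow>\<^sub>M borel" "b \<in> N \<rightarrow>\<^sub>M (borel :: (real ^ 'n) measure)"
  shows "(\<lambda>x. bump_source t0 c r (a x, b x)) \<in> borel_measurable N"
proof -
  have "(\<lambda>x. (a x, b x)) \<in> N \<rightarrow>\<^sub>M borel" using assms by (simp add: borel_prod[symmetric])
  from measurable_compose[OF this bump_source_measurable[OF r]] show ?thesis .
qed

lemma smeared_source_measurable:
  assumes r: "0 < r"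
  shows "smeared_source t0 c r \<in> borel_measurable (borel :: (real \<times> (real ^ 'n)) measure)"
proof -
  have "(\<lambda>x :: (real \<times> (real ^ 'n)) \<times> (real ^ 'n). tent r (snd x) * bump_source t0 c r (fst (fst x), snd (fst x) - snd x)) \<in> borel_measurable ((borel \<Otimes>\<^sub>M borel) \<Otimes>\<^sub>M lborel)"
    by (intro borel_measurable_times bump_source_measurable_compose[OF r]) measurable
  then have "(\<lambda>x :: (real \<times> (real ^ 'n)). LINT z|lborel. tent r z * bump_source t0 c r (fst x, snd x - z)) \<in> borel_measurable (borel \<Otimes>\<^sub>M borel)"
    by (intro lborel.borel_measurable_lebesgue_integral) (simp add: case_prod_beta)
  then show ?thesis by (simp add: smeared_source_def case_prod_beta borel_prod)
qed

lemma smeared_source_bounded: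
  fixes p :: "real \<times> (real ^ 'n)"
  assumes r: "0 < r"
  shows "\<bar>smeared_source t0 c r p\<bar> \<le> (LINT z|lborel. bump_source_bound TYPE('n) / r\<^sup>2 * (r * indicator (cball 0 r) (z :: real ^ 'n)))"
proof -
  obtain s y where p: "p = (s, y)" by (cases p)
  have i: "integrable lborel (\<lambda>z :: real ^ 'n. bump_source_bound TYPE('n) / r\<^sup>2 * (r * indicator (cball 0 r) z))"
    by (intro Bochner_Integration.integrable_mult_right integrable_real_indicator emeasure_bounded_finite) auto
  have "norm (LINT z|lborel. tent r z * bump_source t0 c r (s, y - z)) \<le> (LINT z|lborel. bump_source_bound TYPE('n) / r\<^sup>2 * (r * indicator (cball 0 r) (z :: real ^ 'n)))"
  proof (rule order_trans[OF integral_norm_bound integral_mono])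
    have le: "norm (tent r z * bump_source t0 c r (s, y - z)) \<le> bump_source_bound TYPE('n) / r\<^sup>2 * (r * indicator (cball 0 r) z)" for z
    proof -
      have "norm (tent r z * bump_source t0 c r (s, y - z)) = \<bar>bump_source t0 c r (s, y - z)\<bar> * tent r z"
        using tent_bounds(1)[of r z] by (simp add: abs_mult)
      also have "\<dots> \<le> bump_source_bound TYPE('n) / r\<^sup>2 * (r * indicator (cball 0 r) z)"
        using tent_bounds[of r z] r bump_source_bound_pos[where 'n = 'n] by (intro mult_mono bump_source_le) (auto intro!: divide_nonneg_nonneg less_imp_le)
      finally show ?thesis .
    qed
    then show "\<And>z. z \<in> space lborel \<Longrightarrow> norm (tent r z * bump_source t0 c r (s, y - z)) \<le> bump_source_bound TYPE('n) / r\<^sup>2 * (r * indicator (cball 0 r) z)" by blast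
    show "integrable lborel (\<lambda>z. norm (tent r z * bump_source t0 c r (s, y - z)))"
    proof (rule integrable_norm, rule Bochner_Integration.integrable_bound[OF i])
      show "(\<lambda>z. tent r z * bump_source t0 c r (s, y - z)) \<in> borel_measurable lborel"
        by (intro borel_measurable_times bump_source_measurable_compose[OF r]) measurable
      show "AE z in lborel. norm (tent r z * bump_source t0 c r (s, y - z)) \<le> norm (bump_source_bound TYPE('n) / r\<^sup>2 * (r * indicator (cball 0 r) z))"
        by (intro AE_I2 order_trans[OF le]) (simp only: real_norm_def abs_ge_self)
    qed
    show "integrable lborel (\<lambda>z :: real ^ 'n. bump_source_bound TYPE('n) / r\<^sup>2 * (r * indicator (cball 0 r) z))" by (rule i)
  qed
  then show ?thesis by (simp add: smeared_source_def p)
qed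

text \<open>The smeared source is an average of sources of shifted bumps, so Duhamel's formula holds
  for it with the average of those bumps.\<close>

lemma heat_integral_smeared_source:
  fixes x c :: "real ^ 'n"
  assumes r: "0 < r" "r\<^sup>2 < t0" and t: "0 \<le> t"
  shows "(LINT p|lborel. heat_integrand (t, x) p * smeared_source t0 c r p) =
    heat_mass TYPE('n) * time_bump t0 r t * (LINT z|lborel. tent r z * space_bump c r (x - z))"
proof -
  let ?q = "(t, x)" and ?K = "bump_source_bound TYPE('n) / r\<^sup>2"
  let ?f = "\<lambda>p z. heat_integrand ?q p * (tent r z * bump_source t0 c r (fst p, snd p - z))"
  have K: "0 \<le> ?K" using bump_source_bound_pos[where 'n = 'n] by simp
  have fm: "(\<lambda>(p, z). ?f p z) \<in> borel_measurable (lborel \<Otimes>\<^sub>M lborel)"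
  proof -
    have f[measurable]: "fst \<in> (borel :: (real \<times> (real ^ 'n)) measure) \<rightarrow>\<^sub>M borel" "snd \<in> (borel :: (real \<times> (real ^ 'n)) measure) \<rightarrow>\<^sub>M borel"
      by (simp_all add: borel_prod[symmetric])
    show ?thesis
      unfolding case_prod_beta
      by (intro borel_measurable_times bump_source_measurable_compose[OF r(1)]) measurable
  qed
  have fm': "(\<lambda>(p, z). ennreal (norm (?f p z))) \<in> borel_measurable (lborel \<Otimes>\<^sub>M lborel)"
    using fm by (simp add: case_prod_unfold)
  have ih: "integrable lborel (heat_integrand ?q)"
    using heat_integrand_integrable[of ?q "\<lambda>_. 1" 1] t by simp
  have if': "integrable (lborel \<Otimes>\<^sub>M lborel) (\<lambda>(p, z). ?f p z)"
  proof (rule integrableI_bounded[OF fm])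
    have "(\<integral>\<^sup>+x. ennreal (norm (case x of (p, z) \<Rightarrow> ?f p z)) \<partial>(lborel \<Otimes>\<^sub>M lborel)) = (\<integral>\<^sup>+p. \<integral>\<^sup>+z. ennreal (norm (?f p z)) \<partial>lborel \<partial>lborel)"
      using lborel.nn_integral_fst[OF fm'] by (simp add: case_prod_unfold)
    also have "\<dots> \<le> (\<integral>\<^sup>+p. \<integral>\<^sup>+z. ennreal (heat_integrand ?q p) * (ennreal (r * ?K) * indicator (cball (0 :: real ^ 'n) r) z) \<partial>lborel \<partial>lborel)"
    proof (intro nn_integral_mono)
      fix p and z :: "real ^ 'n"
      have "norm (?f p z) = heat_integrand ?q p * (tent r z * \<bar>bump_source t0 c r (fst p, snd p - z)\<bar>)"
        using tent_bounds(1)[of r z] by (simp add: abs_mult)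
      also have "\<dots> \<le> heat_integrand ?q p * ((r * indicator (cball 0 r) z) * ?K)"
        using tent_bounds[of r z] r K by (intro mult_left_mono mult_mono bump_source_le) auto
      finally have "ennreal (norm (?f p z)) \<le> ennreal (heat_integrand ?q p * ((r * indicator (cball 0 r) z) * ?K))" by (rule ennreal_leI)
      also have "\<dots> = ennreal (heat_integrand ?q p) * (ennreal (r * ?K) * indicator (cball (0 :: real ^ 'n) r) z)"
      proof (cases "z \<in> cball 0 r")
        case True
        have "ennreal (heat_integrand ?q p * (r * ?K)) = ennreal (heat_integrand ?q p) * ennreal (r * ?K)"
          by (rule ennreal_mult) (use mult_nonneg_nonneg[OF less_imp_le[OF r(1)] K] in auto)
        then show ?thesis using True by simp
      qed simp
      finally show "ennreal (norm (?f p z)) \<le> ennreal (heat_integrand ?q p) * (ennreal (r * ?K) * indicator (cball (0 :: real ^ 'n) r) z)" .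
    qed
    also have "\<dots> = (\<integral>\<^sup>+p. ennreal (heat_integrand ?q p) * (ennreal (r * ?K) * emeasure lborel (cball (0 :: real ^ 'n) r)) \<partial>lborel)"
    proof (intro nn_integral_cong)
      fix p
      show "(\<integral>\<^sup>+z. ennreal (heat_integrand ?q p) * (ennreal (r * ?K) * indicator (cball (0 :: real ^ 'n) r) z) \<partial>lborel) =
        ennreal (heat_integrand ?q p) * (ennreal (r * ?K) * emeasure lborel (cball (0 :: real ^ 'n) r))"
      proof -
        have [measurable]: "cball (0 :: real ^ 'n) r \<in> sets borel" by simp
        have "(\<lambda>z. ennreal (r * ?K) * indicator (cball (0 :: real ^ 'n) r) z) \<in> borel_measurable lborel" by measurable
        then have "(\<integral>\<^sup>+z. ennreal (heat_integrand ?q p) * (ennreal (r * ?K) * indicator (cball (0 :: real ^ 'n) r) z) \<partial>lborel) =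
          ennreal (heat_integrand ?q p) * (\<integral>\<^sup>+z. ennreal (r * ?K) * indicator (cball (0 :: real ^ 'n) r) z \<partial>lborel)"
          by (rule nn_integral_cmult)
        also have "(\<integral>\<^sup>+z. ennreal (r * ?K) * indicator (cball (0 :: real ^ 'n) r) z \<partial>lborel) = ennreal (r * ?K) * emeasure lborel (cball (0 :: real ^ 'n) r)"
          by (rule nn_integral_cmult_indicator) simp
        finally show ?thesis .
      qed
    qed
    also have "\<dots> = (\<integral>\<^sup>+p. ennreal (heat_integrand ?q p) \<partial>lborel) * (ennreal (r * ?K) * emeasure lborel (cball (0 :: real ^ 'n) r))"
      by (rule nn_integral_multc) measurable
    also have "\<dots> < \<infinity>"
      using ih r by (simp add: integrable_iff_bounded ennreal_mult_less_top emeasure_cball)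
    finally show "(\<integral>\<^sup>+x. ennreal (norm (case x of (p, z) \<Rightarrow> ?f p z)) \<partial>(lborel \<Otimes>\<^sub>M lborel)) < \<infinity>" .
  qed
  have "(LINT p|lborel. heat_integrand ?q p * smeared_source t0 c r p) = (LINT p|lborel. LINT z|lborel. ?f p z)"
    by (intro Bochner_Integration.integral_cong refl) (simp add: smeared_source_def case_prod_beta)
  also have "\<dots> = (LINT z|lborel. LINT p|lborel. ?f p z)"
    using lborel_pair.Fubini_integral[OF if'] by simp
  also have "\<dots> = (LINT z|lborel. heat_mass TYPE('n) * time_bump t0 r t * (tent r z * space_bump c r (x - z)))"
  proof (intro Bochner_Integration.integral_cong refl)
    fix z
    have "(LINT p|lborel. ?f p z) = (LINT p|lborel. tent r z * (heat_integrand ?q p * bump_source t0 (c + z) r p))"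
      using bump_source_shift[of t0 c r] by (intro Bochner_Integration.integral_cong refl) simp
    also have "\<dots> = tent r z * (heat_mass TYPE('n) * time_bump t0 r t * space_bump (c + z) r x)"
      using heat_integral_bump_source[OF r t, of x "c + z"] by simp
    also have "\<dots> = heat_mass TYPE('n) * time_bump t0 r t * (tent r z * space_bump c r (x - z))"
      by (simp add: space_bump_shift)
    finally show "(LINT p|lborel. ?f p z) = heat_mass TYPE('n) * time_bump t0 r t * (tent r z * space_bump c r (x - z))" .
  qed
  finally show ?thesis by simp
qed

text \<open>A shift shorter than r cannot bring a point at distance 2 r from the centre into a bump
  of radius r.\<close>

lemma tent_space_bump_integral_eq_0:
  assumes r: "0 < r" and x: "2 * r \<le> norm (x - c)"
  shows "(LINT z|lborel. tent r z * space_bump c r (x - z)) = 0"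
proof -
  have "tent r z * space_bump c r (x - z) = 0" for z
  proof (cases "norm z < r")
    case True
    have "norm (x - c) \<le> norm (x - z - c) + norm z" using norm_triangle_ineq[of "x - z - c" z] by (simp add: algebra_simps)
    then have "r \<le> norm (x - z - c)" using x True by linarith
    then show ?thesis using space_bump_eq_0[OF r, of "x - z" c] by simp
  qed (simp add: tent_def)
  then show ?thesis by (simp only: Bochner_Integration.integral_zero)
qed

text \<open>On the ball of radius r/2 the tent is at least r/2 and the bump at least 1/4, hence the
  factor r/8.\<close>

lemma tent_space_bump_integral_ge:
  fixes c :: "real ^ 'n"
  assumes r: "0 < r"
  shows "r / 8 * (unit_ball_vol (real CARD('n)) * (r / 2) ^ CARD('n)) \<le> (LINT z|lborel. tent r z * space_bump c r (c - z))"
proof -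
  have sm: "space_bump c r \<in> borel_measurable borel"
    using smooth_space_bump[OF r, of c] unfolding smooth_bump_def by (intro borel_measurable_continuous_onI) blast
  have m[measurable]: "(\<lambda>z. space_bump c r (c - z)) \<in> borel_measurable borel"
    by (rule measurable_compose[OF _ sm]) measurable
  have i1: "integrable lborel (\<lambda>z. r * indicator (cball (0 :: real ^ 'n) r) z)"
    by (intro Bochner_Integration.integrable_mult_right integrable_real_indicator emeasure_bounded_finite) auto
  have "r / 8 * (unit_ball_vol (real CARD('n)) * (r / 2) ^ CARD('n)) = (LINT z|lborel. r / 8 * indicator (cball (0 :: real ^ 'n) (r / 2)) z)"
    using r measure_lborel_cball[of "r / 2" "0 :: real ^ 'n"] by simp
  also have "\<dots> \<le> (LINT z|lborel. tent r z * space_bump c r (c - z))"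
  proof (rule integral_mono)
    show "integrable lborel (\<lambda>z. r / 8 * indicator (cball (0 :: real ^ 'n) (r / 2)) z)"
      by (intro Bochner_Integration.integrable_mult_right integrable_real_indicator emeasure_bounded_finite) auto
    show "integrable lborel (\<lambda>z. tent r z * space_bump c r (c - z))"
    proof (rule Bochner_Integration.integrable_bound[OF i1])
      show "AE z in lborel. norm (tent r z * space_bump c r (c - z)) \<le> norm (r * indicator (cball 0 r) z)"
      proof (intro AE_I2)
        fix z
        have "tent r z * space_bump c r (c - z) \<le> (r * indicator (cball 0 r) z) * 1"
          using tent_bounds[of r z] space_bump_bounds[of c r "c - z"] r by (intro mult_mono) auto
        moreover have "0 \<le> tent r z * space_bump c r (c - z)" using tent_bounds(1)[of r z] space_bump_bounds(1)[of c r "c - z"] by simp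
        ultimately show "norm (tent r z * space_bump c r (c - z)) \<le> norm (r * indicator (cball 0 r) z)" by simp
      qed
    qed measurable
    fix z :: "real ^ 'n"
    show "r / 8 * indicator (cball 0 (r / 2)) z \<le> tent r z * space_bump c r (c - z)"
    proof (cases "norm z \<le> r / 2")
      case True
      have "r / 2 * (1 / 4) \<le> tent r z * space_bump c r (c - z)"
        using True r by (intro mult_mono space_bump_ge) (auto simp: tent_def)
      then show ?thesis using True by simp
    next
      case False
      then show ?thesis using tent_bounds(1)[of r z] space_bump_bounds(1)[of c r "c - z"] by simp
    qed
  qed
  finally show ?thesis .
qed

text \<open>The test function on the space of balls. The power of the radius cancels the weight in
  \<open>ball_kernel\<close>, and the cut-off at r keeps the support bounded after integration over
  balls.\<close>

definition ball_source :: "real \<Rightarrow> real \<Rightarrow> real ^ 'n \<Rightarrow> real \<Rightarrow> real \<Rightarrow> real \<times> (real ^ 'n) \<Rightarrow> real" where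
  "ball_source \<beta> t0 c r s = (\<lambda>(\<rho>, w). indicator {0<..<r} \<rho> * \<rho> powr ((real CARD('n) + \<beta> + 1) / 2) * bump_source t0 c r (s, w))"

lemma ball_source_bounds:
  fixes c :: "real ^ 'n"
  assumes r: "0 < r" and b: "0 < \<beta>"
  shows "ball_source \<beta> t0 c r s \<in> borel_measurable borel"
    and "\<bar>ball_source \<beta> t0 c r s e\<bar> \<le> r powr ((real CARD('n) + \<beta> + 1) / 2) * (bump_source_bound TYPE('n) / r\<^sup>2)"
    and "e \<notin> {0..r} \<times> cball c r \<Longrightarrow> ball_source \<beta> t0 c r s e = 0"
proof -
  have "(\<lambda>x :: real \<times> (real ^ 'n). indicator {0<..<r} (fst x) * fst x powr ((real CARD('n) + \<beta> + 1) / 2) * bump_source t0 c r (s, snd x)) \<in> borel_measurable (borel \<Otimes>\<^sub>M borel)"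
    by (intro borel_measurable_times bump_source_measurable_compose[OF r]) measurable
  then show "ball_source \<beta> t0 c r s \<in> borel_measurable borel"
    by (simp add: ball_source_def case_prod_beta borel_prod)
  obtain \<rho> w where e: "e = (\<rho>, w)" by (cases e)
  have K: "0 < bump_source_bound TYPE('n)" by (rule bump_source_bound_pos)
  show "\<bar>ball_source \<beta> t0 c r s e\<bar> \<le> r powr ((real CARD('n) + \<beta> + 1) / 2) * (bump_source_bound TYPE('n) / r\<^sup>2)"
  proof (cases "\<rho> \<in> {0<..<r}")
    case True
    have "\<bar>ball_source \<beta> t0 c r s e\<bar> = \<rho> powr ((real CARD('n) + \<beta> + 1) / 2) * \<bar>bump_source t0 c r (s, w)\<bar>"
      using True by (simp add: ball_source_def e abs_mult)
    also have "\<dots> \<le> r powr ((real CARD('n) + \<beta> + 1) / 2) * (bump_source_bound TYPE('n) / r\<^sup>2)"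
      using True r b by (intro mult_mono bump_source_le powr_mono2) auto
    finally show ?thesis .
  next
    case False
    then show ?thesis using r K by (simp add: ball_source_def e)
  qed
  show "e \<notin> {0..r} \<times> cball c r \<Longrightarrow> ball_source \<beta> t0 c r s e = 0"
    using bump_source_eq_0_space[OF r, of w c t0 s]
    by (auto simp: ball_source_def e dist_norm norm_minus_commute split: split_indicator)
qed

text \<open>Power count: r^(N + \<beta> + 1) from the squared weight, r^-4 from the squared source
  and r^(N + 1) from the volume of the support.\<close>

lemma ball_source_square:
  fixes c :: "real ^ 'n"
  assumes r: "0 < r" and b: "0 < \<beta>"
  shows "square_integrable lborel (ball_source \<beta> t0 c r s)"
    and "(LINT e|lborel. (ball_source \<beta> t0 c r s e)\<^sup>2) \<le> (bump_source_bound TYPE('n))\<^sup>2 * unit_ball_vol (real CARD('n)) * r powr (2 * real CARD('n) + \<beta> - 2)"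
proof -
  let ?A = "{0..r} \<times> cball c r" and ?K = "bump_source_bound TYPE('n)" and ?V = "unit_ball_vol (real CARD('n))"
  let ?g = "(real CARD('n) + \<beta> + 1) / 2"
  have A: "bounded ?A" "?A \<in> sets borel"
    by (auto intro!: bounded_Times borel_closed closed_Times)
  have mA: "measure lborel ?A = r * (?V * r ^ CARD('n))"
  proof -
    have "emeasure lborel ?A = emeasure lborel {0..r} * emeasure lborel (cball c r)"
      unfolding lborel_prod[symmetric] by (rule lborel.emeasure_pair_measure_Times) auto
    then show ?thesis using r by (simp add: measure_def emeasure_cball enn2real_mult)
  qed
  show "square_integrable lborel (ball_source \<beta> t0 c r s)"
    by (rule square_integrable_bounded_support(1)[OF ball_source_bounds(1)[OF r b] ball_source_bounds(2)[OF r b] A ball_source_bounds(3)[OF r b]])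
  have "(LINT e|lborel. (ball_source \<beta> t0 c r s e)\<^sup>2) \<le> (r powr ?g * (?K / r\<^sup>2))\<^sup>2 * measure lborel ?A"
    by (rule square_integrable_bounded_support(2)[OF ball_source_bounds(1)[OF r b] ball_source_bounds(2)[OF r b] A ball_source_bounds(3)[OF r b]])
  also have "\<dots> = ?K\<^sup>2 * ?V * ((r powr ?g * r powr ?g) * (r * r ^ CARD('n)) / r ^ 4)"
    unfolding mA by (simp add: power_mult_distrib power_divide power2_eq_square power4_eq_xxxx)
  also have "(r powr ?g * r powr ?g) * (r * r ^ CARD('n)) / r ^ 4 = r powr (2 * real CARD('n) + \<beta> - 2)"
  proof -
    have e: "r powr (2 * real CARD('n) + \<beta> - 2) = r powr (?g + ?g + (1 + real CARD('n)) - real (4 :: nat))"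
      by (rule arg_cong[where f = "\<lambda>a. r powr a"]) (simp add: field_simps)
    show ?thesis
      unfolding e by (simp only: powr_diff powr_add powr_realpow[OF r]) (use r in simp)
  qed
  finally show "(LINT e|lborel. (ball_source \<beta> t0 c r s e)\<^sup>2) \<le> ?K\<^sup>2 * ?V * r powr (2 * real CARD('n) + \<beta> - 2)" .
qed

lemma smeared_source_eq_ball_integral:
  fixes y c :: "real ^ 'n"
  assumes r: "0 < r" and b: "0 < \<beta>"
  shows "smeared_source t0 c r (s, y) = (LINT e|lborel. ball_kernel \<beta> y e * ball_source \<beta> t0 c r s e)"
proof -
  let ?K = "bump_source_bound TYPE('n) / r\<^sup>2"
  let ?g = "(real CARD('n) + \<beta> + 1) / 2"
  \<comment> \<open>The two powers of the radius cancel, leaving the condition that the radius lies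
    between |y - w| and r.\<close>
  let ?f = "\<lambda>(\<rho>, w). (indicator {norm (y - w)<..<r} \<rho> :: real) * bump_source t0 c r (s, w)"
  have eq: "ball_kernel \<beta> y e * ball_source \<beta> t0 c r s e = ?f e" for e
  proof -
    obtain \<rho> w where e: "e = (\<rho>, w)" by (cases e)
    have "\<rho> powr (- (real CARD('n) + \<beta> + 1) / 2) * \<rho> powr ?g = 1" if "0 < \<rho>"
    proof -
      have "- (real CARD('n) + \<beta> + 1) / 2 + ?g = 0" by (simp only: minus_divide_left[symmetric] left_minus)
      then show ?thesis using that by (simp only: powr_add[symmetric]) simp
    qed
    moreover have "0 < \<rho>" if "norm (y - w) < \<rho>" using that norm_ge_zero[of "y - w"] by linarith
    ultimately show ?thesis
      by (auto simp: e ball_kernel_def ball_source_def simp flip: mult.assoc split: split_indicator)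
  qed
  have fm: "?f \<in> borel_measurable borel"
  proof -
    have "(\<lambda>e. ball_kernel \<beta> y e * ball_source \<beta> t0 c r s e) \<in> borel_measurable borel"
      by (intro borel_measurable_times ball_source_bounds(1)[OF r b]) measurable
    then show ?thesis unfolding eq by simp
  qed
  have iff: "integrable lborel ?f"
  proof (rule Bochner_Integration.integrable_bound)
    have "emeasure lborel ({0..r} \<times> cball c r) < \<infinity>" by (intro emeasure_bounded_finite bounded_Times) auto
    then show "integrable lborel (\<lambda>e. ?K * indicator ({0..r} \<times> cball c r) e)"
      by (intro Bochner_Integration.integrable_mult_right integrable_real_indicator) (auto intro!: borel_closed closed_Times)
    show "AE e in lborel. norm (?f e) \<le> norm (?K * indicator ({0..r} \<times> cball c r) e)"
    proof (intro AE_I2)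
      fix e :: "real \<times> (real ^ 'n)"
      obtain \<rho> w where e: "e = (\<rho>, w)" by (cases e)
      show "norm (?f e) \<le> norm (?K * indicator ({0..r} \<times> cball c r) e)"
      proof (cases "norm (y - w) < \<rho> \<and> \<rho> < r \<and> norm (w - c) < r")
        case True
        then have "0 \<le> \<rho>" using norm_ge_zero[of "y - w"] by linarith
        then show ?thesis using True bump_source_le[OF r, of t0 c "(s, w)"] bump_source_bound_pos[where 'n = 'n]
          by (simp add: e dist_norm norm_minus_commute)
      next
        case False
        then have "?f e = 0" using bump_source_eq_0_space[OF r, of w c t0 s] by (auto simp: e split: split_indicator)
        then show ?thesis by simp
      qed
    qed
  qed (use fm in simp)
  have iff': "integrable (lborel \<Otimes>\<^sub>M lborel) (\<lambda>(\<rho>, w). ?f (\<rho>, w))"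
    using iff by (simp add: lborel_prod)
  have "(LINT e|lborel. ball_kernel \<beta> y e * ball_source \<beta> t0 c r s e) = (LINT e|lborel. ?f e)" unfolding eq ..
  also have "\<dots> = (LINT \<rho>|lborel. LINT w|lborel. ?f (\<rho>, w))"
    using lborel_pair.integral_fst'[OF iff'] by (simp add: lborel_prod)
  also have "\<dots> = (LINT w|lborel. LINT \<rho>|lborel. ?f (\<rho>, w))"
    using lborel_pair.Fubini_integral[OF iff'] by simp
  \<comment> \<open>Integrating out the radius turns the indicator into the length of the interval,
    which is the tent.\<close>
  also have "\<dots> = (LINT w|lborel. tent r (y - w) * bump_source t0 c r (s, w))"
  proof (intro Bochner_Integration.integral_cong refl)
    fix w
    have "(LINT \<rho>|lborel. ?f (\<rho>, w)) = measure lborel {norm (y - w)<..<r} * bump_source t0 c r (s, w)" by simp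
    also have "measure lborel {norm (y - w)<..<r} = tent r (y - w)" by (simp add: tent_def measure_def max_def)
    finally show "(LINT \<rho>|lborel. ?f (\<rho>, w)) = tent r (y - w) * bump_source t0 c r (s, w)" .
  qed
  also have "\<dots> = (LINT z|lborel. tent r z * bump_source t0 c r (s, y - z))"
  proof -
    have l: "lborel = distr lborel borel (\<lambda>z :: real ^ 'n. y - z)"
      using lborel_affine[of "-1" y] by (simp add: density_1)
    have m: "(\<lambda>w. tent r (y - w) * bump_source t0 c r (s, w)) \<in> borel_measurable borel"
      by (intro borel_measurable_times bump_source_measurable_compose[OF r]) measurable
    show ?thesis by (subst l) (use m in \<open>simp add: integral_distr\<close>)
  qed
  finally show ?thesis by (simp add: smeared_source_def)
qed

lemma smeared_source_eq_0_time:
  assumes "0 < r" "r\<^sup>2 \<le> \<bar>s - t0\<bar>"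
  shows "smeared_source t0 c r (s, y) = 0"
  by (simp add: smeared_source_def bump_source_eq_0_time[OF assms])

text \<open>For fixed time the dual bound is the Cauchy--Schwarz inequality for the ball representation of the
  Riesz kernel; a second application in the time variable uses that the source lives on an
  interval of length \<open>2 r\<^sup>2\<close>.\<close>

lemma colored_dual_bound:
  fixes c :: "real ^ 'n"
  assumes b: "0 < \<beta>" and r: "0 < r" and A: "0 < A"
    and rep: "\<And>y z :: real ^ 'n. y \<noteq> z \<Longrightarrow>
      (\<integral>\<^sup>+e. ennreal (ball_kernel \<beta> y e * ball_kernel \<beta> z e) \<partial>lborel) = ennreal (A * norm (y - z) powr - \<beta>)"
  shows "dual_bound (colored_covariance \<beta>) (smeared_source t0 c r)
    (2 * r\<^sup>2 * (A * ((bump_source_bound TYPE('n))\<^sup>2 * unit_ball_vol (real CARD('n)) * r powr (2 * real CARD('n) + \<beta> - 2))))"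
    (is "dual_bound _ ?g (2 * r\<^sup>2 * (A * ?D))")
  unfolding dual_bound_def
proof (intro conjI ballI impI)
  have D: "0 \<le> ?D" by simp
  then show "0 \<le> 2 * r\<^sup>2 * (A * ?D)" using A by simp
  fix h :: "real \<times> (real ^ 'n) \<Rightarrow> real"
  assume h[measurable]: "h \<in> borel_measurable borel" and fin: "plus_norm_sq (colored_covariance \<beta>) h < \<infinity>"
    and int: "integrable lborel (\<lambda>p. h p * ?g p)"
  let ?G = "\<lambda>s (p :: (real ^ 'n) \<times> (real ^ 'n)). norm (fst p - snd p) powr - \<beta> * (h (s, fst p) * h (s, snd p))"
  define q where "q s = (LINT p|lborel. ?G s p)" for s
  have q1: "AE s in lborel. integrable lborel (?G s)" by (rule colored_form_slices(1)[OF h fin])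
  have q2: "integrable lborel q" "(LINT s|lborel. q s) = noise_form (colored_covariance \<beta>) h"
    unfolding q_def[abs_def] by (rule colored_form_slices(2)[OF h fin], rule colored_form_slices(3)[OF h fin])
  define a where "a s = (LINT y|lborel. h (s, y) * ?g (s, y))" for s
  have hs: "(\<lambda>y. h (s, y)) \<in> borel_measurable borel" for s
  proof -
    have "(\<lambda>y. (s, y)) \<in> borel \<rightarrow>\<^sub>M (borel :: (real \<times> (real ^ 'n)) measure)" by (intro borel_measurable_continuous_onI continuous_intros)
    from measurable_compose[OF this h] show ?thesis .
  qed
  have ae: "AE s in lborel. (a s)\<^sup>2 \<le> A * ?D * q s"
    using q1
  proof eventually_elim
    case (elim s)
    have fm: "(\<lambda>p :: (real ^ 'n) \<times> (real ^ 'n). A * norm (fst p - snd p) powr - \<beta>) \<in> borel_measurable borel"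
    proof -
      have "(\<lambda>p :: (real ^ 'n) \<times> (real ^ 'n). A * norm (fst p - snd p) powr - \<beta>) \<in> borel_measurable (borel \<Otimes>\<^sub>M borel)" by measurable
      then show ?thesis by (simp add: borel_prod)
    qed
    have i: "integrable lborel (\<lambda>p :: (real ^ 'n) \<times> (real ^ 'n). (A * norm (fst p - snd p) powr - \<beta>) * (h (s, fst p) * h (s, snd p)))"
      using elim by (simp add: mult.assoc)
    have f0: "0 \<le> A * norm (fst p - snd p) powr - \<beta>" for p :: "(real ^ 'n) \<times> (real ^ 'n)" using A by simp
    have repAE: "AE p :: (real ^ 'n) \<times> (real ^ 'n) in lborel. (\<integral>\<^sup>+e. ennreal (ball_kernel \<beta> (fst p) e * ball_kernel \<beta> (snd p) e) \<partial>lborel) = ennreal (A * norm (fst p - snd p) powr - \<beta>)"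
      using AE_off_diagonal by eventually_elim (rule rep)
    note kd = kernel_dual[OF ball_kernel_measurable ball_kernel_nonneg fm f0 repAE hs i ball_source_square(1)[OF r b]]
    have Aq: "(LINT p|lborel. (A * norm (fst p - snd p) powr - \<beta>) * (h (s, fst p) * h (s, snd p))) = A * q s"
      by (simp add: q_def mult.assoc)
    have le: "(a s)\<^sup>2 \<le> (LINT e|lborel. (ball_source \<beta> t0 c r s e)\<^sup>2) * (A * q s)"
      using kd(1)[of t0 c s] unfolding Aq by (simp add: a_def smeared_source_eq_ball_integral[OF r b])
    \<comment> \<open>The sign of the spatial form permits replacing the exact norm of
      \<open>ball_source\<close> by its time-independent bound; it comes from the same
      representation as the integral of a square.\<close>
    have Aq0: "0 \<le> A * q s" using kd(2) unfolding Aq .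
    have "(a s)\<^sup>2 \<le> ?D * (A * q s)"
      using le mult_right_mono[OF ball_source_square(2)[OF r b, of t0 c s] Aq0] by linarith
    then show ?case by (simp add: ac_simps)
  qed
  have supp: "a s = indicator {t0 - r\<^sup>2..t0 + r\<^sup>2} s * a s" for s
    using smeared_source_eq_0_time[OF r, of s t0 c] by (auto simp: a_def split: split_indicator)
  have int': "integrable (lborel \<Otimes>\<^sub>M lborel) (\<lambda>(s, y). h (s, y) * ?g (s, y))"
  proof -
    have "(\<lambda>(s, y). h (s, y) * ?g (s, y)) = (\<lambda>p. h p * ?g p)" by auto
    then show ?thesis using int by (simp only: lborel_prod)
  qed
  have ia: "integrable lborel a" unfolding a_def[abs_def] using lborel_pair.integrable_fst'[OF int'] by simp
  have sum: "(LINT p|lborel. h p * ?g p) = (LINT s|lborel. a s)"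
  proof -
    have "(\<lambda>(s, y). h (s, y) * ?g (s, y)) = (\<lambda>p. h p * ?g p)" by auto
    then show ?thesis unfolding a_def using lborel_pair.integral_fst'[OF int'] by (simp only: lborel_prod)
  qed
  have am: "a \<in> borel_measurable lborel" using ia by simp
  have iq: "integrable lborel (\<lambda>s. A * ?D * q s)" using q2(1) by simp
  have ia2: "integrable lborel (\<lambda>s. (a s)\<^sup>2)"
  proof (rule Bochner_Integration.integrable_bound[OF iq])
    show "AE s in lborel. norm ((a s)\<^sup>2) \<le> norm (A * ?D * q s)" using ae by eventually_elim simp
  qed (use am in simp)
  have sa: "square_integrable lborel a" using am ia2 by (simp add: square_integrable_def)
  have isq: "(indicat_real {t0 - r\<^sup>2..t0 + r\<^sup>2} s)\<^sup>2 = indicat_real {t0 - r\<^sup>2..t0 + r\<^sup>2} s" for s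
    by (simp split: split_indicator)
  have sI: "square_integrable lborel (indicat_real {t0 - r\<^sup>2..t0 + r\<^sup>2})"
    unfolding square_integrable_def isq by simp
  have I2: "(LINT s|lborel. (indicat_real {t0 - r\<^sup>2..t0 + r\<^sup>2} s)\<^sup>2) = 2 * r\<^sup>2"
    unfolding isq by simp
  have "(LINT p|lborel. h p * ?g p)\<^sup>2 = (LINT s|lborel. indicat_real {t0 - r\<^sup>2..t0 + r\<^sup>2} s * a s)\<^sup>2"
    unfolding sum supp[symmetric] ..
  also have "\<dots> \<le> 2 * r\<^sup>2 * (LINT s|lborel. (a s)\<^sup>2)"
    using square_integrable_cauchy_schwarz[OF sI sa] unfolding I2 .
  also have "\<dots> \<le> 2 * r\<^sup>2 * (LINT s|lborel. A * ?D * q s)"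
    using integral_mono_AE[OF ia2 iq ae] by (intro mult_left_mono) auto
  also have "\<dots> = 2 * r\<^sup>2 * (A * ?D) * noise_form (colored_covariance \<beta>) h" using q2(2) by simp
  finally show "(LINT p|lborel. h p * ?g p)\<^sup>2 \<le> 2 * r\<^sup>2 * (A * ?D) * noise_form (colored_covariance \<beta>) h" .
qed

lemma colored_has_localized_duals:
  assumes b: "0 < \<beta>"
  shows "has_localized_duals (colored_covariance \<beta> :: (real \<times> (real ^ 'n) \<times> (real ^ 'n)) measure) \<beta>"
proof -
  obtain A where A: "0 < A" and rep: "\<And>y z :: real ^ 'n. y \<noteq> z \<Longrightarrow>
      (\<integral>\<^sup>+e. ennreal (ball_kernel \<beta> y e * ball_kernel \<beta> z e) \<partial>lborel) = ennreal (A * norm (y - z) powr - \<beta>)"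
    using ball_kernel_represents[OF b, where 'n = 'n] by metis
  define K where "K = bump_source_bound TYPE('n)"
  define V where "V = unit_ball_vol (real CARD('n))"
  define m where "m = heat_mass TYPE('n)"
  define N where "N = CARD('n)"
  have pos: "0 < K" "0 < V" "0 < m"
    using bump_source_bound_pos heat_mass_pos by (auto simp: K_def V_def m_def)
  define L where "L r = m * (r / 8 * (V * (r / 2) ^ N))" for r :: real
  define \<kappa> where "\<kappa> r = 2 * r\<^sup>2 * (A * (K\<^sup>2 * V * r powr (2 * real N + \<beta> - 2)))" for r :: real
  \<comment> \<open>With \<open>L\<close> the lower bound of the pairing and \<kappa> the cost, this
    is the r-independent value of L^2 / (\<kappa> r^(2 - \<beta>)): the powers are r^(2N + 2)
    against r^(2N + \<beta>).\<close>
  define C where "C = (m / 8 * V / 2 ^ N)\<^sup>2 / (2 * A * K\<^sup>2 * V)"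
  have C: "0 < C" using pos A by (simp add: C_def)
  have CL: "C * \<kappa> r * r powr (2 - \<beta>) = (L r)\<^sup>2" if r: "0 < r" for r
  proof -
    have e: "r powr (2 * real N + \<beta> - 2) * r powr (2 - \<beta>) = r ^ (2 * N)"
    proof -
      have "r powr (2 * real N + \<beta> - 2) * r powr (2 - \<beta>) = r powr real (2 * N)"
        unfolding powr_add[symmetric] by (rule arg_cong[where f = "\<lambda>a. r powr a"]) simp
      then show ?thesis by (simp only: powr_realpow[OF r])
    qed
    have "C * \<kappa> r * r powr (2 - \<beta>) = C * (2 * A * K\<^sup>2 * V) * (r\<^sup>2 * (r powr (2 * real N + \<beta> - 2) * r powr (2 - \<beta>)))"
      by (simp add: \<kappa>_def)
    also have "\<dots> = (m / 8 * V / 2 ^ N)\<^sup>2 * (r\<^sup>2 * (r ^ N)\<^sup>2)"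
      unfolding e using pos A by (simp add: C_def power_mult mult.commute[of 2 N])
    also have "\<dots> = (L r)\<^sup>2" by (simp add: L_def power_mult_distrib power_divide)
    finally show ?thesis .
  qed
  show ?thesis
    unfolding has_localized_duals_def
  proof (intro exI[of _ C] conjI allI impI C)
    fix t0 r :: real and c :: "real ^ 'n"
    assume r: "0 < r" "r\<^sup>2 < t0"
    let ?g = "smeared_source t0 c r"
    show "\<exists>g \<kappa>. localized_dual (colored_covariance \<beta>) t0 c r g \<kappa> \<and>
       C * \<kappa> * r powr (2 - \<beta>) \<le> (LINT p|lborel. heat_integrand (t0, c) p * g p)\<^sup>2"
      unfolding localized_dual_def
    proof (rule exI[of _ ?g], rule exI[of _ "\<kappa> r"], intro conjI allI impI)
      show "0 < \<kappa> r" using pos A r by (simp add: \<kappa>_def)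
      show "dual_bound (colored_covariance \<beta>) ?g (\<kappa> r)"
        using colored_dual_bound[OF b r(1) A rep, of t0 c] by (simp add: \<kappa>_def K_def V_def N_def)
      show "?g \<in> borel_measurable borel" by (rule smeared_source_measurable[OF r(1)])
      show "\<exists>K. \<forall>p. \<bar>?g p\<bar> \<le> K" using smeared_source_bounded[OF r(1)] by blast
      fix t and x :: "real ^ 'n" assume t: "0 \<le> t" and "r\<^sup>2 \<le> \<bar>t - t0\<bar> \<or> 2 * r \<le> norm (x - c)"
      then have "time_bump t0 r t = 0 \<or> (LINT z|lborel. tent r z * space_bump c r (x - z)) = 0"
        using r by (auto intro: time_bump_eq_0 tent_space_bump_integral_eq_0)
      then show "(LINT p|lborel. heat_integrand (t, x) p * ?g p) = 0"
        unfolding heat_integral_smeared_source[OF r t] by auto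
    next
      have t0: "0 \<le> t0" using r order_trans[OF zero_le_power2 less_imp_le[OF r(2)]] by simp
      have "L r \<le> (LINT p|lborel. heat_integrand (t0, c) p * ?g p)"
        unfolding heat_integral_smeared_source[OF r t0]
        using tent_space_bump_integral_ge[OF r(1), of c] pos by (simp add: L_def m_def V_def N_def)
      moreover have "0 \<le> L r" using pos r by (simp add: L_def)
      ultimately show "C * \<kappa> r * r powr (2 - \<beta>) \<le> (LINT p|lborel. heat_integrand (t0, c) p * ?g p)\<^sup>2"
        unfolding CL[OF r(1)] by (rule power_mono)
    qed
  qed
qed

section \<open>The lower bound\<close>

text \<open>The test function is centred at \<open>p\<close> with radius a small multiple of the parabolic distance \<open>\<epsilon>\<close> from
  \<open>p\<close> to the points \<open>q i\<close>, so it does not see these; the factor \<open>\<theta>\<close> also keeps its support inside positive times.\<close>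

lemma wiener_variance_lower_bound:
  fixes \<Lambda> :: "(real \<times> (real ^ 'n) \<times> (real ^ 'n)) measure" and u :: "real \<times> (real ^ 'n) \<Rightarrow> 'a \<Rightarrow> real"
  assumes M: "prob_space M" and W: "gaussian_noise M \<Lambda> W" and loc: "locally_finite_covariance \<Lambda>"
    and duals: "has_localized_duals \<Lambda> \<beta>" and \<beta>: "\<beta> < 2"
    and u: "\<And>t x. 0 \<le> t \<Longrightarrow> has_wiener_integral M \<Lambda> W (heat_integrand (t, x)) (u (t, x))"
    and a: "0 < a" "a < b"
  shows "\<exists>C>0. \<forall>n\<ge>1. \<forall>p q (e :: nat \<Rightarrow> real). p \<in> {a..b} \<times> {x. \<forall>k. x $ k \<in> {-b..b}} \<longrightarrow>
    (\<forall>i\<in>{1..n}. q i \<in> {a..b} \<times> {x. \<forall>k. x $ k \<in> {-b..b}}) \<longrightarrow>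
    C * Min ((\<lambda>i. (she_metric \<beta> p (q i))\<^sup>2) ` {1..n}) \<le> (LINT \<omega>|M. (u p \<omega> - (\<Sum>i\<in>{1..n}. e i * u (q i) \<omega>))\<^sup>2)"
proof -
  obtain C where C: "0 < C" and dual: "\<forall>t0 (c :: real ^ 'n) r. 0 < r \<longrightarrow> r\<^sup>2 < t0 \<longrightarrow>
     (\<exists>g \<kappa>. localized_dual \<Lambda> t0 c r g \<kappa> \<and> C * \<kappa> * r powr (2 - \<beta>) \<le> (LINT p|lborel. heat_integrand (t0, c) p * g p)\<^sup>2)"
    using duals unfolding has_localized_duals_def by (elim exE conjE) (rule that)
  let ?B = "{a..b} \<times> {x :: real ^ 'n. \<forall>k. x $ k \<in> {-b..b}}"
  have b0: "0 < b" using a by simp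
  define h where "h = 2 - \<beta>"
  have h: "0 < h" using \<beta> by (simp add: h_def)
  \<comment> \<open>An upper bound for the parabolic distance of two points of the box: time
    differences are at most b, and the spatial difference is bounded through the l1 norm.\<close>
  define E where "E = sqrt b + 2 * (b * real CARD('n))"
  have E: "0 < E" using b0 by (simp add: E_def add_pos_nonneg)
  \<comment> \<open>The bound 1/4 keeps twice the radius below the distance to the
    \<open>q i\<close>; the second bound makes the radius at most sqrt(a)/2, so its square stays
    below every admissible time.\<close>
  define \<theta> where "\<theta> = min (1 / 4) (sqrt a / (2 * E))"
  have \<theta>: "0 < \<theta>" "\<theta> \<le> 1 / 4" "\<theta> * E \<le> sqrt a / 2"
  proof -
    show "0 < \<theta>" "\<theta> \<le> 1 / 4" using a E by (auto simp: \<theta>_def)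
    have "\<theta> * E \<le> sqrt a / (2 * E) * E" using E by (intro mult_right_mono) (auto simp: \<theta>_def)
    then show "\<theta> * E \<le> sqrt a / 2" using E by simp
  qed
  show ?thesis
  \<comment> \<open>The divisor 4 absorbs the factor from squaring the estimate
    \<open>metric\<close>.\<close>
  proof (intro exI[of _ "C * \<theta> powr h / 4"] conjI allI impI)
    show "0 < C * \<theta> powr h / 4" using C \<theta> by simp
    fix n :: nat and p and q :: "nat \<Rightarrow> real \<times> (real ^ 'n)" and e :: "nat \<Rightarrow> real"
    assume n: "1 \<le> n" and p: "p \<in> ?B" and q: "\<forall>i\<in>{1..n}. q i \<in> ?B"
    obtain t0 c where pe: "p = (t0, c)" by (cases p)
    have t0: "a \<le> t0" "t0 \<le> b" using p by (auto simp: pe)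
    have c: "\<bar>c $ k\<bar> \<le> b" for k
    proof -
      have "- b \<le> c $ k \<and> c $ k \<le> b" using p by (simp add: pe)
      then show ?thesis by linarith
    qed
    \<comment> \<open>The parabolic distance to \<open>p\<close>. A maximum rather than a sum, so
      that distance at least \<epsilon> means distance \<epsilon> in time or in space, the two
      alternatives in \<open>localized_dual\<close>.\<close>
    define \<delta> where "\<delta> i = max (sqrt \<bar>fst (q i) - t0\<bar>) (norm (snd (q i) - c))" for i
    define \<epsilon> where "\<epsilon> = Min (\<delta> ` {1..n})"
    have fin: "finite (\<delta> ` {1..n})" "\<delta> ` {1..n} \<noteq> {}" using n by auto
    have \<delta>0: "0 \<le> \<delta> i" for i by (simp add: \<delta>_def le_max_iff_disj)
    have \<delta>E: "\<delta> i \<le> E" if i: "i \<in> {1..n}" for i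
    proof -
      obtain t x where qe: "q i = (t, x)" by (cases "q i")
      have qB: "(t, x) \<in> ?B" using q i unfolding qe[symmetric] by blast
      then have t: "a \<le> t" "t \<le> b" by auto
      have x: "\<bar>x $ k\<bar> \<le> b" for k
      proof -
        have "- b \<le> x $ k \<and> x $ k \<le> b" using qB by simp
        then show ?thesis by linarith
      qed
      have "\<bar>t - t0\<bar> \<le> b" using t t0 a by linarith
      then have 1: "sqrt \<bar>t - t0\<bar> \<le> E" using b0 by (simp add: E_def add_increasing2)
      have "norm (x - c) \<le> (\<Sum>k\<in>UNIV. \<bar>(x - c) $ k\<bar>)" by (rule norm_le_l1_cart)
      also have "\<dots> \<le> (\<Sum>k\<in>(UNIV :: 'n set). 2 * b)"
      proof (rule sum_mono)
        fix k
        show "\<bar>(x - c) $ k\<bar> \<le> 2 * b" using x[of k] c[of k] by simp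
      qed
      also have "\<dots> \<le> E" using b0 by (simp add: E_def)
      finally show ?thesis using 1 by (simp add: \<delta>_def qe)
    qed
    \<comment> \<open>The metric has exponent h/4 in time and h/2 in space, so each of its two terms
      is at most the power h/2 of the parabolic distance.\<close>
    have metric: "she_metric \<beta> p (q i) \<le> 2 * \<delta> i powr (h / 2)" for i
    proof -
      obtain t x where qe: "q i = (t, x)" by (cases "q i")
      have "\<bar>t - t0\<bar> powr (h / 4) = sqrt \<bar>t - t0\<bar> powr (h / 2)"
        by (simp add: powr_half_sqrt[symmetric] powr_powr)
      also have "\<dots> \<le> \<delta> i powr (h / 2)" using h by (intro powr_mono2) (auto simp: \<delta>_def qe)
      finally have 1: "\<bar>t - t0\<bar> powr (h / 4) \<le> \<delta> i powr (h / 2)" .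
      have 2: "norm (x - c) powr (h / 2) \<le> \<delta> i powr (h / 2)" using h by (intro powr_mono2) (auto simp: \<delta>_def qe)
      show ?thesis using 1 2 by (simp add: she_metric_def pe qe h_def abs_minus_commute norm_minus_commute)
    qed
    have "\<epsilon> \<in> \<delta> ` {1..n}" unfolding \<epsilon>_def by (rule Min_in[OF fin])
    then obtain i0 where i0: "i0 \<in> {1..n}" "\<epsilon> = \<delta> i0" by auto
    have \<epsilon>le: "\<epsilon> \<le> \<delta> i" if "i \<in> {1..n}" for i unfolding \<epsilon>_def using that by (intro Min_le) auto
    have \<epsilon>: "0 \<le> \<epsilon>" "\<epsilon> \<le> E" using i0 \<delta>0 \<delta>E by auto
    have m0: "0 \<le> she_metric \<beta> p (q i0)" by (simp add: she_metric_def split: prod.split)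
    have "Min ((\<lambda>i. (she_metric \<beta> p (q i))\<^sup>2) ` {1..n}) \<le> (she_metric \<beta> p (q i0))\<^sup>2"
      using i0 by (intro Min_le) auto
    also have "\<dots> \<le> (2 * \<epsilon> powr (h / 2))\<^sup>2"
      using metric[of i0] m0 i0 by (intro power_mono) auto
    also have "\<dots> = 4 * \<epsilon> powr h"
      by (simp add: power_mult_distrib power2_eq_square powr_add[symmetric])
    finally have Min: "Min ((\<lambda>i. (she_metric \<beta> p (q i))\<^sup>2) ` {1..n}) \<le> 4 * \<epsilon> powr h" .
    have goal: "C * (\<theta> * \<epsilon>) powr h \<le> (LINT \<omega>|M. (u p \<omega> - (\<Sum>i\<in>{1..n}. e i * u (q i) \<omega>))\<^sup>2)"
    proof (cases "\<epsilon> = 0")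
      \<comment> \<open>If \<open>p\<close> is one of the \<open>q i\<close>, the left side is 0
        because 0 \<open>powr\<close> h is 0.\<close>
      case True
      then show ?thesis by simp
    next
      case False
      define r where "r = \<theta> * \<epsilon>"
      have r: "0 < r" using False \<epsilon> \<theta> by (simp add: r_def)
      have "r \<le> \<theta> * E" using \<epsilon> \<theta> unfolding r_def by (intro mult_left_mono) auto
      then have "r \<le> sqrt a / 2" using \<theta> by linarith
      then have "r\<^sup>2 \<le> (sqrt a / 2)\<^sup>2" using r by (intro power_mono) auto
      also have "\<dots> < t0" using a t0 by (simp add: power_divide)
      finally have r2: "r\<^sup>2 < t0" .
      have r4: "r \<le> \<epsilon> / 4" using \<theta> \<epsilon> mult_right_mono[of \<theta> "1 / 4" \<epsilon>] by (simp add: r_def)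
      obtain g \<kappa> where ld: "localized_dual \<Lambda> t0 c r g \<kappa>"
        and ge: "C * \<kappa> * r powr h \<le> (LINT p|lborel. heat_integrand (t0, c) p * g p)\<^sup>2"
        using dual[rule_format, OF r r2, of c] unfolding h_def by blast
      have \<kappa>: "0 < \<kappa>" and g: "dual_bound \<Lambda> g \<kappa>" and gm: "g \<in> borel_measurable borel"
        using ld unfolding localized_dual_def by blast+
      have zero: "(LINT p|lborel. heat_integrand (t, x) p * g p) = 0"
        if "0 \<le> t" "r\<^sup>2 \<le> \<bar>t - t0\<bar> \<or> 2 * r \<le> norm (x - c)" for t x
        using ld that unfolding localized_dual_def by blast
      obtain K where K: "\<And>p. \<bar>g p\<bar> \<le> K" using ld unfolding localized_dual_def by blast
      \<comment> \<open>\<open>p\<close> takes the free index 0 with coefficient 1, so the residual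
        is one linear combination of Wiener integrals.\<close>
      define Q where "Q i = (if i = 0 then p else q i)" for i :: nat
      define d where "d i = (if i = 0 then 1 else - e i)" for i :: nat
      have Qt: "0 \<le> fst (Q i)" if "i \<in> {0..n}" for i
      proof (cases "i = 0")
        case True
        then show ?thesis using t0 a by (simp add: Q_def pe)
      next
        case False
        then have "q i \<in> ?B" using that q by auto
        then show ?thesis using a False by (auto simp: Q_def mem_Times_iff)
      qed
      have hw: "has_wiener_integral M \<Lambda> W (heat_integrand (Q i)) (u (Q i))" if "i \<in> {0..n}" for i
        using u[of "fst (Q i)" "snd (Q i)"] Qt[OF that] by simp
      have split0: "(\<Sum>i\<in>{0..n}. d i * f (Q i)) = f p - (\<Sum>i\<in>{1..n}. e i * f (q i))" for f :: "_ \<Rightarrow> real"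
      proof -
        have "(\<Sum>i\<in>{0..n}. d i * f (Q i)) = d 0 * f (Q 0) + (\<Sum>i\<in>{Suc 0..n}. d i * f (Q i))" by (rule sum.atLeast_Suc_atMost) simp
        also have "(\<Sum>i\<in>{Suc 0..n}. d i * f (Q i)) = (\<Sum>i\<in>{Suc 0..n}. - (e i * f (q i)))" by (intro sum.cong) (auto simp: d_def Q_def)
        finally show ?thesis by (simp add: d_def Q_def sum_negf)
      qed
      have "(\<Sum>i\<in>{0..n}. d i * (LINT p|lborel. heat_integrand (Q i) p * g p))\<^sup>2 \<le> \<kappa> * (LINT \<omega>|M. (\<Sum>i\<in>{0..n}. d i * u (Q i) \<omega>)\<^sup>2)"
      proof (rule wiener_combination(3)[where I = "{0..n}" and X = "\<lambda>i. u (Q i)" and f = "\<lambda>i. heat_integrand (Q i)", OF M W loc _ hw g])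
        show "integrable lborel (\<lambda>p. indicator A p * g p)" if "A \<in> bounded_borel" for A
        proof (rule Bochner_Integration.integrable_bound)
          show "integrable lborel (\<lambda>p. K * indicator A p)"
            using that by (intro Bochner_Integration.integrable_mult_right integrable_real_indicator emeasure_bounded_finite) (auto simp: bounded_borel_def)
          show "(\<lambda>p. indicator A p * g p) \<in> borel_measurable lborel" using that gm by (auto simp: bounded_borel_def)
          show "AE p in lborel. norm (indicator A p * g p) \<le> norm (K * indicator A p)"
            using order_trans[OF K abs_ge_self] by (intro AE_I2) (simp split: split_indicator)
        qed
        show "integrable lborel (\<lambda>p. heat_integrand (Q i) p * g p)" if "i \<in> {0..n}" for i
          by (rule heat_integrand_integrable[OF Qt[OF that] gm K])
      qed auto
      \<comment> \<open>All terms with \<open>i \<ge> 1\<close> vanish because the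
        \<open>q i\<close> lie outside the cylinder, whatever the coefficients \<open>e i\<close>
        are.\<close>
      also have "(\<Sum>i\<in>{0..n}. d i * (LINT p|lborel. heat_integrand (Q i) p * g p)) = (LINT p'|lborel. heat_integrand (t0, c) p' * g p')"
      proof -
        have "(LINT p|lborel. heat_integrand (q i) p * g p) = 0" if i: "i \<in> {1..n}" for i
        proof -
          obtain t x where qe: "q i = (t, x)" by (cases "q i")
          have "(t, x) \<in> ?B" using q i unfolding qe[symmetric] by blast
          then have t: "0 \<le> t" using a by auto
          have "\<epsilon> \<le> sqrt \<bar>t - t0\<bar> \<or> \<epsilon> \<le> norm (x - c)" using \<epsilon>le[OF i] by (auto simp: \<delta>_def qe max_def split: if_splits)
          then have "r\<^sup>2 \<le> \<bar>t - t0\<bar> \<or> 2 * r \<le> norm (x - c)"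
          proof
            assume "\<epsilon> \<le> sqrt \<bar>t - t0\<bar>"
            then have "r \<le> sqrt \<bar>t - t0\<bar>" using r4 \<epsilon> by linarith
            then have "r\<^sup>2 \<le> (sqrt \<bar>t - t0\<bar>)\<^sup>2" using r by (intro power_mono) auto
            then show ?thesis by simp
          next
            assume "\<epsilon> \<le> norm (x - c)"
            then show ?thesis using r4 \<epsilon> by linarith
          qed
          then show ?thesis unfolding qe by (rule zero[OF t])
        qed
        then show ?thesis using split0[of "\<lambda>q. LINT p|lborel. heat_integrand q p * g p"] by (simp add: pe)
      qed
      also have "(\<lambda>\<omega>. (\<Sum>i\<in>{0..n}. d i * u (Q i) \<omega>)) = (\<lambda>\<omega>. u p \<omega> - (\<Sum>i\<in>{1..n}. e i * u (q i) \<omega>))"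
        using split0[of "\<lambda>q. u q \<omega>" for \<omega>] by (rule ext)
      finally have "C * \<kappa> * r powr h \<le> \<kappa> * (LINT \<omega>|M. (u p \<omega> - (\<Sum>i\<in>{1..n}. e i * u (q i) \<omega>))\<^sup>2)"
        using ge by linarith
      then have "\<kappa> * (C * r powr h) \<le> \<kappa> * (LINT \<omega>|M. (u p \<omega> - (\<Sum>i\<in>{1..n}. e i * u (q i) \<omega>))\<^sup>2)" by (simp add: ac_simps)
      then show ?thesis using \<kappa> unfolding r_def by (simp only: mult_le_cancel_left_pos)
    qed
    have "C * \<theta> powr h / 4 * Min ((\<lambda>i. (she_metric \<beta> p (q i))\<^sup>2) ` {1..n}) \<le> C * \<theta> powr h / 4 * (4 * \<epsilon> powr h)"
      using C by (intro mult_left_mono[OF Min]) simp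
    also have "\<dots> = C * (\<theta> * \<epsilon>) powr h" using \<theta> \<epsilon> by (simp add: powr_mult)
    also note goal
    finally show "C * \<theta> powr h / 4 * Min ((\<lambda>i. (she_metric \<beta> p (q i))\<^sup>2) ` {1..n}) \<le> (LINT \<omega>|M. (u p \<omega> - (\<Sum>i\<in>{1..n}. e i * u (q i) \<omega>))\<^sup>2)" .
  qed
qed

theorem proposition5p1:
  fixes M :: "'a measure"
    and \<beta> a b :: real
    and d :: nat
    and \<Lambda> :: "(real \<times> (real ^ 'n) \<times> (real ^ 'n)) measure"
    and W :: "nat \<Rightarrow> (real \<times> (real ^ 'n)) set \<Rightarrow> 'a \<Rightarrow> real"
    and u :: "nat \<Rightarrow> real \<times> (real ^ 'n) \<Rightarrow> 'a \<Rightarrow> real"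
  assumes "prob_space M"
    and "d \<ge> 1"
    and "(0 < \<beta> \<and> \<beta> < min 2 (real CARD('n)) \<and> \<Lambda> = colored_covariance \<beta>) \<or>
         (CARD('n) = 1 \<and> \<beta> = 1 \<and> \<Lambda> = white_covariance)"
    and "iid_gaussian_noises M \<Lambda> d W"
    and "stochastic_heat_solution M \<Lambda> d W u"
    and "0 < a" and "a < b"
  shows "\<exists>C>0. \<forall>n\<ge>1. \<forall>(p :: real \<times> (real ^ 'n)) (q :: nat \<Rightarrow> real \<times> (real ^ 'n)).
           p \<in> {a..b} \<times> {x. \<forall>k. x $ k \<in> {-b..b}} \<and>
           (\<forall>i\<in>{1..n}. q i \<in> {a..b} \<times> {x. \<forall>k. x $ k \<in> {-b..b}}) \<longrightarrow>
           (AE \<omega> in M. cond_variance M (generated_by M {1..n} (\<lambda>i. u 1 (q i))) (u 1 p) \<omega>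
              \<ge> C * Min ((\<lambda>i. (she_metric \<beta> p (q i))\<^sup>2) ` {1..n}))"
proof -
  interpret prob_space M by (rule assms(1))
  have one: "1 \<in> {1..d}" using assms(2) by simp
  have W: "gaussian_noise M \<Lambda> (W 1)" using assms(4) one unfolding iid_gaussian_noises_def by blast
  have loc: "locally_finite_covariance \<Lambda>"
    using assms(3) locally_finite_colored[of \<beta>, where 'n = 'n] locally_finite_white[where 'n = 'n] by auto
  have duals: "has_localized_duals \<Lambda> \<beta>"
    using assms(3) colored_has_localized_duals[of \<beta>, where 'n = 'n] white_has_localized_duals[where 'n = 'n] by auto
  have \<beta>: "\<beta> < 2" using assms(3) by auto
  have u: "has_wiener_integral M \<Lambda> (W 1) (heat_integrand (t, x)) (u 1 (t, x))" if "0 \<le> t" for t x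
    using assms(5) one that unfolding stochastic_heat_solution_def heat_integrand_def by simp
  obtain C where C: "0 < C" and bound: "\<And>n p q (e :: nat \<Rightarrow> real). 1 \<le> n \<Longrightarrow> p \<in> {a..b} \<times> {x. \<forall>k. x $ k \<in> {-b..b}} \<Longrightarrow>
    (\<forall>i\<in>{1..n}. q i \<in> {a..b} \<times> {x. \<forall>k. x $ k \<in> {-b..b}}) \<Longrightarrow>
    C * Min ((\<lambda>i. (she_metric \<beta> p (q i))\<^sup>2) ` {1..n}) \<le> (LINT \<omega>|M. (u 1 p \<omega> - (\<Sum>i\<in>{1..n}. e i * u 1 (q i) \<omega>))\<^sup>2)"
    using wiener_variance_lower_bound[OF assms(1) W loc duals \<beta> u assms(6,7)] by blast
  show ?thesis
  proof (intro exI[of _ C] conjI C allI impI, elim conjE)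
    fix n :: nat and p :: "real \<times> (real ^ 'n)" and q :: "nat \<Rightarrow> real \<times> (real ^ 'n)"
    assume n: "1 \<le> n" and p: "p \<in> {a..b} \<times> {x. \<forall>k. x $ k \<in> {-b..b}}"
      and q: "\<forall>i\<in>{1..n}. q i \<in> {a..b} \<times> {x. \<forall>k. x $ k \<in> {-b..b}}"
    have up: "has_wiener_integral M \<Lambda> (W 1) (heat_integrand p) (u 1 p)"
      using u[of "fst p" "snd p"] p assms(6) by (auto simp: mem_Times_iff)
    have uq: "has_wiener_integral M \<Lambda> (W 1) (heat_integrand (q i)) (u 1 (q i))" if "i \<in> {1..n}" for i
    proof -
      have "q i \<in> {a..b} \<times> {x. \<forall>k. x $ k \<in> {-b..b}}" using q that by blast
      then show ?thesis using u[of "fst (q i)" "snd (q i)"] assms(6) by (auto simp: mem_Times_iff)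
    qed
    \<comment> \<open>Index 0 again stands for \<open>p\<close>, so that joint Gaussianity of
      \<open>u 1 p\<close> and the \<open>u 1 (q i)\<close> is an instance of
      \<open>wiener_combination\<close>.\<close>
    define Q where "Q i = (if i = 0 then p else q i)" for i :: nat
    have uQ: "has_wiener_integral M \<Lambda> (W 1) (heat_integrand (Q i)) (u 1 (Q i))" if "i \<in> {0..n}" for i
      using up uq that by (cases "i = 0") (auto simp: Q_def)
    note wc = wiener_combination(1,2)[where I = "{0..n}" and X = "\<lambda>i. u 1 (Q i)" and f = "\<lambda>i. heat_integrand (Q i)",
      OF assms(1) W loc finite_atLeastAtMost uQ]
    have split0: "(\<Sum>i\<in>{0..n}. (if i = 0 then c0 else c i) * u 1 (Q i) \<omega>) = c0 * u 1 p \<omega> + (\<Sum>i\<in>{1..n}. c i * u 1 (q i) \<omega>)" for c0 c \<omega>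
    proof -
      have "(\<Sum>i\<in>{0..n}. (if i = 0 then c0 else c i) * u 1 (Q i) \<omega>) =
        (if 0 = (0::nat) then c0 else c 0) * u 1 (Q 0) \<omega> + (\<Sum>i\<in>{Suc 0..n}. (if i = 0 then c0 else c i) * u 1 (Q i) \<omega>)"
        by (rule sum.atLeast_Suc_atMost) simp
      also have "(\<Sum>i\<in>{Suc 0..n}. (if i = 0 then c0 else c i) * u 1 (Q i) \<omega>) = (\<Sum>i\<in>{Suc 0..n}. c i * u 1 (q i) \<omega>)"
        by (intro sum.cong) (auto simp: Q_def)
      finally show ?thesis by (simp add: Q_def)
    qed
    have sq: "square_integrable M (\<lambda>\<omega>. c0 * u 1 p \<omega> + (\<Sum>i\<in>{1..n}. c i * u 1 (q i) \<omega>))" for c0 c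
      using wc(1)[where a = "\<lambda>i. if i = 0 then c0 else c i"] unfolding split0 .
    have ch: "(CLINT \<omega>|M. iexp (c0 * u 1 p \<omega> + (\<Sum>i\<in>{1..n}. c i * u 1 (q i) \<omega>))) =
      exp (- (LINT \<omega>|M. (c0 * u 1 p \<omega> + (\<Sum>i\<in>{1..n}. c i * u 1 (q i) \<omega>))\<^sup>2) / 2)" for c0 c
      using wc(2)[where a = "\<lambda>i. if i = 0 then c0 else c i"] unfolding split0 .
    have sp: "square_integrable M (u 1 p)" using sq[of 1 "\<lambda>_. 0"] by simp
    have sqi: "square_integrable M (u 1 (q i))" if i: "i \<in> {1..n}" for i
    proof -
      have "(\<Sum>j\<in>{1..n}. (if j = i then 1 else 0) * u 1 (q j) \<omega>) = u 1 (q i) \<omega>" for \<omega>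
        using i by (simp add: if_distrib[where f = "\<lambda>c. c * _"] cong: if_cong)
      then show ?thesis using sq[of 0 "\<lambda>j. if j = i then 1 else 0"] by (simp only: mult_zero_left add_0)
    qed
    \<comment> \<open>The projection coefficients \<open>c\<close> are not known explicitly, but
      \<open>bound\<close> holds for every choice.\<close>
    obtain c where "AE \<omega> in M. cond_variance M (generated_by M {1..n} (\<lambda>i. u 1 (q i))) (u 1 p) \<omega> =
      (LINT \<omega>|M. (u 1 p \<omega> - (\<Sum>i\<in>{1..n}. c i * u 1 (q i) \<omega>))\<^sup>2)"
      using gaussian_cond_variance[of "{1..n}" "u 1 p" "\<lambda>i. u 1 (q i)", OF _ sp sqi ch] by auto
    then show "AE \<omega> in M. cond_variance M (generated_by M {1..n} (\<lambda>i. u 1 (q i))) (u 1 p) \<omega> \<ge>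
      C * Min ((\<lambda>i. (she_metric \<beta> p (q i))\<^sup>2) ` {1..n})"
      by eventually_elim (use bound[OF n p q, of c] in simp)
  qed
qed

end
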